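(* Let $\beta$ be a real number with $|\beta|>1$ and let $K(\beta)$ be the support of the associated Parry–Yrrap measure. Let $\psi:\mathbb{R}^+\to\mathbb{R}^+$ be a real positive decreasing function and $a\in K(\beta)$. Then $$\dim_{\rm H}W(T_\beta,\psi,a)=\frac{\log|\beta|}{\lambda+\log|\beta|}.$$
   Context: $T_\beta:[0,1)\to[0,1)$ is $T_\beta(x)=\beta x\ (\mathrm{mod}\ 1)$, also regarded as a map of $\mathbb{T}=\mathbb{R}/\mathbb{Z}$. The Parry–Yrrap measure $\mu_\beta$ is the unique $T_\beta$-invariant probability measure absolutely continuous with respect to one-dimensional Lebesgue measure; $K(\beta)\subseteq[0,1]$ is its support. $W(T_\beta,\psi,a):=\{x\in\mathbb{T}:\|T_\beta^n(x)-a\|\le\psi(n)\text{ for infinitely many }n\in\mathbb{N}\}$, where $\|\cdot\|$ is the distance to the nearest integer. $\lambda=\lambda(\psi):=\liminf_{n\to\infty}\frac{-\log\psi(n)}{n}$ is the lower order at infinity of $\psi$; if $\lambda=+\infty$ the right-hand side is read as $0$. $\dim_{\rm H}$ is Hausdorff dimension. *)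

theory Defs
  imports "HOL-Probability.Probability"
begin

section \<open>Hausdorff measure and Hausdorff dimension\<close>

text \<open>
  The \<open>s\<close>-th power of the diameter, with the conventions \<open>diam {} ^ s = 0\<close> and \<open>diam U ^ 0 = 1\<close>
  for nonempty \<open>U\<close> (whereas \<open>0 powr 0 = 0\<close>). Since the library's \<^const>\<open>diameter\<close> is \<open>0\<close> on
  unbounded sets, it is only used for bounded sets below.
\<close>

definition diam_powr :: "real \<Rightarrow> 'a::metric_space set \<Rightarrow> ennreal" where
  "diam_powr s U =
     (if U = {} then 0 else if s = 0 then 1 else ennreal (diameter U powr s))"

definition hausdorff_premeasure :: "real \<Rightarrow> real \<Rightarrow> 'a::metric_space set \<Rightarrow> ennreal" where
  "hausdorff_premeasure s \<delta> A =
     (INF U \<in> {U :: nat \<Rightarrow> 'a set.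
                 A \<subseteq> (\<Union>i. U i) \<and> (\<forall>i. bounded (U i) \<and> diameter (U i) \<le> \<delta>)}.
        \<Sum>i. diam_powr s (U i))"

definition hausdorff_measure :: "real \<Rightarrow> 'a::metric_space set \<Rightarrow> ennreal" where
  "hausdorff_measure s A = (SUP \<delta> \<in> {0<..}. hausdorff_premeasure s \<delta> A)"

definition hausdorff_dim :: "'a::metric_space set \<Rightarrow> ereal" where
  "hausdorff_dim A = (INF s \<in> {s. 0 \<le> s \<and> hausdorff_measure s A = 0}. ereal s)"


section \<open>The transformation \<open>x \<mapsto> \<beta> x (mod 1)\<close> and its absolutely continuous invariant measure\<close>

definition beta_map :: "real \<Rightarrow> real \<Rightarrow> real" where
  "beta_map \<beta> x = frac (\<beta> * x)"

text \<open>
  Measures on \<open>[0,1)\<close> are represented as Borel measures on the real line that are concentrated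
  on \<open>[0,1)\<close>. For \<open>\<bar>\<beta>\<bar> > 1\<close> exactly one measure satisfies this predicate.
\<close>

definition parry_yrrap_measure :: "real \<Rightarrow> real measure \<Rightarrow> bool" where
  "parry_yrrap_measure \<beta> \<mu> \<longleftrightarrow>
     prob_space \<mu> \<and> sets \<mu> = sets borel \<and> emeasure \<mu> {0..<1} = 1 \<and>
     distr \<mu> \<mu> (beta_map \<beta>) = \<mu> \<and>
     absolutely_continuous lborel \<mu>"

definition measure_support :: "'a::topological_space measure \<Rightarrow> 'a set" where
  "measure_support \<mu> = {x. \<forall>U. open U \<and> x \<in> U \<longrightarrow> emeasure \<mu> U > 0}"


section \<open>The shrinking target set and the lower order\<close>

definition int_dist :: "real \<Rightarrow> real" where
  "int_dist x = infdist x \<int>"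

text \<open>
  The circle is represented by \<open>[0,1)\<close>. With the Euclidean metric in place of the circle metric
  this leaves Hausdorff dimensions unchanged, as the two metrics agree on each of \<open>[0,1/2)\<close> and
  \<open>[1/2,1)\<close>.
\<close>

definition target_set :: "(real \<Rightarrow> real) \<Rightarrow> (real \<Rightarrow> real) \<Rightarrow> real \<Rightarrow> real set" where
  "target_set T \<psi> a = {x \<in> {0..<1}. \<exists>\<^sub>\<infinity>n. int_dist ((T ^^ n) x - a) \<le> \<psi> (real n)}"

text \<open>
  The lower order may be \<open>\<infinity>\<close>; in \<^typ>\<open>ereal\<close>, \<open>r / \<infinity> = 0\<close> for real \<open>r\<close>.
\<close>

definition lower_order :: "(real \<Rightarrow> real) \<Rightarrow> ereal" where
  "lower_order \<psi> = liminf (\<lambda>n. ereal (- ln (\<psi> (real n)) / real n))"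

end

theory Submission
  imports Defs
begin

text \<open>
  Write \<open>s = \<bar>\<beta>\<bar>\<close>. The iterate \<open>T ^^ n\<close> is affine with slope \<open>\<beta> ^ n\<close> on each of at most \<open>C * s ^ n\<close>
  intervals, which gives the upper bound by covering the preimages of the targets.

  For the lower bound, an interval on which no iterate is cut at an integer point would grow for ever;
  hence some iterate of every interval covers a punctured neighbourhood of \<open>0\<close> on the circle, and by
  compactness it covers \<open>V = (0, \<eta>)\<close> for one \<open>\<eta>\<close> that serves all intervals. So \<open>V\<close> contains at
  least \<open>c * s ^ n\<close> disjoint intervals that are mapped onto \<open>V\<close> after about \<open>n\<close> steps.
  Every point \<open>a\<close> of the support of \<open>\<mu>\<close> has a one-sided neighbourhood covered by a branch starting in
  \<open>V\<close>: the points reached from \<open>V\<close> carry \<open>\<mu>\<close>, and the exceptional points of the support would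
  form a finite set that contains the preimages in the support of its elements, so that
  invariance makes the measure of its \<open>r\<close>-neighbourhood nondecreasing as \<open>r\<close> shrinks to \<open>0\<close>.
  Alternating between branches from \<open>V\<close> to the target around \<open>a\<close> and branches back to \<open>V\<close> yields a
  Cantor set inside the target set. As \<open>\<psi>\<close> is decreasing, hitting the target of time \<open>n\<close>
  a bounded number of steps too early does no harm.
\<close>

section \<open>Open intervals\<close>

text \<open>In general there is no Markov partition, so the proof counts and measures intervals of
  continuity. It depends on the count \<open>C * s ^ n\<close> carrying no subexponential factor:
  the intervals shorter than \<open>\<delta> / s ^ n\<close> then have total length at most
  \<open>C * \<delta>\<close>, uniformly in \<open>n\<close>, and can be thrown away. This is done
  both when disjoint branches from \<open>V\<close> to \<open>V\<close> are produced and when almost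
  every orbit is shown to enter \<open>V\<close>. The sharp count comes from looking
  \<open>m\<close> steps ahead with \<open>s ^ m > 4\<close>: a short interval contains at most one
  break of \<open>T ^^ m\<close>, so breaks at most double, up to a term of order
  \<open>s ^ n\<close>, while the bound gains the factor \<open>s ^ m\<close>. Since targets shrink,
  the return from a target to \<open>V\<close> is delicate. Avoiding a break may cost half of an
  interval, and the piece of \<open>I\<close> mapped onto \<open>V\<close> is only known to be at
  least \<open>c * len I powr (1 + \<kappa>)\<close> long. The exponent inequalities are strict, so
  an arbitrarily small \<open>\<kappa>\<close> is harmless.\<close>

definition oint :: "real set \<Rightarrow> bool" where
  "oint I \<longleftrightarrow> (\<exists>u v. u < v \<and> I = {u<..<v})"

abbreviation len :: "real set \<Rightarrow> real" where
  "len \<equiv> measure lborel"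

lemma ointI: "u < v \<Longrightarrow> oint {u<..<v}"
  unfolding oint_def by blast

lemma ointE:
  assumes "oint I"
  obtains u v where "u < v" "I = {u<..<v}" "len I = v - u"
  using assms unfolding oint_def by force

lemma oint_len_pos: "oint I \<Longrightarrow> len I > 0"
  by (elim ointE) simp

lemma oint_len_mono: "oint I \<Longrightarrow> oint J \<Longrightarrow> I \<subseteq> J \<Longrightarrow> len I \<le> len J"
  by (elim ointE) (auto simp: greaterThanLessThan_subseteq_greaterThanLessThan)

lemma oint_len_le_1: "oint I \<Longrightarrow> I \<subseteq> {0<..<1} \<Longrightarrow> len I \<le> 1"
  using oint_len_mono[of I "{0<..<1}"] ointI[of 0 1] by simp

lemma oint_open: "oint I \<Longrightarrow> open I"
  by (elim ointE) auto

lemma oint_mem_between: "oint I \<Longrightarrow> x \<in> I \<Longrightarrow> y \<in> I \<Longrightarrow> x \<le> z \<Longrightarrow> z \<le> y \<Longrightarrow> z \<in> I"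
  by (elim ointE) auto

lemma affine_image_Ioo:
  fixes k c u v :: real
  assumes "k \<noteq> 0" "u < v"
  shows "(\<lambda>x. k * x + c) ` {u<..<v} =
    (if k > 0 then {k * u + c<..<k * v + c} else {k * v + c<..<k * u + c})" (is "?L = ?R")
proof
  show "?L \<subseteq> ?R"
    using assms by (auto simp: mult_less_cancel_left)
  show "?R \<subseteq> ?L"
  proof
    fix y assume y: "y \<in> ?R"
    have "(y - c) / k \<in> {u<..<v}"
      using y assms by (auto simp: field_simps split: if_splits)
    moreover have "y = k * ((y - c) / k) + c" using assms by simp
    ultimately show "y \<in> ?L" by (rule rev_image_eqI)
  qed
qed

lemma oint_affine_image:
  assumes "oint I" "k \<noteq> 0"
  shows "oint ((\<lambda>x. k * x + c) ` I)" "len ((\<lambda>x. k * x + c) ` I) = \<bar>k\<bar> * len I"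
proof -
  obtain u v where I: "u < v" "I = {u<..<v}" "len I = v - u"
    using assms(1) by (rule ointE)
  have "k > 0 \<Longrightarrow> k * u < k * v" "k < 0 \<Longrightarrow> k * v < k * u"
    using I(1) by simp_all
  then show "oint ((\<lambda>x. k * x + c) ` I)" "len ((\<lambda>x. k * x + c) ` I) = \<bar>k\<bar> * len I"
    unfolding I(3) unfolding I(2) affine_image_Ioo[OF assms(2) I(1)]
    using assms(2) by (auto intro!: ointI simp: algebra_simps abs_if)
qed

lemma oint_affine_vimage:
  assumes "oint I" "oint K" "k \<noteq> 0" "K \<subseteq> (\<lambda>x. k * x + c) ` I"
  shows "oint {x \<in> I. k * x + c \<in> K}" "(\<lambda>x. k * x + c) ` {x \<in> I. k * x + c \<in> K} = K"
proof -
  have "{x \<in> I. k * x + c \<in> K} = (\<lambda>y. (1/k) * y + (- c/k)) ` K"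
  proof
    show "{x \<in> I. k * x + c \<in> K} \<subseteq> (\<lambda>y. (1/k) * y + (- c/k)) ` K"
      using assms(3) by (auto simp: field_simps intro!: rev_image_eqI)
    show "(\<lambda>y. (1/k) * y + (- c/k)) ` K \<subseteq> {x \<in> I. k * x + c \<in> K}"
    proof
      fix x assume "x \<in> (\<lambda>y. (1/k) * y + (- c/k)) ` K"
      then obtain y where y: "y \<in> K" "x = (1/k) * y + (- c/k)" by blast
      moreover obtain z where z: "z \<in> I" "y = k * z + c" using y(1) assms(4) by blast
      ultimately have "x = z" using assms(3) by (simp add: field_simps)
      then show "x \<in> {x \<in> I. k * x + c \<in> K}" using z y by simp
    qed
  qed
  then show "oint {x \<in> I. k * x + c \<in> K}"
    using oint_affine_image(1)[OF assms(2), of "1/k" "- c/k"] assms(3) by simp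
  show "(\<lambda>x. k * x + c) ` {x \<in> I. k * x + c \<in> K} = K"
    using assms(4) by blast
qed

text \<open>The longer side of the single point of \<open>F\<close> is kept. This is the source of
  the factor 2 in the expansion argument.\<close>

lemma oint_half_avoiding:
  assumes "oint I" "\<And>x y. x \<in> I \<Longrightarrow> y \<in> I \<Longrightarrow> x \<in> F \<Longrightarrow> y \<in> F \<Longrightarrow> x = y"
  shows "\<exists>J \<subseteq> I. oint J \<and> J \<inter> F = {} \<and> len J \<ge> len I / 2"
proof (cases "I \<inter> F = {}")
  case True
  then show ?thesis using assms(1) oint_len_pos[OF assms(1)] by (intro exI[of _ I]) auto
next
  case False
  then obtain d where d: "d \<in> I" "d \<in> F" by blast
  obtain u v where I: "u < v" "I = {u<..<v}" "len I = v - u"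
    using assms(1) by (rule ointE)
  have F: "y \<notin> F" if "y \<in> I" "y \<noteq> d" for y using assms(2)[OF d(1) _ d(2)] that by blast
  have d': "u < d" "d < v" using d I by auto
  show ?thesis
  proof (cases "d - u \<ge> v - d")
    case True
    have "{u<..<d} \<inter> F = {}" using F d' by (auto simp: I(2))
    moreover have "{u<..<d} \<subseteq> I" using d' by (auto simp: I(2))
    moreover have "len {u<..<d} \<ge> len I / 2" using True d' I(3) by simp
    ultimately show ?thesis using ointI[OF d'(1)] by blast
  next
    case False
    have "{d<..<v} \<inter> F = {}" using F d' by (auto simp: I(2))
    moreover have "{d<..<v} \<subseteq> I" using d' by (auto simp: I(2))
    moreover have "len {d<..<v} \<ge> len I / 2" using False d' I(3) by simp
    ultimately show ?thesis using ointI[OF d'(2)] by blast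
  qed
qed

lemma finite_real_gap:
  fixes F :: "real set"
  assumes "finite F"
  shows "\<exists>\<gamma>>0. \<forall>x\<in>F. \<forall>y\<in>F. x \<noteq> y \<longrightarrow> \<gamma> \<le> \<bar>x - y\<bar>"
proof -
  define D where "D = (\<lambda>(x, y). \<bar>x - y\<bar>) ` {p \<in> F \<times> F. fst p \<noteq> snd p}"
  have fin: "finite (insert 1 D)" using assms unfolding D_def by simp
  have "Min (insert 1 D) > 0"
    using fin by (subst Min_gr_iff) (auto simp: D_def)
  moreover have "Min (insert 1 D) \<le> \<bar>x - y\<bar>" if "x \<in> F" "y \<in> F" "x \<noteq> y" for x y
    using fin that by (intro Min_le) (auto simp: D_def image_iff intro!: bexI[of _ "(x, y)"])
  ultimately show ?thesis by blast
qed

section \<open>Branches of the iterates\<close>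

locale beta_dynamics =
  fixes \<beta> :: real
  assumes beta: "1 < \<bar>\<beta>\<bar>"
begin

abbreviation s :: real where "s \<equiv> \<bar>\<beta>\<bar>"
abbreviation T :: "real \<Rightarrow> real" where "T \<equiv> beta_map \<beta>"

text \<open>The interior discontinuities of \<open>T\<close>; 0 and 1 are left out because all
  intervals below lie in the open unit interval.\<close>

definition cuts :: "real set" where
  "cuts = {x \<in> {0<..<1}. \<beta> * x \<in> \<int>}"

text \<open>\<open>S\<close> may be larger than \<open>cuts\<close>: extra points force the
  intervals of continuity to respect further division points, such as the ends of a window.\<close>

definition breaks :: "real set \<Rightarrow> nat \<Rightarrow> real set" where
  "breaks S n = {x \<in> {0<..<1}. \<exists>i<n. (T ^^ i) x \<in> S}"

lemma beta_nonzero: "\<beta> \<noteq> 0"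
  using beta by auto

lemma finite_cuts: "finite cuts"
proof (rule finite_subset)
  show "cuts \<subseteq> (\<lambda>k. of_int k / \<beta>) ` {- \<lceil>s\<rceil>..\<lceil>s\<rceil>}"
  proof
    fix x assume "x \<in> cuts"
    then obtain k where k: "0 < x" "x < 1" "\<beta> * x = of_int k"
      by (auto simp: cuts_def Ints_def)
    have "\<bar>of_int k\<bar> \<le> s"
      using k mult_left_le[of x s] by (simp add: abs_mult flip: k(3))
    then have "k \<in> {- \<lceil>s\<rceil>..\<lceil>s\<rceil>}" by simp linarith
    moreover have "x = of_int k / \<beta>" using k(3) beta_nonzero by (simp add: field_simps)
    ultimately show "x \<in> (\<lambda>k. of_int k / \<beta>) ` {- \<lceil>s\<rceil>..\<lceil>s\<rceil>}" by blast
  qed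
qed auto

lemma cuts_subset: "cuts \<subseteq> {0<..<1}"
  by (auto simp: cuts_def)

lemma T_pos: "\<beta> * x \<notin> \<int> \<Longrightarrow> T x \<in> {0<..<1}"
  by (simp add: beta_map_def frac_gt_0_iff frac_lt_1)

lemma breaks_mono: "n \<le> m \<Longrightarrow> breaks S n \<subseteq> breaks S m"
  by (force simp: breaks_def)

lemma breaks_mono_set: "S \<subseteq> S' \<Longrightarrow> breaks S n \<subseteq> breaks S' n"
  by (force simp: breaks_def)

lemma breaks_0 [simp]: "breaks S 0 = {}"
  by (simp add: breaks_def)

lemma breaks_1: "S \<subseteq> {0<..<1} \<Longrightarrow> breaks S 1 = S"
  by (auto simp: breaks_def)

lemma iterate_mem:
  assumes "x \<in> {0<..<1}" "x \<notin> breaks S n" "cuts \<subseteq> S" "i \<le> n"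
  shows "(T ^^ i) x \<in> {0<..<1}"
  using assms(4)
proof (induction i)
  case 0
  then show ?case using assms(1) by simp
next
  case (Suc i)
  have "(T ^^ i) x \<notin> S" using assms(1,2) Suc.prems by (auto simp: breaks_def)
  then have "\<beta> * (T ^^ i) x \<notin> \<int>" using Suc assms(3) by (auto simp: cuts_def)
  then show ?case using T_pos by simp
qed

lemma breaks_add:
  assumes "cuts \<subseteq> S"
  shows "breaks S (n + m) =
    breaks S n \<union> {x \<in> {0<..<1} - breaks S n. (T ^^ n) x \<in> breaks S m}" (is "?L = ?R")
proof
  show "?L \<subseteq> ?R"
  proof
    fix x assume x: "x \<in> ?L"
    show "x \<in> ?R"
    proof (cases "x \<in> breaks S n")
      case False
      obtain i where i: "i < n + m" "(T ^^ i) x \<in> S" "0 < x" "x < 1"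
        using x by (auto simp: breaks_def)
      have "n \<le> i" using False i by (auto simp: breaks_def not_less)
      then have "(T ^^ (i - n)) ((T ^^ n) x) \<in> S"
        using i(2) funpow_add[of "i - n" n T] by simp
      moreover have "i - n < m" using i \<open>n \<le> i\<close> by simp
      ultimately show ?thesis
        using False i iterate_mem[OF _ False assms order_refl] by (auto simp: breaks_def)
    qed simp
  qed
  show "?R \<subseteq> ?L"
  proof
    fix x assume "x \<in> ?R"
    then consider "x \<in> breaks S n" | "x \<in> {0<..<1}" "(T ^^ n) x \<in> breaks S m" by blast
    then show "x \<in> ?L"
    proof cases
      case 1
      then show ?thesis using breaks_mono[of n "n + m"] by auto
    next
      case 2
      then obtain i where i: "i < m" "(T ^^ i) ((T ^^ n) x) \<in> S" by (auto simp: breaks_def)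
      then have "(T ^^ (n + i)) x \<in> S" unfolding add.commute[of n i] funpow_add by simp
      moreover have "n + i < n + m" using i(1) by simp
      ultimately show ?thesis using 2(1) unfolding breaks_def by blast
    qed
  qed
qed

text \<open>Two values with different integer parts enclose an integer, which would be the value of
  \<open>\<beta> * z\<close> at some \<open>z\<close> between the two arguments.\<close>

lemma floor_constant:
  assumes "oint J" "\<And>x. x \<in> J \<Longrightarrow> \<beta> * x \<notin> \<int>"
  shows "\<exists>k. \<forall>x\<in>J. \<lfloor>\<beta> * x\<rfloor> = k"
proof -
  have *: "\<not> \<lfloor>\<beta> * x\<rfloor> < \<lfloor>\<beta> * y\<rfloor>" if xy: "x \<in> J" "y \<in> J" for x y
  proof
    assume less: "\<lfloor>\<beta> * x\<rfloor> < \<lfloor>\<beta> * y\<rfloor>"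
    define z where "z = of_int \<lfloor>\<beta> * y\<rfloor> / \<beta>"
    have z: "\<beta> * z = of_int \<lfloor>\<beta> * y\<rfloor>" using beta_nonzero by (simp add: z_def)
    have 1: "\<beta> * x < \<beta> * z" "\<beta> * z \<le> \<beta> * y" using less z by linarith+
    have "z \<in> J"
    proof (cases "\<beta> > 0")
      case True
      then show ?thesis using 1 oint_mem_between[OF assms(1) xy, of z] by simp
    next
      case False
      then show ?thesis using 1 beta_nonzero oint_mem_between[OF assms(1) xy(2,1), of z]
        by (simp add: mult_less_cancel_left mult_le_cancel_left)
    qed
    then show False using assms(2) z by force
  qed
  obtain x0 where "x0 \<in> J" using assms(1) by (elim ointE) (meson dense greaterThanLessThan_iff)
  then show ?thesis using *[of _ x0] *[of x0]
    by (intro exI[of _ "\<lfloor>\<beta> * x0\<rfloor>"]) (auto intro: antisym simp: not_less)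
qed

lemma iterate_affine:
  assumes "oint I" "I \<subseteq> {0<..<1}" "I \<inter> breaks cuts n = {}"
  shows "\<exists>c. \<forall>x\<in>I. (T ^^ n) x = \<beta> ^ n * x + c"
  using assms(3)
proof (induction n)
  case 0
  show ?case by (rule exI[of _ 0]) simp
next
  case (Suc n)
  have "I \<inter> breaks cuts n = {}" using Suc.prems breaks_mono[of n "Suc n"] by auto
  with Suc.IH obtain c where c: "\<And>x. x \<in> I \<Longrightarrow> (T ^^ n) x = \<beta> ^ n * x + c" by blast
  define J where "J = (\<lambda>x. \<beta> ^ n * x + c) ` I"
  have J: "oint J" unfolding J_def using beta_nonzero by (intro oint_affine_image assms) simp
  have "\<beta> * y \<notin> \<int>" if "y \<in> J" for y
  proof -
    obtain x where x: "x \<in> I" "y = (T ^^ n) x" using \<open>y \<in> J\<close> c by (auto simp: J_def)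
    have "x \<notin> breaks cuts (Suc n)" using x Suc.prems by auto
    then have "y \<notin> cuts" using x assms(2) by (auto simp: breaks_def)
    moreover have "y \<in> {0<..<1}"
      using iterate_mem[of x cuts "Suc n" n] x assms(2) \<open>x \<notin> breaks cuts (Suc n)\<close> by auto
    ultimately show ?thesis by (auto simp: cuts_def)
  qed
  with floor_constant[OF J] obtain k where k: "\<And>y. y \<in> J \<Longrightarrow> \<lfloor>\<beta> * y\<rfloor> = k" by blast
  have "(T ^^ Suc n) x = \<beta> ^ Suc n * x + (\<beta> * c - of_int k)" if "x \<in> I" for x
  proof -
    have "\<beta> ^ n * x + c \<in> J" using that by (auto simp: J_def)
    from k[OF this] show ?thesis using c[OF that]
      by (simp add: beta_map_def frac_def algebra_simps)
  qed
  then show ?case by blast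
qed

text \<open>By \<open>iterate_affine\<close> the slope on \<open>I\<close> is
  \<open>\<beta> ^ n\<close>, so lengths can be read off from the image. \<open>I\<close> need not
  be maximal, so a branch can be restricted to any subinterval of its image.\<close>

definition branch :: "nat \<Rightarrow> real set \<Rightarrow> real set \<Rightarrow> bool" where
  "branch n I J \<longleftrightarrow> oint I \<and> I \<subseteq> {0<..<1} \<and> I \<inter> breaks cuts n = {} \<and> J = (T ^^ n) ` I"

lemma branchE:
  assumes "branch n I J"
  obtains c where "\<And>x. x \<in> I \<Longrightarrow> (T ^^ n) x = \<beta> ^ n * x + c" "J = (\<lambda>x. \<beta> ^ n * x + c) ` I"
    "inj_on (T ^^ n) I"
proof -
  obtain c where c: "\<forall>x\<in>I. (T ^^ n) x = \<beta> ^ n * x + c"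
    using iterate_affine[of I n] assms unfolding branch_def by blast
  have c1: "(T ^^ n) x = \<beta> ^ n * x + c" if "x \<in> I" for x using c that by blast
  have c2: "J = (\<lambda>x. \<beta> ^ n * x + c) ` I"
    using assms c1 unfolding branch_def by simp
  have c3: "inj_on (T ^^ n) I" using c1 beta_nonzero by (auto simp: inj_on_def)
  show ?thesis by (rule that[OF c1 c2 c3])
qed

lemma branch_oint:
  assumes "branch n I J"
  shows "oint I" "oint J" "I \<subseteq> {0<..<1}" "J \<subseteq> {0<..<1}" "len J = s ^ n * len I"
proof -
  show I: "oint I" "I \<subseteq> {0<..<1}" using assms by (auto simp: branch_def)
  obtain c where c: "J = (\<lambda>x. \<beta> ^ n * x + c) ` I"
    using assms by (elim branchE) (rule that)
  have "\<beta> ^ n \<noteq> 0" using beta_nonzero by simp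
  from oint_affine_image[OF I(1) this, of c] show "oint J" "len J = s ^ n * len I"
    unfolding c power_abs by blast+
  show "J \<subseteq> {0<..<1}"
  proof
    fix y assume "y \<in> J"
    then obtain x where x: "x \<in> I" "y = (T ^^ n) x" using assms by (auto simp: branch_def)
    then show "y \<in> {0<..<1}"
      using iterate_mem[of x cuts n n] assms unfolding branch_def by blast
  qed
qed

lemma branch_restrict:
  assumes "branch n I J" "oint K" "K \<subseteq> J"
  shows "branch n {x \<in> I. (T ^^ n) x \<in> K} K"
proof -
  obtain c where c: "\<And>x. x \<in> I \<Longrightarrow> (T ^^ n) x = \<beta> ^ n * x + c" "J = (\<lambda>x. \<beta> ^ n * x + c) ` I"
    using assms(1) by (elim branchE) (rule that)
  have eq: "{x \<in> I. (T ^^ n) x \<in> K} = {x \<in> I. \<beta> ^ n * x + c \<in> K}" using c(1) by auto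
  have "\<beta> ^ n \<noteq> 0" using beta_nonzero by simp
  from oint_affine_vimage(1)[OF branch_oint(1)[OF assms(1)] assms(2) this, of c]
  have "oint {x \<in> I. (T ^^ n) x \<in> K}"
    unfolding eq using assms(3) c(2) by blast
  moreover have "K = (T ^^ n) ` {x \<in> I. (T ^^ n) x \<in> K}"
    using assms(1,3) unfolding branch_def by blast
  ultimately show ?thesis using assms(1) unfolding branch_def by blast
qed

lemma branch_compose:
  assumes "branch n I J" "branch m J K"
  shows "branch (n + m) I K"
proof -
  have I: "oint I" "I \<subseteq> {0<..<1}" "I \<inter> breaks cuts n = {}" "J = (T ^^ n) ` I"
    using assms(1) by (simp_all add: branch_def)
  have J: "J \<inter> breaks cuts m = {}" "K = (T ^^ m) ` J"
    using assms(2) by (simp_all add: branch_def)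
  have "I \<inter> breaks cuts (n + m) = {}"
    unfolding breaks_add[OF order_refl] using I(3) J(1)[unfolded I(4)] by blast
  moreover have "K = (T ^^ (n + m)) ` I"
    unfolding J(2) I(4) image_comp add.commute[of n m] funpow_add ..
  ultimately show ?thesis using I(1,2) by (simp add: branch_def)
qed

lemma branch_0: "oint I \<Longrightarrow> I \<subseteq> {0<..<1} \<Longrightarrow> branch 0 I I"
  by (simp add: branch_def)

lemma branch_1: "oint I \<Longrightarrow> I \<subseteq> {0<..<1} \<Longrightarrow> I \<inter> cuts = {} \<Longrightarrow> branch 1 I (T ` I)"
  using breaks_1[of cuts] unfolding branch_def by (simp add: cuts_subset)

text \<open>Only the elapsed time and the image are recorded; forgetting where the branch starts
  makes the relation transitive.\<close>

definition reach :: "nat \<Rightarrow> real set \<Rightarrow> real set \<Rightarrow> bool" where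
  "reach n J K \<longleftrightarrow> (\<exists>I\<subseteq>J. branch n I K)"

lemma reach_trans:
  assumes "reach n J K" "reach m K L"
  shows "reach (n + m) J L"
proof -
  obtain I K' where I: "I \<subseteq> J" "branch n I K" "K' \<subseteq> K" "branch m K' L"
    using assms by (auto simp: reach_def)
  have "branch n {x \<in> I. (T ^^ n) x \<in> K'} K'"
    by (rule branch_restrict[OF I(2) branch_oint(1)[OF I(4)] I(3)])
  from branch_compose[OF this I(4)] show ?thesis
    unfolding reach_def using I(1) by (intro exI[of _ "{x \<in> I. (T ^^ n) x \<in> K'}"]) auto
qed

lemma reach_mono: "reach n J K \<Longrightarrow> J \<subseteq> J' \<Longrightarrow> reach n J' K"
  by (auto simp: reach_def)

lemma reach_shrink:
  assumes "reach n J K" "oint K'" "K' \<subseteq> K"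
  shows "reach n J K'"
proof -
  obtain I where I: "I \<subseteq> J" "branch n I K" using assms(1) by (auto simp: reach_def)
  from branch_restrict[OF this(2) assms(2,3)] show ?thesis
    unfolding reach_def using I(1) by (intro exI[of _ "{x \<in> I. (T ^^ n) x \<in> K'}"]) auto
qed

lemma branch_reach: "branch n I J \<Longrightarrow> reach n I J"
  by (auto simp: reach_def)

end

section \<open>Counting branches\<close>

text \<open>For finite \<open>F\<close> inside the unit interval these are the components of its
  complement there, described by end points so that they can be counted.\<close>

definition laps :: "real set \<Rightarrow> real set set" where
  "laps F = {{u<..<v} | u v. u \<in> insert 0 F \<and> v \<in> insert 1 F \<and> u < v \<and> {u<..<v} \<inter> F = {}}"

lemma lapsI:
  "u \<in> insert 0 F \<Longrightarrow> v \<in> insert 1 F \<Longrightarrow> u < v \<Longrightarrow> {u<..<v} \<inter> F = {} \<Longrightarrow> {u<..<v} \<in> laps F"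
  unfolding laps_def by blast

lemma lapsE:
  assumes "I \<in> laps F"
  obtains u v where "u \<in> insert 0 F" "v \<in> insert 1 F" "u < v" "I = {u<..<v}" "{u<..<v} \<inter> F = {}"
  using assms by (auto simp: laps_def)

lemma laps_oint: "I \<in> laps F \<Longrightarrow> oint I"
  by (elim lapsE) (simp add: ointI)

lemma laps_avoid: "I \<in> laps F \<Longrightarrow> I \<inter> F = {}"
  by (elim lapsE) simp

lemma laps_subset: "F \<subseteq> {0<..<1} \<Longrightarrow> I \<in> laps F \<Longrightarrow> I \<subseteq> {0<..<1}"
  by (elim lapsE) force

lemma laps_cover:
  assumes "finite F" "x \<in> {0<..<1} - F"
  shows "\<exists>I\<in>laps F. x \<in> I"
proof -
  define u where "u = Max {d \<in> insert 0 F. d < x}"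
  define v where "v = Min {d \<in> insert 1 F. x < d}"
  have u: "u \<in> {d \<in> insert 0 F. d < x}"
    unfolding u_def using assms by (intro Max_in) auto
  have v: "v \<in> {d \<in> insert 1 F. x < d}"
    unfolding v_def using assms by (intro Min_in) auto
  have "{u<..<v} \<inter> F = {}"
  proof (rule ccontr)
    assume "{u<..<v} \<inter> F \<noteq> {}"
    then obtain d where d: "u < d" "d < v" "d \<in> F" by auto
    show False
    proof (cases "d < x")
      case True
      then have "d \<le> u" unfolding u_def using assms d by (intro Max_ge) auto
      then show False using d by simp
    next
      case False
      then have "x < d" using assms d by (metis Diff_iff linorder_neqE)
      then have "v \<le> d" unfolding v_def using assms d by (intro Min_le) auto
      then show False using d by simp
    qed
  qed
  moreover have "u \<in> insert 0 F" "v \<in> insert 1 F" "u < v" using u v by auto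
  ultimately have "{u<..<v} \<in> laps F" by (intro lapsI)
  moreover have "x \<in> {u<..<v}" using u v by auto
  ultimately show ?thesis by blast
qed

lemma laps_disjoint:
  assumes "I \<in> laps F" "J \<in> laps F" "x \<in> I" "x \<in> J" "F \<subseteq> {0<..<1}"
  shows "I = J"
proof -
  obtain u v where I: "u \<in> insert 0 F" "v \<in> insert 1 F" "I = {u<..<v}" "{u<..<v} \<inter> F = {}"
    using assms(1) by (rule lapsE)
  obtain u' v' where J: "u' \<in> insert 0 F" "v' \<in> insert 1 F" "J = {u'<..<v'}" "{u'<..<v'} \<inter> F = {}"
    using assms(2) by (rule lapsE)
  have F: "0 < d \<and> d < 1" if "d \<in> F" for d using that assms(5) by auto
  have x: "u < x" "x < v" "u' < x" "x < v'" using assms(3,4) I(3) J(3) by auto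
  have a: "d \<le> u \<or> v \<le> d" "d \<le> u' \<or> v' \<le> d" if "d \<in> F" for d
  proof -
    have "\<not> (u < d \<and> d < v)" "\<not> (u' < d \<and> d < v')" using I(4) J(4) that by auto
    then show "d \<le> u \<or> v \<le> d" "d \<le> u' \<or> v' \<le> d" by linarith+
  qed
  have "u = u'"
    using I(1) J(1) a[of u] a[of u'] F[of u] F[of u'] x by auto
  moreover have "v = v'"
    using I(2) J(2) a[of v] a[of v'] F[of v] F[of v'] x by auto
  ultimately show ?thesis using I J by simp
qed

text \<open>Counting laps by their left end points, which lie in \<open>insert 0 F\<close>, gives
  the bound \<open>card F + 1\<close>.\<close>

lemma laps_eq_of_Inf:
  assumes "I \<in> laps F" "J \<in> laps F" "Inf I = Inf J" "F \<subseteq> {0<..<1}"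
  shows "I = J"
proof -
  obtain u v where I: "u < v" "I = {u<..<v}" using laps_oint[OF assms(1)] by (rule ointE)
  obtain u' v' where J: "u' < v'" "J = {u'<..<v'}" using laps_oint[OF assms(2)] by (rule ointE)
  have "u = u'" using assms(3) I J by simp
  moreover obtain x where "u < x" "x < min v v'" using dense[of u "min v v'"] I J \<open>u = u'\<close> by auto
  ultimately show ?thesis using laps_disjoint[OF assms(1,2) _ _ assms(4), of x] I J by auto
qed

lemma finite_laps:
  assumes "finite F" "F \<subseteq> {0<..<1}"
  shows "finite (laps F)" "card (laps F) \<le> card F + 1"
proof -
  have inj: "inj_on Inf (laps F)"
    using laps_eq_of_Inf[OF _ _ _ assms(2)] by (auto simp: inj_on_def)
  have sub: "Inf ` laps F \<subseteq> insert 0 F"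
    by (auto elim!: lapsE)
  show "finite (laps F)"
    using inj_on_finite[OF inj sub] assms by simp
  have "card (laps F) \<le> card (insert 0 F)"
    using card_inj_on_le[OF inj sub] assms by simp
  also have "\<dots> \<le> card F + 1" using assms by (simp add: card_insert_if)
  finally show "card (laps F) \<le> card F + 1" .
qed

lemma oint_fmeasurable: "oint I \<Longrightarrow> I \<in> fmeasurable lborel"
  by (elim ointE) (auto intro!: fmeasurableI)

lemma sum_len_le:
  assumes "finite \<A>" "\<And>I. I \<in> \<A> \<Longrightarrow> oint I" "pairwise disjnt \<A>" "\<And>I. I \<in> \<A> \<Longrightarrow> I \<subseteq> A"
    "A \<in> sets borel" "emeasure lborel A < \<infinity>"
  shows "(\<Sum>I\<in>\<A>. len I) \<le> len A"
proof -
  have fm: "I \<in> fmeasurable lborel" if "I \<in> \<A>" for I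
    using assms(2)[OF that] by (rule oint_fmeasurable)
  have "(\<Sum>I\<in>\<A>. len I) = len (\<Union>I\<in>\<A>. I)"
    using assms(1,3) fm
    by (intro measure_UNION'[symmetric]) (auto simp: pairwise_def disjnt_def)
  also have "\<dots> \<le> len A"
  proof (rule measure_mono_fmeasurable)
    show "(\<Union>I\<in>\<A>. I) \<subseteq> A" using assms(4) by blast
    show "(\<Union>I\<in>\<A>. I) \<in> sets lborel" using fmeasurableD[OF fm] assms(1) by (intro sets.finite_UN) auto
    show "A \<in> fmeasurable lborel" using assms(5,6) by (intro fmeasurableI) auto
  qed
  finally show ?thesis .
qed

lemma len_le_sum:
  assumes "finite \<A>" "\<And>I. I \<in> \<A> \<Longrightarrow> oint I" "A \<subseteq> F \<union> \<Union>\<A>" "finite F" "A \<in> sets borel"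
  shows "len A \<le> (\<Sum>I\<in>\<A>. len I)"
proof -
  have fm: "I \<in> fmeasurable lborel" if "I \<in> \<A>" for I
    using assms(2)[OF that] by (rule oint_fmeasurable)
  have F: "F \<in> fmeasurable lborel" "len F = 0"
    using emeasure_lborel_countable[OF countable_finite[OF assms(4)]] assms(4)
    by (auto intro!: fmeasurableI borel_closed finite_imp_closed simp: measure_def)
  have U: "\<Union>\<A> \<in> fmeasurable lborel"
    using fm assms(1) by (intro fmeasurable.finite_Union) auto
  have "len A \<le> len (F \<union> \<Union>\<A>)"
    using assms(3,5) F U by (intro measure_mono_fmeasurable) auto
  also have "\<dots> \<le> len F + len (\<Union>\<A>)"
    using F U by (intro measure_Un_le) auto
  also have "len (\<Union>\<A>) \<le> (\<Sum>I\<in>\<A>. len I)"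
    using measure_UNION_le[OF assms(1), of "\<lambda>I. I" lborel] fmeasurableD[OF fm] by simp
  finally show ?thesis using F by simp
qed

lemma laps_pairwise: "F \<subseteq> {0<..<1} \<Longrightarrow> pairwise disjnt (laps F)"
  using laps_disjoint unfolding pairwise_def disjnt_def by blast

lemma card_long_laps:
  assumes "finite F" "F \<subseteq> {0<..<1}" "x > 0"
  shows "real (card {I \<in> laps F. len I \<ge> x}) \<le> 1 / x"
proof -
  let ?L = "{I \<in> laps F. len I \<ge> x}"
  have fin: "finite ?L" using finite_laps[OF assms(1,2)] by simp
  have "real (card ?L) * x \<le> (\<Sum>I\<in>?L. len I)"
    using sum_mono[of ?L "\<lambda>_. x" len] by simp
  also have "\<dots> \<le> len {0<..<1}"
    using fin laps_oint laps_subset[OF assms(2)] laps_pairwise[OF assms(2)]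
    by (intro sum_len_le) (auto simp: pairwise_def)
  finally show ?thesis using assms(3) by (simp add: field_simps)
qed

context beta_dynamics
begin

definition cutset :: "real set \<Rightarrow> bool" where
  "cutset S \<longleftrightarrow> finite S \<and> cuts \<subseteq> S \<and> S \<subseteq> {0<..<1}"

lemma cutset_cuts: "cutset cuts"
  by (simp add: cutset_def finite_cuts cuts_subset)

lemma breaks_subset: "breaks S n \<subseteq> {0<..<1}"
  by (auto simp: breaks_def)

lemma lap_branch:
  assumes "cutset S" "I \<in> laps (breaks S n)"
  shows "branch n I ((T ^^ n) ` I)"
  using laps_oint[OF assms(2)] laps_avoid[OF assms(2)] laps_subset[OF breaks_subset assms(2)]
    breaks_mono_set[of cuts S n] assms(1) by (auto simp: branch_def cutset_def)

lemma card_preimage_lap: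
  assumes "cutset S" "I \<in> laps (breaks S n)" "finite B"
  shows "finite {x \<in> I. (T ^^ n) x \<in> B}" "card {x \<in> I. (T ^^ n) x \<in> B} \<le> card (B \<inter> (T ^^ n) ` I)"
proof -
  have "inj_on (T ^^ n) I"
    using lap_branch[OF assms(1,2)] by (elim branchE)
  then have inj: "inj_on (T ^^ n) {x \<in> I. (T ^^ n) x \<in> B}" by (auto intro: inj_on_subset)
  have sub: "(T ^^ n) ` {x \<in> I. (T ^^ n) x \<in> B} \<subseteq> B \<inter> (T ^^ n) ` I" by auto
  show "finite {x \<in> I. (T ^^ n) x \<in> B}"
    using inj_on_finite[OF inj sub] assms(3) by simp
  show "card {x \<in> I. (T ^^ n) x \<in> B} \<le> card (B \<inter> (T ^^ n) ` I)"
    using card_inj_on_le[OF inj sub] assms(3) by simp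
qed

lemma breaks_add_laps:
  assumes "cutset S" "finite (breaks S n)"
  shows "breaks S (n + m) =
    breaks S n \<union> (\<Union>I\<in>laps (breaks S n). {x \<in> I. (T ^^ n) x \<in> breaks S m})"
proof -
  have "cuts \<subseteq> S" using assms(1) by (simp add: cutset_def)
  note eq = breaks_add[OF this, of n m]
  have "{x \<in> {0<..<1} - breaks S n. (T ^^ n) x \<in> breaks S m} =
      (\<Union>I\<in>laps (breaks S n). {x \<in> I. (T ^^ n) x \<in> breaks S m})" (is "?L = ?R")
  proof
    show "?L \<subseteq> ?R" using laps_cover[OF assms(2)] by force
    show "?R \<subseteq> ?L"
    proof
      fix x assume "x \<in> ?R"
      then obtain I where I: "I \<in> laps (breaks S n)" "x \<in> I" "(T ^^ n) x \<in> breaks S m" by auto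
      then show "x \<in> ?L"
        using laps_avoid[OF I(1)] laps_subset[OF breaks_subset I(1)] by auto
    qed
  qed
  then show ?thesis using eq by simp
qed

lemma finite_breaks:
  assumes "cutset S"
  shows "finite (breaks S n)"
proof (induction n)
  case (Suc n)
  have "finite (\<Union>I\<in>laps (breaks S n). {x \<in> I. (T ^^ n) x \<in> S})"
    using finite_laps(1)[OF Suc breaks_subset] card_preimage_lap(1)[OF assms] assms
    by (auto simp: cutset_def)
  moreover have "breaks S 1 = S" using breaks_1 assms by (auto simp: cutset_def)
  ultimately show ?case
    using breaks_add_laps[OF assms Suc, of 1] Suc by simp
qed simp

text \<open>Each new break lies in a lap and is sent by \<open>T ^^ n\<close> to a point of
  \<open>breaks S m\<close>. A lap shorter than \<open>\<gamma> / s ^ n\<close> has an image shorter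
  than \<open>\<gamma>\<close> and gains at most one break; at most \<open>s ^ n / \<gamma>\<close>
  laps are longer.\<close>

lemma card_breaks_add:
  assumes "cutset S" "\<gamma> > 0"
    "\<And>x y. x \<in> breaks S m \<Longrightarrow> y \<in> breaks S m \<Longrightarrow> x \<noteq> y \<Longrightarrow> \<gamma> \<le> \<bar>x - y\<bar>"
  shows "real (card (breaks S (n + m))) \<le>
    2 * real (card (breaks S n)) + 1 + real (card (breaks S m)) / \<gamma> * s ^ n"
proof -
  let ?F = "breaks S n" and ?B = "breaks S m"
  have fin: "finite ?F" "finite ?B" using finite_breaks[OF assms(1)] by auto
  note lfin = finite_laps[OF fin(1) breaks_subset]
  let ?L = "{I \<in> laps ?F. len I \<ge> \<gamma> / s ^ n}"
  have s: "s ^ n > 0" using beta by simp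
  have 1: "card {x \<in> I. (T ^^ n) x \<in> ?B} \<le> 1" if "I \<in> laps ?F - ?L" for I
  proof -
    have br: "branch n I ((T ^^ n) ` I)" using that lap_branch[OF assms(1)] by auto
    from branch_oint[OF br] have K: "oint ((T ^^ n) ` I)" "len ((T ^^ n) ` I) < \<gamma>"
      using that s by (auto simp: field_simps)
    have "x = y" if "x \<in> ?B \<inter> (T ^^ n) ` I" "y \<in> ?B \<inter> (T ^^ n) ` I" for x y
    proof (rule ccontr)
      assume "x \<noteq> y"
      then have "\<gamma> \<le> \<bar>x - y\<bar>" using that assms(3) by auto
      moreover obtain u v where uv: "(T ^^ n) ` I = {u<..<v}" "len ((T ^^ n) ` I) = v - u"
        using K(1) by (rule ointE)
      then have "\<bar>x - y\<bar> < v - u" using that by auto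
      ultimately show False using K(2) uv by simp
    qed
    then have "card (?B \<inter> (T ^^ n) ` I) \<le> 1"
      using fin(2) by (auto simp: card_le_Suc0_iff_eq)
    then show ?thesis using card_preimage_lap(2)[OF assms(1) _ fin(2), of I n] that by simp
  qed
  have 2: "card {x \<in> I. (T ^^ n) x \<in> ?B} \<le> card ?B" if "I \<in> laps ?F" for I
    using card_preimage_lap(2)[OF assms(1) that fin(2)] card_mono[OF fin(2), of "?B \<inter> (T ^^ n) ` I"]
    by simp
  have "card (breaks S (n + m)) \<le> card ?F + card (\<Union>I\<in>laps ?F. {x \<in> I. (T ^^ n) x \<in> ?B})"
    unfolding breaks_add_laps[OF assms(1) fin(1)] by (rule card_Un_le)
  also have "card (\<Union>I\<in>laps ?F. {x \<in> I. (T ^^ n) x \<in> ?B}) \<le>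
      (\<Sum>I\<in>laps ?F. card {x \<in> I. (T ^^ n) x \<in> ?B})"
    by (rule card_UN_le[OF lfin(1)])
  also have "\<dots> = (\<Sum>I\<in>laps ?F - ?L. card {x \<in> I. (T ^^ n) x \<in> ?B}) +
      (\<Sum>I\<in>?L. card {x \<in> I. (T ^^ n) x \<in> ?B})"
    using lfin(1) by (intro sum.subset_diff) auto
  also have "\<dots> \<le> card (laps ?F - ?L) * 1 + card ?L * card ?B"
    using sum_bounded_above[of "laps ?F - ?L" "\<lambda>I. card {x \<in> I. (T ^^ n) x \<in> ?B}" 1]
      sum_bounded_above[of "?L" "\<lambda>I. card {x \<in> I. (T ^^ n) x \<in> ?B}" "card ?B"] 1 2
    by (intro add_mono) auto
  also have "card (laps ?F - ?L) \<le> card ?F + 1"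
    using lfin card_mono[OF lfin(1), of "laps ?F - ?L"] by simp
  finally have "card (breaks S (n + m)) \<le> 2 * card ?F + 1 + card ?L * card ?B" by simp
  then have "real (card (breaks S (n + m))) \<le> 2 * real (card ?F) + 1 + real (card ?L) * real (card ?B)"
    by (simp flip: of_nat_mult of_nat_add)
  moreover have "real (card ?L) \<le> 1 / (\<gamma> / s ^ n)"
    using assms(2) s fin by (intro card_long_laps breaks_subset) auto
  then have "real (card ?L) * real (card ?B) \<le> 1 / (\<gamma> / s ^ n) * real (card ?B)"
    by (rule mult_right_mono) simp
  ultimately show ?thesis by (simp add: mult.commute)
qed

lemma card_breaks_bound:
  assumes "cutset S"
  shows "\<exists>C>0. \<forall>n. real (card (breaks S n)) + 1 \<le> C * s ^ n"
proof -
  \<comment> \<open>The constant 4 absorbs the doubling together with the term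
    \<open>K * s ^ n\<close>, as \<open>2 * (1 + K) + K \<le> 4 * (1 + K)\<close>.\<close>
  obtain m where m: "4 < s ^ m" using real_arch_pow[OF beta] by blast
  then have "m > 0" by (cases m) auto
  obtain \<gamma> where \<gamma>: "\<gamma> > 0"
    "\<forall>x\<in>breaks S m. \<forall>y\<in>breaks S m. x \<noteq> y \<longrightarrow> \<gamma> \<le> \<bar>x - y\<bar>"
    using finite_real_gap[OF finite_breaks[OF assms]] by blast
  define K where "K = real (card (breaks S m)) / \<gamma>"
  have K: "K \<ge> 0" using \<gamma> by (simp add: K_def)
  have rec: "real (card (breaks S (n + m))) \<le> 2 * real (card (breaks S n)) + 1 + K * s ^ n" for n
    using card_breaks_add[OF assms \<gamma>(1), of m n] \<gamma>(2) unfolding K_def by blast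
  have *: "real (card (breaks S (j * m))) + 1 \<le> (1 + K) * s ^ (j * m)" for j
  proof (induction j)
    case (Suc j)
    have pos: "s ^ (j * m) > 0" using beta by simp
    have "real (card (breaks S (Suc j * m))) + 1 \<le> 2 * (real (card (breaks S (j * m))) + 1) + K * s ^ (j * m)"
      using rec[of "j * m"] by (simp add: add.commute)
    also have "\<dots> \<le> 2 * ((1 + K) * s ^ (j * m)) + K * s ^ (j * m)" using Suc by simp
    also have "\<dots> \<le> (1 + K) * s ^ (j * m) * 4" using K pos by (simp add: algebra_simps)
    also have "\<dots> \<le> (1 + K) * s ^ (j * m) * s ^ m"
      using K pos m by (intro mult_left_mono) auto
    finally show ?case by (simp add: power_add mult_ac)
  qed (use K in simp)
  have "real (card (breaks S n)) + 1 \<le> ((1 + K) * s ^ m) * s ^ n" for n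
  proof -
    \<comment> \<open>Rounds \<open>n\<close> up to a multiple of \<open>m\<close>, at the cost of a
      factor \<open>s ^ m\<close>.\<close>
    let ?j = "n div m + 1"
    have le: "n \<le> ?j * m" "?j * m \<le> n + m"
      using \<open>m > 0\<close> by (metis add.commute div_mult_mod_eq mod_less_divisor less_imp_le add_le_cancel_left
        mult.commute mult_Suc_right plus_1_eq_Suc, simp add: div_times_less_eq_dividend)
    have "card (breaks S n) \<le> card (breaks S (?j * m))"
      by (intro card_mono finite_breaks assms breaks_mono le)
    then have "real (card (breaks S n)) + 1 \<le> (1 + K) * s ^ (?j * m)" using *[of ?j] by simp
    also have "\<dots> \<le> (1 + K) * s ^ (n + m)"
      using K beta le(2) by (intro mult_left_mono power_increasing) auto
    finally show ?thesis by (simp add: power_add mult_ac)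
  qed
  then show ?thesis using K beta by (intro exI[of _ "(1 + K) * s ^ m"]) auto
qed

end

section \<open>Expansion of intervals\<close>

lemma frac_near_int:
  fixes z :: real
  shows "0 < z \<Longrightarrow> z < 1 \<Longrightarrow> frac (of_int k + z) = z"
    "-1 < z \<Longrightarrow> z < 0 \<Longrightarrow> frac (of_int k + z) = 1 + z"
  by (auto simp: frac_unique_iff)

context beta_dynamics
begin

lemma T_near_cut:
  assumes "\<beta> * d = of_int k" "x = d + z" "0 < \<bar>\<beta> * z\<bar>" "\<bar>\<beta> * z\<bar> < 1"
  shows "T x = (if \<beta> * z > 0 then \<beta> * x - of_int k else \<beta> * x - of_int k + 1)" "\<beta> * x \<notin> \<int>"
proof -
  have eq: "\<beta> * x = of_int k + \<beta> * z" using assms by (simp add: algebra_simps)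
  show *: "T x = (if \<beta> * z > 0 then \<beta> * x - of_int k else \<beta> * x - of_int k + 1)"
  proof (cases "\<beta> * z > 0")
    case True
    then show ?thesis unfolding beta_map_def eq using frac_near_int(1)[of "\<beta> * z" k] assms(4) by simp
  next
    case False
    then have "- 1 < \<beta> * z" "\<beta> * z < 0" using assms(3,4) by linarith+
    then show ?thesis unfolding beta_map_def eq using frac_near_int(2)[of "\<beta> * z" k] by simp
  qed
  have "frac (\<beta> * x) \<noteq> 0"
    using * eq assms by (auto simp: beta_map_def split: if_splits)
  then show "\<beta> * x \<notin> \<int>" by simp
qed

text \<open>The one-sided limits of \<open>T\<close> at a cut are 0 and 1, so the two sides of
  \<open>d\<close> are stretched over neighbourhoods of the two ends; the sign of
  \<open>\<beta>\<close> decides which side goes where.\<close>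

lemma cut_reach_ends:
  assumes "oint J" "J \<subseteq> {0<..<1}" "d \<in> J" "d \<in> cuts"
  shows "\<exists>e>0. e < 1 \<and> reach 1 J {0<..<e} \<and> reach 1 J {1 - e<..<1}"
proof -
  obtain u v where J: "u < v" "J = {u<..<v}" using assms(1) by (rule ointE)
  obtain k where k: "\<beta> * d = of_int k" using assms(4) by (auto simp: cuts_def Ints_def)
  \<comment> \<open>The first bound keeps \<open>s * e\<close> below 1, so no second cut lies within
    distance \<open>e\<close> of \<open>d\<close>. The witness for the statement is
    \<open>s * e\<close>.\<close>
  define e where "e = min (1 / (2 * s)) (min (d - u) (v - d))"
  have e1: "e \<le> 1 / (2 * s)" "e \<le> d - u" "e \<le> v - d" by (auto simp: e_def)
  have e: "e > 0" "d - e \<ge> u" "d + e \<le> v"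
    using assms(3) J beta e1 by (auto simp: e_def)
  have "s * e \<le> s * (1 / (2 * s))" using e1(1) by (rule mult_left_mono) simp
  then have se: "s * e < 1" using beta by simp
  have near: "0 < \<bar>\<beta> * z\<bar> \<and> \<bar>\<beta> * z\<bar> < 1" if "z \<noteq> 0" "\<bar>z\<bar> < e" for z
  proof -
    have "s * \<bar>z\<bar> < s * e" using that beta by (intro mult_strict_left_mono) auto
    then have "s * \<bar>z\<bar> < 1" using se by (rule order.strict_trans)
    then show ?thesis using that beta_nonzero by (simp add: abs_mult)
  qed
  have TR: "T x = (if \<beta> * (x - d) > 0 then \<beta> * x + - of_int k else \<beta> * x + (1 - of_int k))" "\<beta> * x \<notin> \<int>"
    if "x \<noteq> d" "\<bar>x - d\<bar> < e" for x
    using T_near_cut[OF k, of x "x - d"] near[of "x - d"] that by auto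
  let ?R = "{d<..<d + e}" and ?L = "{d - e<..<d}"
  have R: "branch 1 ?R (T ` ?R)"
    using e J assms(2) TR(2) by (intro branch_1 ointI) (auto simp: cuts_def)
  have L: "branch 1 ?L (T ` ?L)"
    using e J assms(2) TR(2) by (intro branch_1 ointI) (auto simp: cuts_def)
  have sub: "?R \<subseteq> J" "?L \<subseteq> J" using e J by auto
  have R1: "reach 1 J (T ` ?R)" "reach 1 J (T ` ?L)"
    using reach_mono[OF branch_reach[OF R] sub(1)] reach_mono[OF branch_reach[OF L] sub(2)] by auto
  have k': "of_int k = \<beta> * d" by (simp add: k)
  show ?thesis
  proof (cases "\<beta> > 0")
    case True
    have "T ` ?R = (\<lambda>x. \<beta> * x + - of_int k) ` ?R"
      using TR(1) True by (intro image_cong) auto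
    also have "\<dots> = {0<..<s * e}" using True e se
      unfolding affine_image_Ioo[OF beta_nonzero less_add_same_cancel1[THEN iffD2, OF e(1)]]
      by (simp add: k' algebra_simps)
    finally have 1: "T ` ?R = {0<..<s * e}" .
    have "T ` ?L = (\<lambda>x. \<beta> * x + (1 - of_int k)) ` ?L"
      using TR(1) True by (intro image_cong) (auto simp: zero_less_mult_iff)
    also have "\<dots> = {1 - s * e<..<1}" using True e se
      by (subst affine_image_Ioo) (simp_all add: k' algebra_simps)
    finally have 2: "T ` ?L = {1 - s * e<..<1}" .
    show ?thesis using R1 e se beta unfolding 1 2 by (intro exI[of _ "s * e"]) auto
  next
    case False
    then have neg: "\<beta> < 0" using beta_nonzero by simp
    have "T ` ?L = (\<lambda>x. \<beta> * x + - of_int k) ` ?L"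
      using TR(1) neg by (intro image_cong) (auto simp: zero_less_mult_iff)
    also have "\<dots> = {0<..<s * e}" using neg e se
      by (subst affine_image_Ioo) (simp_all add: k' algebra_simps)
    finally have 1: "T ` ?L = {0<..<s * e}" .
    have "T ` ?R = (\<lambda>x. \<beta> * x + (1 - of_int k)) ` ?R"
      using TR(1) neg by (intro image_cong) (auto simp: zero_less_mult_iff)
    also have "\<dots> = {1 - s * e<..<1}" using neg e se
      by (subst affine_image_Ioo) (simp_all add: k' algebra_simps)
    finally have 2: "T ` ?R = {1 - s * e<..<1}" .
    show ?thesis using R1 e se beta unfolding 1 2 by (intro exI[of _ "s * e"]) auto
  qed
qed

lemma reach_ends:
  assumes "oint J" "J \<subseteq> {0<..<1}"
  shows "\<exists>n e. 0 < e \<and> e < 1 \<and> reach n J {0<..<e} \<and> reach n J {1 - e<..<1}"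
proof -
  have step: "\<exists>n e. 0 < e \<and> e < 1 \<and> reach n J {0<..<e} \<and> reach n J {1 - e<..<1}" if "oint J" "J \<subseteq> {0<..<1}" "s ^ k * len J \<ge> 1" for k J
    using that
  proof (induction k arbitrary: J)
    case 0
    \<comment> \<open>An uncut \<open>J\<close> of length at least 1 would have an image of length
      at least \<open>s > 1\<close> inside the unit interval.\<close>
    have "\<exists>d. d \<in> J \<and> d \<in> cuts"
    proof (rule ccontr)
      assume "\<nexists>d. d \<in> J \<and> d \<in> cuts"
      then have "branch 1 J (T ` J)" using 0 by (intro branch_1) auto
      from branch_oint[OF this] have "s * len J \<le> 1"
        using oint_len_le_1[of "T ` J"] by simp
      moreover have "s * 1 \<le> s * len J" using 0(3) by (intro mult_left_mono) auto
      ultimately show False using beta by linarith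
    qed
    then obtain d where "d \<in> J" "d \<in> cuts" by blast
    from cut_reach_ends[OF 0(1,2) this] obtain e where "0 < e" "e < 1" "reach 1 J {0<..<e}" "reach 1 J {1 - e<..<1}" by blast
    then show ?case by - (rule exI[of _ "1::nat"], rule exI[of _ e], simp)
  next
    case (Suc k)
    show ?case
    proof (cases "J \<inter> cuts = {}")
      case True
      then have br: "branch 1 J (T ` J)" using Suc.prems by (intro branch_1)
      note b = branch_oint[OF br]
      have "s ^ k * len (T ` J) \<ge> 1" using b(5) Suc.prems(3) by (simp add: mult_ac)
      from Suc.IH[OF b(2,4) this] show ?thesis
        using reach_trans[OF branch_reach[OF br]] by blast
    next
      case False
      then obtain d where "d \<in> J" "d \<in> cuts" by blast
      from cut_reach_ends[OF Suc.prems(1,2) this] obtain e where "0 < e" "e < 1" "reach 1 J {0<..<e}" "reach 1 J {1 - e<..<1}" by blast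
      then show ?thesis by - (rule exI[of _ "1::nat"], rule exI[of _ e], simp)
    qed
  qed
  obtain k where "1 / len J < s ^ k" using real_arch_pow[OF beta] by blast
  then have "s ^ k * len J \<ge> 1" using oint_len_pos[OF assms(1)] by (simp add: field_simps)
  then show ?thesis using step assms by blast
qed

text \<open>\<open>\<gamma>\<close> bounds the distances between breaks of \<open>T ^^ m\<close>
  from below, so a shorter interval contains at most one of them.\<close>

lemma short_half:
  "\<exists>\<gamma>>0. \<forall>I. oint I \<longrightarrow> len I < \<gamma> \<longrightarrow> (\<exists>J\<subseteq>I. oint J \<and> J \<inter> breaks cuts m = {} \<and> len J \<ge> len I / 2)"
proof -
  obtain \<gamma> where \<gamma>: "\<gamma> > 0"
    "\<forall>x\<in>breaks cuts m. \<forall>y\<in>breaks cuts m. x \<noteq> y \<longrightarrow> \<gamma> \<le> \<bar>x - y\<bar>"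
    using finite_real_gap[OF finite_breaks[OF cutset_cuts]] by blast
  have "\<exists>J\<subseteq>I. oint J \<and> J \<inter> breaks cuts m = {} \<and> len J \<ge> len I / 2" if I: "oint I" "len I < \<gamma>" for I
  proof (rule oint_half_avoiding[OF I(1)])
    fix x y assume xy: "x \<in> I" "y \<in> I" "x \<in> breaks cuts m" "y \<in> breaks cuts m"
    obtain u v where uv: "I = {u<..<v}" "len I = v - u" using I(1) by (rule ointE)
    have "\<bar>x - y\<bar> < v - u" using xy uv(1) by auto
    then show "x = y" using xy \<gamma>(2) I(2) uv(2) by force
  qed
  then show ?thesis using \<gamma>(1) by blast
qed

text \<open>A round passes to a half without breaks and applies \<open>T ^^ m\<close>, so the length
  grows by a factor of at least \<open>s ^ m / 2\<close>. The hypothesis limits the number of rounds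
  to \<open>j\<close>. The quotient \<open>len K / s ^ q\<close> is the length of the piece of
  \<open>I\<close> mapped onto \<open>K\<close>, and this piece has been halved at most
  \<open>j\<close> times.\<close>

lemma expand:
  assumes half: "\<And>I. oint I \<Longrightarrow> len I < \<gamma> \<Longrightarrow>
      \<exists>J\<subseteq>I. oint J \<and> J \<inter> breaks cuts m = {} \<and> len J \<ge> len I / 2"
    and "oint I" "I \<subseteq> {0<..<1}" "len I * (s ^ m / 2) ^ j \<ge> \<gamma>"
  shows "\<exists>q K. reach q I K \<and> oint K \<and> K \<subseteq> {0<..<1} \<and> len K \<ge> \<gamma> \<and> len K / s ^ q \<ge> len I / 2 ^ j"
  using assms(2-)
proof (induction j arbitrary: I)
  case 0
  then show ?case using branch_reach[OF branch_0] by (intro exI[of _ 0] exI[of _ I]) auto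
next
  case (Suc j)
  show ?case
  proof (cases "len I < \<gamma>")
    case False
    have "len I / 2 ^ Suc j \<le> len I / 1"
      by (rule divide_left_mono) (use oint_len_pos[OF Suc.prems(1)] in \<open>auto simp del: power_Suc\<close>)
    then show ?thesis using False branch_reach[OF branch_0] Suc.prems
      by (intro exI[of _ 0] exI[of _ I]) auto
  next
    case True
    then obtain J where J: "J \<subseteq> I" "oint J" "J \<inter> breaks cuts m = {}" "len J \<ge> len I / 2"
      using half Suc.prems by blast
    then have br: "branch m J ((T ^^ m) ` J)" using Suc.prems by (auto simp: branch_def)
    note b = branch_oint[OF br]
    have spos: "s ^ m > 0" using beta by simp
    have "len ((T ^^ m) ` J) \<ge> len I * (s ^ m / 2)"
      using b(5) mult_left_mono[OF J(4), of "s ^ m"] spos by (simp add: mult_ac)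
    then have "len ((T ^^ m) ` J) * (s ^ m / 2) ^ j \<ge> len I * (s ^ m / 2) * (s ^ m / 2) ^ j"
      using spos by (intro mult_right_mono) auto
    then have "len ((T ^^ m) ` J) * (s ^ m / 2) ^ j \<ge> \<gamma>"
      using Suc.prems(3) by (simp add: mult.assoc)
    from Suc.IH[OF b(2,4) this] obtain q K where K: "reach q ((T ^^ m) ` J) K" "oint K"
      "K \<subseteq> {0<..<1}" "len K \<ge> \<gamma>" "len K / s ^ q \<ge> len ((T ^^ m) ` J) / 2 ^ j" by blast
    have "reach (m + q) I K"
      using reach_trans[OF branch_reach[OF br] K(1)] reach_mono J(1) by blast
    moreover have "len K / s ^ (m + q) \<ge> len I / 2 ^ Suc j"
    proof -
      have "len I / 2 ^ Suc j \<le> len J / 2 ^ j" using J(4) by (simp add: field_simps)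
      also have "\<dots> = (len ((T ^^ m) ` J) / 2 ^ j) / s ^ m" using b(5) spos by simp
      also have "\<dots> \<le> (len K / s ^ q) / s ^ m" using K(5) spos by (intro divide_right_mono) auto
      finally show ?thesis by (simp add: power_add mult.commute)
    qed
    ultimately show ?thesis using K by blast
  qed
qed

text \<open>Compactness: every interval of length at least \<open>\<delta>\<close> contains one of finitely many grid intervals.\<close>

lemma grid_uniform:
  fixes Q :: "nat \<Rightarrow> real set \<Rightarrow> bool"
  assumes ex: "\<And>J. oint J \<Longrightarrow> J \<subseteq> {0<..<1} \<Longrightarrow> \<exists>q. Q q J"
    and mono: "\<And>q J J'. Q q J \<Longrightarrow> J \<subseteq> J' \<Longrightarrow> Q q J'"
    and "\<delta> > 0"
  shows "\<exists>P. \<forall>J. oint J \<longrightarrow> J \<subseteq> {0<..<1} \<longrightarrow> len J \<ge> \<delta> \<longrightarrow> (\<exists>q\<le>P. Q q J)"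
proof -
  obtain N where N: "2 / \<delta> < real N" using reals_Archimedean2 by blast
  then have Npos: "N > 0" using assms(3) by (cases N) (auto simp: field_simps)
  define G where "G i = {real i / real N<..<real (Suc i) / real N}" for i
  have "\<exists>q. Q q (G i)" if "i < N" for i
  proof -
    have "real (Suc i) / N \<le> 1" "real i / N \<ge> 0" "real i / N < real (Suc i) / N"
      using that Npos by (auto simp: field_simps)
    then show ?thesis unfolding G_def
      by (intro ex ointI subsetI) (simp_all only: greaterThanLessThan_iff, linarith)
  qed
  then obtain f where f: "\<And>i. i < N \<Longrightarrow> Q (f i) (G i)" by metis
  have "\<exists>q\<le>Max (f ` {..<N}). Q q J" if J: "oint J" "J \<subseteq> {0<..<1}" "len J \<ge> \<delta>" for J
  proof -
    obtain u v where uv: "u < v" "J = {u<..<v}" "len J = v - u" using J(1) by (rule ointE)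
    have uv1: "0 \<le> u" "v \<le> 1"
      using J(2) uv(1) unfolding uv(2) by (auto simp: greaterThanLessThan_subseteq_greaterThanLessThan)
    define i where "i = nat \<lceil>u * N\<rceil>"
    have i: "u * N \<le> real i" "real i < u * N + 1"
      using uv1(1) unfolding i_def by (auto simp: nat_ceiling_le_eq) (linarith | simp)+
    have "(v - u) * N > 2"
    proof -
      have "2 < \<delta> * N" using N assms(3) by (simp add: field_simps)
      also have "\<dots> \<le> (v - u) * N" using J(3) uv(3) by (intro mult_right_mono) auto
      finally show ?thesis .
    qed
    then have i2: "real (Suc i) \<le> v * N" using i(2) by (simp add: algebra_simps)
    also have "\<dots> \<le> 1 * real N" using uv1(2) by (intro mult_right_mono) auto
    finally have "i < N" by simp
    have "G i \<subseteq> J"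
      using i(1) i2 Npos unfolding G_def uv(2)
      by (auto simp: greaterThanLessThan_subseteq_greaterThanLessThan field_simps)
    then have "Q (f i) J" using f[OF \<open>i < N\<close>] mono by blast
    moreover have "f i \<le> Max (f ` {..<N})" using \<open>i < N\<close> by (intro Max_ge) auto
    ultimately show ?thesis by blast
  qed
  then show ?thesis by blast
qed

lemma long_expand:
  "\<exists>\<gamma>>0. \<forall>I. oint I \<longrightarrow> I \<subseteq> {0<..<1} \<longrightarrow> (\<exists>q K. reach q I K \<and> oint K \<and> K \<subseteq> {0<..<1} \<and> len K \<ge> \<gamma>)"
proof -
  obtain m where m: "2 < s ^ m" using real_arch_pow[OF beta] by blast
  obtain \<gamma> where \<gamma>: "\<gamma> > 0" "\<And>I. oint I \<Longrightarrow> len I < \<gamma> \<Longrightarrow>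
      \<exists>J\<subseteq>I. oint J \<and> J \<inter> breaks cuts m = {} \<and> len J \<ge> len I / 2"
    using short_half by metis
  have "\<exists>q K. reach q I K \<and> oint K \<and> K \<subseteq> {0<..<1} \<and> len K \<ge> \<gamma>" if I: "oint I" "I \<subseteq> {0<..<1}" for I
  proof -
    obtain j where "\<gamma> / len I < (s ^ m / 2) ^ j" using real_arch_pow[of "s ^ m / 2"] m by auto
    then have "len I * (s ^ m / 2) ^ j \<ge> \<gamma>" using oint_len_pos[OF I(1)] by (simp add: field_simps)
    from expand[OF \<gamma>(2) I this] show ?thesis by blast
  qed
  then show ?thesis using \<gamma>(1) by blast
qed

text \<open>The end neighbourhoods from \<open>reach_ends\<close> depend on the interval. Intervals
  of length at least \<open>\<gamma>\<close> can share one size by \<open>grid_uniform\<close>, and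
  \<open>long_expand\<close> first makes every interval that long.\<close>

lemma ex_window:
  "\<exists>\<eta>>0. \<eta> \<le> 1 / 2 \<and> (\<forall>J. oint J \<longrightarrow> J \<subseteq> {0<..<1} \<longrightarrow>
     (\<exists>n. reach n J {0<..<\<eta>}) \<and> (\<exists>n. reach n J {1 - \<eta><..<1}))"
proof -
  define R where "R J e \<longleftrightarrow> (\<exists>n. reach n J {0<..<e} \<and> reach n J {1 - e<..<1})" for J e
  have R_shrink: "R J e'" if "R J e" "0 < e'" "e' \<le> e" for J e e'
    using that reach_shrink[of _ J "{0<..<e}" "{0<..<e'}"]
      reach_shrink[of _ J "{1 - e<..<1}" "{1 - e'<..<1}"] ointI[of 0 e'] ointI[of "1 - e'" 1]
    unfolding R_def by (auto simp: greaterThanLessThan_subseteq_greaterThanLessThan)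
  obtain \<gamma> where \<gamma>: "\<gamma> > 0" "\<And>I. oint I \<Longrightarrow> I \<subseteq> {0<..<1} \<Longrightarrow>
      \<exists>q K. reach q I K \<and> oint K \<and> K \<subseteq> {0<..<1} \<and> len K \<ge> \<gamma>"
    using long_expand by metis
  \<comment> \<open>Sizes are indexed by natural numbers to fit \<open>grid_uniform\<close>; the
    offset 2 yields \<open>\<eta> \<le> 1 / 2\<close>.\<close>
  have "\<exists>P. \<forall>J. oint J \<longrightarrow> J \<subseteq> {0<..<1} \<longrightarrow> len J \<ge> \<gamma> \<longrightarrow> (\<exists>q\<le>P. R J (1 / real (q + 2)))"
  proof (rule grid_uniform)
    fix J assume "oint J" "J \<subseteq> {0<..<1}"
    then obtain e where e: "e > 0" "R J e" using reach_ends unfolding R_def by blast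
    obtain q where "1 / real (Suc q) < e" using nat_approx_posE[OF e(1)] by blast
    moreover have "1 / real (q + 2) \<le> 1 / real (Suc q)" by (simp add: field_simps)
    ultimately show "\<exists>q. R J (1 / real (q + 2))" using R_shrink[OF e(2), of "1 / real (q + 2)"]
      by (intro exI[of _ q]) auto
  next
    show "R J' (1 / real (q + 2))" if "R J (1 / real (q + 2))" "J \<subseteq> J'" for q J J'
      using that reach_mono unfolding R_def by blast
  qed (rule \<gamma>(1))
  then obtain P where P: "\<And>J. oint J \<Longrightarrow> J \<subseteq> {0<..<1} \<Longrightarrow> len J \<ge> \<gamma> \<Longrightarrow> \<exists>q\<le>P. R J (1 / real (q + 2))"
    by blast
  define \<eta> where "\<eta> = 1 / real (P + 2)"
  have \<eta>: "\<eta> > 0" "\<eta> \<le> 1 / 2" by (auto simp: \<eta>_def field_simps)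
  have "(\<exists>n. reach n J {0<..<\<eta>}) \<and> (\<exists>n. reach n J {1 - \<eta><..<1})" if J: "oint J" "J \<subseteq> {0<..<1}" for J
  proof -
    obtain q K where K: "reach q J K" "oint K" "K \<subseteq> {0<..<1}" "len K \<ge> \<gamma>" using \<gamma>(2)[OF J] by blast
    obtain p where p: "p \<le> P" "R K (1 / real (p + 2))" using P[OF K(2-4)] by blast
    have "R K \<eta>" using R_shrink[OF p(2) \<eta>(1)] p(1) by (simp add: \<eta>_def field_simps)
    then show ?thesis using reach_trans[OF K(1)] unfolding R_def by blast
  qed
  then show ?thesis using \<eta> by blast
qed

end

section \<open>Returns to the window \<open>V\<close>: delay, loss of length and number of
  branches\<close>

locale beta_window = beta_dynamics +
  fixes \<eta> :: real
  assumes eta: "0 < \<eta>" "\<eta> \<le> 1 / 2"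
    and reach_left: "\<And>J. oint J \<Longrightarrow> J \<subseteq> {0<..<1} \<Longrightarrow> \<exists>n. reach n J {0<..<\<eta>}"
    and reach_right: "\<And>J. oint J \<Longrightarrow> J \<subseteq> {0<..<1} \<Longrightarrow> \<exists>n. reach n J {1 - \<eta><..<1}"
begin

abbreviation V :: "real set" where "V \<equiv> {0<..<\<eta>}"

lemma V_oint: "oint V" "V \<subseteq> {0<..<1}" "len V = \<eta>"
  using eta by (auto simp: ointI)

lemma reach_V_bounded:
  assumes "\<delta> > 0"
  shows "\<exists>P. \<forall>J. oint J \<longrightarrow> J \<subseteq> {0<..<1} \<longrightarrow> len J \<ge> \<delta> \<longrightarrow> (\<exists>q\<le>P. reach q J V)"
  using grid_uniform[of "\<lambda>q J. reach q J V"] reach_left reach_mono assms by blast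

text \<open>\<open>\<eta> / s ^ q\<close> is the length of the piece of \<open>I\<close> mapped onto
  \<open>V\<close>. In \<open>expand\<close>, \<open>j\<close> rounds of growth
  \<open>\<theta> = s ^ m / 2\<close> lose a factor \<open>2 ^ j\<close>. For large \<open>m\<close>
  one has \<open>2 \<le> \<theta> powr \<kappa>\<close>, so this loss is at most of order
  \<open>len I powr (- \<kappa>)\<close>.\<close>

lemma reach_V_quantitative:
  assumes "\<kappa> > 0"
  shows "\<exists>c>0. \<forall>I. oint I \<longrightarrow> I \<subseteq> {0<..<1} \<longrightarrow> (\<exists>q. reach q I V \<and> \<eta> / s ^ q \<ge> c * len I powr (1 + \<kappa>))"
proof -
  obtain m where m: "2 * (1 + 2 powr (1 / \<kappa>)) < s ^ m" using real_arch_pow[OF beta] by blast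
  define \<theta> where "\<theta> = s ^ m / 2"
  have \<theta>: "\<theta> > 1" "\<theta> > 2 powr (1 / \<kappa>)" 
  proof -
    have *: "x / 2 > 1 \<and> x / 2 > p" if "2 * (1 + p) < x" "p \<ge> 0" for x p :: real using that by simp
    show "\<theta> > 1" "\<theta> > 2 powr (1 / \<kappa>)" using *[OF m] by (auto simp: \<theta>_def)
  qed
  have \<theta>2: "2 \<le> \<theta> powr \<kappa>"
    using powr_mono2[of \<kappa> "2 powr (1 / \<kappa>)" \<theta>] \<theta> assms by (simp add: powr_powr)
  obtain \<gamma> where \<gamma>: "\<gamma> > 0" "\<And>I. oint I \<Longrightarrow> len I < \<gamma> \<Longrightarrow>
      \<exists>J\<subseteq>I. oint J \<and> J \<inter> breaks cuts m = {} \<and> len J \<ge> len I / 2"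
    using short_half by metis
  obtain P where P: "\<And>J. oint J \<Longrightarrow> J \<subseteq> {0<..<1} \<Longrightarrow> len J \<ge> \<gamma> \<Longrightarrow> \<exists>q\<le>P. reach q J V"
    using reach_V_bounded[OF \<gamma>(1)] by blast
  \<comment> \<open>The two entries of the minimum serve the cases \<open>j = 0\<close> and
    \<open>j > 0\<close> below.\<close>
  define c1 where "c1 = min 1 (1 / (\<gamma> * \<theta>) powr \<kappa>)"
  have c1: "c1 > 0" using \<gamma> \<theta> by (auto simp: c1_def)
  define c where "c = c1 * (\<eta> / s ^ P)"
  have "c > 0" using c1 eta beta by (simp add: c_def)
  moreover have "\<exists>q. reach q I V \<and> \<eta> / s ^ q \<ge> c * len I powr (1 + \<kappa>)" if I: "oint I" "I \<subseteq> {0<..<1}" for I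
  proof -
    have pos: "len I > 0" and le1: "len I \<le> 1" using oint_len_pos oint_len_le_1 I by auto
    \<comment> \<open>Minimality ensures, for positive \<open>j\<close>, that
      \<open>\<theta> ^ j\<close> exceeds \<open>\<gamma> / len I\<close> by at most the factor
      \<open>\<theta>\<close>.\<close>
    define j where "j = (LEAST j. len I * \<theta> ^ j \<ge> \<gamma>)"
    have ex: "\<exists>j. len I * \<theta> ^ j \<ge> \<gamma>"
    proof -
      obtain j where "\<gamma> / len I < \<theta> ^ j" using real_arch_pow[OF \<theta>(1)] by blast
      then show ?thesis using pos by (intro exI[of _ j]) (simp add: field_simps)
    qed
    have j: "len I * \<theta> ^ j \<ge> \<gamma>" unfolding j_def using ex by (rule LeastI_ex)
    have lower: "len I / 2 ^ j \<ge> c1 * len I powr (1 + \<kappa>)"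
    proof (cases j)
      case 0
      have "c1 * len I powr (1 + \<kappa>) \<le> 1 * len I powr 1"
        using assms pos le1 c1 by (intro mult_mono powr_mono') (auto simp: c1_def)
      then show ?thesis using 0 pos by simp
    next
      case (Suc i)
      have "\<not> len I * \<theta> ^ i \<ge> \<gamma>" using not_less_Least[of i "\<lambda>j. len I * \<theta> ^ j \<ge> \<gamma>"] Suc
        unfolding j_def by simp
      then have "\<theta> ^ j \<le> \<gamma> * \<theta> / len I" using Suc pos \<theta> by (simp add: field_simps)
      have "2 ^ j \<le> (\<theta> powr \<kappa>) ^ j" using \<theta>2 by (intro power_mono) auto
      also have "\<dots> = (\<theta> ^ j) powr \<kappa>"
        using \<theta> by (simp add: powr_powr mult.commute flip: powr_realpow)
      also have "\<dots> \<le> (\<gamma> * \<theta> / len I) powr \<kappa>"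
        using \<open>\<theta> ^ j \<le> _\<close> \<theta> assms by (intro powr_mono2) auto
      also have "\<dots> = (\<gamma> * \<theta>) powr \<kappa> / len I powr \<kappa>"
        using \<gamma> \<theta> pos by (simp add: powr_divide)
      finally have "len I * (len I powr \<kappa> / (\<gamma> * \<theta>) powr \<kappa>) \<le> len I / 2 ^ j"
        using pos \<gamma> \<theta> by (simp add: field_simps)
      moreover have "c1 * len I powr (1 + \<kappa>) \<le> len I * (len I powr \<kappa> / (\<gamma> * \<theta>) powr \<kappa>)"
      proof -
        have "c1 * len I powr (1 + \<kappa>) \<le> (1 / (\<gamma> * \<theta>) powr \<kappa>) * len I powr (1 + \<kappa>)"
          by (intro mult_right_mono) (auto simp: c1_def)
        then show ?thesis using pos by (simp add: powr_add)
      qed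
      ultimately show ?thesis by linarith
    qed
    obtain q K where K: "reach q I K" "oint K" "K \<subseteq> {0<..<1}" "len K \<ge> \<gamma>" "len K / s ^ q \<ge> len I / 2 ^ j"
      using expand[OF \<gamma>(2) I j[unfolded \<theta>_def]] by blast
    obtain p where p: "p \<le> P" "reach p K V" using P[OF K(2-4)] by blast
    have sp: "s ^ p \<le> s ^ P" "s ^ p > 0" "s ^ q > 0" "s ^ P > 0"
      using p(1) beta by (auto intro: power_increasing)
    have "c * len I powr (1 + \<kappa>) \<le> (len K / s ^ q) * (\<eta> / s ^ P)"
      unfolding c_def using lower K(5) eta sp
      by (subst mult.assoc[of c1], subst mult.commute[of "\<eta> / s ^ P"], subst mult.assoc[symmetric])
        (intro mult_right_mono; simp)
    also have "\<dots> \<le> (1 / s ^ q) * (\<eta> / s ^ p)"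
      using oint_len_le_1[OF K(2,3)] oint_len_pos[OF K(2)] eta sp
      by (intro mult_mono divide_right_mono divide_left_mono) auto
    also have "\<dots> = \<eta> / s ^ (q + p)" by (simp add: power_add)
    finally show ?thesis using reach_trans[OF K(1) p(2)] by blast
  qed
  ultimately show ?thesis by blast
qed

text \<open>Laps of total length \<open>\<eta> / 2\<close> fill the middle half of \<open>V\<close>.
  The short ones account for at most \<open>\<eta> / 4\<close>, and each of the others has length at
  most \<open>1 / s ^ n\<close>, so at least \<open>\<eta> / 4 * s ^ n\<close> long ones exist.
  Their images reach \<open>V\<close> within \<open>P\<close> more steps; pigeonholing makes the
  delay common. The middle half keeps closures inside parent intervals later on.\<close>

lemma many_branches:
  "\<exists>c>0. \<exists>P. \<forall>n\<ge>1. \<exists>n'\<in>{n..n + P}. \<exists>\<A>. finite \<A> \<and> pairwise disjnt \<A> \<and>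
     (\<forall>A\<in>\<A>. branch n' A V \<and> A \<subseteq> {\<eta>/4<..<3*\<eta>/4}) \<and> c * s ^ n \<le> real (card \<A>)"
proof -
  \<comment> \<open>With the ends of the middle half as breaks, every lap lies inside
    \<open>W\<close> or off it. They are breaks only from time 1 on, whence
    \<open>n \<ge> 1\<close>.\<close>
  define S where "S = cuts \<union> {\<eta>/4, 3*\<eta>/4}"
  have S: "cutset S" using cutset_cuts eta by (auto simp: cutset_def S_def)
  obtain C where C: "C > 0" "\<And>n. real (card (breaks S n)) + 1 \<le> C * s ^ n"
    using card_breaks_bound[OF S] by blast
  \<comment> \<open>Chosen so that \<open>C * s ^ n\<close> laps shorter than
    \<open>\<delta> / s ^ n\<close> have total length at most \<open>\<eta> / 4\<close>.\<close>
  define \<delta> where "\<delta> = \<eta> / (4 * C)"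
  have "\<delta> > 0" using C eta by (simp add: \<delta>_def)
  then obtain P where P: "\<And>J. oint J \<Longrightarrow> J \<subseteq> {0<..<1} \<Longrightarrow> len J \<ge> \<delta> \<Longrightarrow> \<exists>q\<le>P. reach q J V"
    using reach_V_bounded by blast
  define W where "W = {\<eta>/4<..<3*\<eta>/4}"
  have W: "W \<subseteq> {0<..<1}" "len W = \<eta> / 2" using eta by (auto simp: W_def field_simps)
  \<comment> \<open>The factor \<open>\<eta> / 4\<close> from the length count, divided by the
    number \<open>P + 1\<close> of possible delays.\<close>
  define c where "c = \<eta> / (4 * real (P + 1))"
  have "c > 0" using eta by (simp add: c_def)
  have "\<exists>n'\<in>{n..n + P}. \<exists>\<A>. finite \<A> \<and> pairwise disjnt \<A> \<and>
     (\<forall>A\<in>\<A>. branch n' A V \<and> A \<subseteq> W) \<and> c * s ^ n \<le> real (card \<A>)" if n: "n \<ge> 1" for n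
  proof -
    let ?F = "breaks S n"
    have fin: "finite ?F" using finite_breaks[OF S] .
    note lfin = finite_laps[OF fin breaks_subset]
    have sn: "s ^ n > 0" using beta by simp
    define \<L> where "\<L> = {L \<in> laps ?F. L \<subseteq> W}"
    have Lfin: "finite \<L>" using lfin by (simp add: \<L>_def)
    have S_breaks: "S \<subseteq> ?F"
      using breaks_1[of S] S breaks_mono[OF n, of S] by (simp add: cutset_def)
    have "W \<subseteq> ?F \<union> \<Union>\<L>"
    proof
      fix x assume x: "x \<in> W"
      show "x \<in> ?F \<union> \<Union>\<L>"
      proof (cases "x \<in> ?F")
        case False
        then obtain L where L: "L \<in> laps ?F" "x \<in> L" using laps_cover[OF fin, of x] x W(1) by blast
        obtain u v where uv: "u < v" "L = {u<..<v}" using laps_oint[OF L(1)] by (rule ointE)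
        have "\<eta>/4 \<notin> L" "3*\<eta>/4 \<notin> L" using laps_avoid[OF L(1)] S_breaks by (auto simp: S_def)
        then have "L \<subseteq> W" using uv L(2) x by (auto simp: W_def)
        then show ?thesis using L by (auto simp: \<L>_def)
      qed simp
    qed
    note W_cover = this
    have 1: "\<eta> / 2 \<le> (\<Sum>L\<in>\<L>. len L)"
    proof -
      have "len W \<le> (\<Sum>L\<in>\<L>. len L)"
        using W_cover laps_oint fin Lfin by (intro len_le_sum) (auto simp: \<L>_def W_def)
      then show ?thesis by (simp add: W(2))
    qed
    define \<G> where "\<G> = {L \<in> \<L>. len L \<ge> \<delta> / s ^ n}"
    have Gfin: "finite \<G>" using Lfin by (simp add: \<G>_def)
    have br: "branch n L ((T ^^ n) ` L)" if "L \<in> \<L>" for L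
      using lap_branch[OF S] that by (auto simp: \<L>_def)
    have len_L: "len L \<le> 1 / s ^ n" if "L \<in> \<L>" for L
      using branch_oint[OF br[OF that]] oint_len_le_1[of "(T ^^ n) ` L"] sn by (simp add: field_simps)
    have "(\<Sum>L\<in>\<L>. len L) = (\<Sum>L\<in>\<L> - \<G>. len L) + (\<Sum>L\<in>\<G>. len L)"
      using Lfin by (intro sum.subset_diff) (auto simp: \<G>_def)
    also have "\<dots> \<le> real (card (\<L> - \<G>)) * (\<delta> / s ^ n) + real (card \<G>) * (1 / s ^ n)"
      using len_L by (intro add_mono sum_bounded_above) (auto simp: \<G>_def)
    also have "real (card (\<L> - \<G>)) * (\<delta> / s ^ n) \<le> (C * s ^ n) * (\<delta> / s ^ n)"
    proof (rule mult_right_mono)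
      have "card (\<L> - \<G>) \<le> card (laps ?F)" using lfin by (intro card_mono) (auto simp: \<L>_def)
      then have "real (card (\<L> - \<G>)) \<le> real (card ?F) + 1" using lfin(2) by linarith
      then show "real (card (\<L> - \<G>)) \<le> C * s ^ n" using C(2)[of n] by linarith
    qed (use \<open>\<delta> > 0\<close> sn in auto)
    also have "(C * s ^ n) * (\<delta> / s ^ n) = \<eta> / 4" using C sn by (simp add: \<delta>_def)
    finally have "\<eta> / 4 \<le> real (card \<G>) * (1 / s ^ n)" using 1 by linarith
    then have 2: "\<eta> / 4 * s ^ n \<le> real (card \<G>)" using sn by (simp add: field_simps)
    have "\<exists>p A. p \<le> P \<and> A \<subseteq> L \<and> branch (n + p) A V" if "L \<in> \<G>" for L
    proof -
      have L: "L \<in> \<L>" using that by (simp add: \<G>_def)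
      note b = branch_oint[OF br[OF L]]
      have "len ((T ^^ n) ` L) \<ge> \<delta>" using b(5) that sn by (simp add: \<G>_def field_simps)
      then obtain p where p: "p \<le> P" "reach p ((T ^^ n) ` L) V" using P b by blast
      from reach_trans[OF branch_reach[OF br[OF L]] p(2)] show ?thesis
        using p(1) unfolding reach_def by blast
    qed
    then obtain p A where pA: "\<And>L. L \<in> \<G> \<Longrightarrow> p L \<le> P" "\<And>L. L \<in> \<G> \<Longrightarrow> A L \<subseteq> L"
      "\<And>L. L \<in> \<G> \<Longrightarrow> branch (n + p L) (A L) V" by metis
    have "\<exists>k\<le>P. c * s ^ n \<le> real (card {L \<in> \<G>. p L = k})"
    proof (rule ccontr)
      assume no: "\<not> ?thesis"
      have "card \<G> = (\<Sum>k\<in>{..P}. card {L \<in> \<G>. p L = k})"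
        using pA(1) Gfin by (subst card_UN_disjoint[symmetric]) (auto intro!: arg_cong[where f = card])
      then have "real (card \<G>) = (\<Sum>k\<in>{..P}. real (card {L \<in> \<G>. p L = k}))" by simp
      also have "\<dots> < (\<Sum>k\<in>{..P}. c * s ^ n)"
        using no by (intro sum_strict_mono) (simp_all add: not_le, metis linorder_not_less)
      also have "\<dots> = real (P + 1) * c * s ^ n" by simp
      also have "real (P + 1) * c = \<eta> / 4"
      proof -
        have "x * (\<eta> / (4 * x)) = \<eta> / 4" if "x \<noteq> 0" for x using that by (simp add: field_simps)
        from this[of "real (P + 1)"] show ?thesis unfolding c_def by simp
      qed
      finally show False using 2 by simp
    qed
    then obtain k where k: "k \<le> P" "c * s ^ n \<le> real (card {L \<in> \<G>. p L = k})" by blast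
    define \<A> where "\<A> = A ` {L \<in> \<G>. p L = k}"
    have disj: "L = L'" if "L \<in> \<G>" "L' \<in> \<G>" "x \<in> A L" "x \<in> A L'" for L L' x
    proof (rule laps_disjoint[OF _ _ _ _ breaks_subset])
      show "L \<in> laps ?F" "L' \<in> laps ?F" using that(1,2) by (simp_all add: \<G>_def \<L>_def)
      show "x \<in> L" "x \<in> L'" using that pA(2) by blast+
    qed
    have ne: "A L \<noteq> {}" if "L \<in> \<G>" for L
      using oint_len_pos[OF branch_oint(1)[OF pA(3)[OF that]]] by force
    have "inj_on A \<G>"
    proof (rule inj_onI)
      fix L L' assume L: "L \<in> \<G>" "L' \<in> \<G>" "A L = A L'"
      obtain x where "x \<in> A L" using ne[OF L(1)] by blast
      then show "L = L'" using disj[OF L(1,2)] L(3) by simp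
    qed
    then have "card \<A> = card {L \<in> \<G>. p L = k}"
      unfolding \<A>_def by (intro card_image) (auto intro: inj_on_subset)
    moreover have "pairwise disjnt \<A>" using disj unfolding \<A>_def pairwise_def disjnt_def by blast
    moreover have "\<forall>B\<in>\<A>. branch (n + k) B V \<and> B \<subseteq> W"
      using pA unfolding \<A>_def \<G>_def \<L>_def by blast
    moreover have "finite \<A>" using Gfin by (simp add: \<A>_def)
    ultimately show ?thesis using k by (intro bexI[of _ "n + k"] exI[of _ \<A>]) auto
  qed
  then show ?thesis using \<open>c > 0\<close> unfolding W_def by blast
qed

end

section \<open>The support of the invariant measure\<close>

context beta_window
begin

text \<open>One side is enough to enter the target around \<open>a\<close>, and one side is all that
  is available at 0 and 1.\<close>

definition germ :: "real \<Rightarrow> bool" where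
  "germ a \<longleftrightarrow> (\<exists>\<rho>>0. \<exists>p. reach p V {a<..<a + \<rho>} \<or> reach p V {a - \<rho><..<a})"

text \<open>Orbits are followed only along branches, so the set is open, but it is forward invariant
  only off the cuts.\<close>

definition orbit_set :: "real set" where
  "orbit_set = \<Union>{J. \<exists>n. reach n V J}"

lemma reach_oint: "reach n J K \<Longrightarrow> oint K" "reach n J K \<Longrightarrow> K \<subseteq> {0<..<1}"
  unfolding reach_def using branch_oint(2,4) by blast+

lemma orbit_open: "open orbit_set"
  unfolding orbit_set_def using reach_oint oint_open by (intro open_Union) auto

lemma orbit_subset: "orbit_set \<subseteq> {0<..<1}"
  unfolding orbit_set_def using reach_oint by blast

lemma orbit_left: "V \<subseteq> orbit_set"
  unfolding orbit_set_def using branch_reach[OF branch_0[OF V_oint(1,2)]] by blast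

lemma orbit_right: "{1 - \<eta><..<1} \<subseteq> orbit_set"
  unfolding orbit_set_def using reach_right[OF V_oint(1,2)] by blast

lemma open_small_oint:
  fixes U :: "real set"
  assumes "open U" "x \<in> U"
  shows "\<exists>e>0. {x - e<..<x + e} \<subseteq> U"
  using assms by (simp add: open_contains_ball ball_eq_greaterThanLessThan)

lemma closed_cuts: "closed cuts"
  using finite_cuts by (rule finite_imp_closed)

lemma orbit_step:
  assumes "y \<in> orbit_set" "y \<notin> cuts"
  shows "T y \<in> orbit_set"
proof -
  obtain n J where J: "reach n V J" "y \<in> J" using assms(1) by (auto simp: orbit_set_def)
  have "open (J - cuts)" using reach_oint(1)[OF J(1)] oint_open closed_cuts by (intro open_Diff) auto
  then obtain e where e: "e > 0" "{y - e<..<y + e} \<subseteq> J - cuts"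
    using open_small_oint[of "J - cuts" y] J(2) assms(2) by blast
  let ?K = "{y - e<..<y + e}"
  have K: "oint ?K" "?K \<subseteq> J" "?K \<inter> cuts = {}" using e by (auto intro!: ointI)
  have "reach n V ?K" using reach_shrink[OF J(1) K(1,2)] .
  moreover have "branch 1 ?K (T ` ?K)" using K reach_oint(2)[OF J(1)] by (intro branch_1) auto
  ultimately have "reach (n + 1) V (T ` ?K)" using reach_trans branch_reach by blast
  then show ?thesis unfolding orbit_set_def using e(1) by force
qed

text \<open>A branch of \<open>T\<close> has an integer constant term, so an end point that is a cut
  is sent to an integer, that is, to 0 or 1.\<close>

lemma image_at_cut:
  assumes "branch 1 {u<..<v} J" "u < v" "u \<in> cuts \<or> v \<in> cuts"
  shows "\<exists>w. 0 < w \<and> w < 1 \<and> J = {0<..<w} \<or> 0 < w \<and> w < 1 \<and> J = {w<..<1} \<or> J = {0<..<1}"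
proof -
  obtain c where c: "\<And>x. x \<in> {u<..<v} \<Longrightarrow> (T ^^ 1) x = \<beta> ^ 1 * x + c"
    "J = (\<lambda>x. \<beta> ^ 1 * x + c) ` {u<..<v}" using assms(1) by (elim branchE) (rule that)
  obtain x where x: "u < x" "x < v" using dense assms(2) by blast
  have "c = - of_int \<lfloor>\<beta> * x\<rfloor>" using c(1)[of x] x by (simp add: beta_map_def frac_def)
  then have cint: "c \<in> \<int>" by simp
  obtain p q where pq: "J = {p<..<q}" "p < q" "{p, q} = {\<beta> * u + c, \<beta> * v + c}"
  proof (cases "\<beta> > 0")
    case True
    show ?thesis using True assms(2) beta_nonzero
      by (intro that[of "\<beta> * u + c" "\<beta> * v + c"]) (auto simp: c(2) affine_image_Ioo)
  next
    case False
    then show ?thesis using assms(2) beta_nonzero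
      by (intro that[of "\<beta> * v + c" "\<beta> * u + c"]) (auto simp: c(2) affine_image_Ioo)
  qed
  have "p \<in> \<int> \<or> q \<in> \<int>"
  proof -
    have "\<beta> * u + c \<in> \<int> \<or> \<beta> * v + c \<in> \<int>" using assms(3) cint by (auto simp: cuts_def)
    then show ?thesis using pq(3) by (metis insertCI insertE singletonD)
  qed
  moreover have pq01: "0 \<le> p" "q \<le> 1"
    using branch_oint(4)[OF assms(1)] pq
    by (auto simp: greaterThanLessThan_subseteq_greaterThanLessThan)
  ultimately have "p = 0 \<or> q = 1"
    using pq(2) by (auto elim!: Ints_cases)
  then show ?thesis
  proof
    assume "p = 0"
    then show ?thesis using pq pq01 by (intro exI[of _ q]) (cases "q = 1"; simp)
  next
    assume "q = 1"
    then show ?thesis using pq pq01 by (intro exI[of _ p]) (cases "p = 0"; simp)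
  qed
qed

text \<open>An interval ending at 0 or 1 merges with \<open>V\<close> or with
  \<open>{1 - \<eta><..<1}\<close>, both of which lie in the orbit set.\<close>

lemma orbit_enlarge:
  assumes "J \<subseteq> orbit_set" "y \<in> J" "J = {0<..<w} \<or> J = {w<..<1}" "0 \<le> w" "w \<le> 1"
  shows "\<exists>R. oint R \<and> R \<subseteq> orbit_set \<and> y \<in> R \<and> len R \<ge> \<eta>"
  using assms(3)
proof
  assume J: "J = {0<..<w}"
  have "{0<..<max w \<eta>} \<subseteq> orbit_set" using assms(1) orbit_left unfolding J by (auto simp: max_def)
  then show ?thesis using J assms(2) eta
    by (intro exI[of _ "{0<..<max w \<eta>}"]) (auto intro!: ointI)
next
  assume J: "J = {w<..<1}"
  have "{min w (1 - \<eta>)<..<1} \<subseteq> orbit_set" using assms(1) orbit_right unfolding J by (auto simp: min_def)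
  then show ?thesis using J assms(2,5) eta
    by (intro exI[of _ "{min w (1 - \<eta>)<..<1}"]) (auto intro!: ointI)
qed

text \<open>A long interval is carried along with the orbit of a point of \<open>V\<close>. If a cut
  trims it, the image ends at 0 or 1 and can be enlarged again; otherwise its length grows. Hence
  all components of the orbit set have length at least \<open>\<eta>\<close>.\<close>

lemma orbit_interval:
  assumes "y \<in> orbit_set"
  shows "\<exists>R. oint R \<and> R \<subseteq> orbit_set \<and> y \<in> R \<and> len R \<ge> \<eta>"
proof -
  have *: "\<exists>R. oint R \<and> R \<subseteq> orbit_set \<and> (T ^^ n) x \<in> R \<and> len R \<ge> \<eta>"
    if "x \<in> V" "x \<notin> breaks cuts n" for n x
    using that
  proof (induction n)
    case 0
    then show ?case using V_oint orbit_left by (intro exI[of _ V]) auto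
  next
    case (Suc n)
    have x01: "x \<in> {0<..<1}" using Suc.prems V_oint by auto
    let ?y = "(T ^^ n) x"
    have "x \<notin> breaks cuts n" using Suc.prems(2) breaks_mono[of n "Suc n"] by auto
    then obtain R where R: "oint R" "R \<subseteq> orbit_set" "?y \<in> R" "len R \<ge> \<eta>"
      using Suc.IH[OF Suc.prems(1)] by blast
    have ycut: "?y \<notin> cuts" using Suc.prems(2) x01 by (auto simp: breaks_def)
    have y01: "?y \<in> {0<..<1}" using R orbit_subset by blast
    obtain L where L: "L \<in> laps cuts" "?y \<in> L" using laps_cover[OF finite_cuts, of ?y] ycut y01 by blast
    obtain p q where L': "p \<in> insert 0 cuts" "q \<in> insert 1 cuts" "L = {p<..<q}" "{p<..<q} \<inter> cuts = {}"
      using L(1) by (rule lapsE)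
    obtain u v where R': "u < v" "R = {u<..<v}" "len R = v - u" using R(1) by (rule ointE)
    have uv01: "0 \<le> u" "v \<le> 1"
    proof -
      have "R \<subseteq> {0<..<1}" using R(2) orbit_subset by (rule order_trans)
      then show "0 \<le> u" "v \<le> 1" unfolding R'(2) using R'(1)
        by (auto simp: greaterThanLessThan_subseteq_greaterThanLessThan)
    qed
    define u' v' where "u' = max p u" "v' = min q v"
    have K: "u' < v'" "?y \<in> {u'<..<v'}" "{u'<..<v'} \<subseteq> R" "{u'<..<v'} \<inter> cuts = {}"
      using L(2) L'(3,4) R(3) R'(2) by (auto simp: u'_v'_def)
    have "{u'<..<v'} \<subseteq> {0<..<1}" using K(3) R(2) orbit_subset by blast
    then have br: "branch 1 {u'<..<v'} (T ` {u'<..<v'})" using K by (intro branch_1 ointI)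
    have Ty: "(T ^^ Suc n) x \<in> T ` {u'<..<v'}" using K(2) by simp
    have sub: "T ` {u'<..<v'} \<subseteq> orbit_set"
    proof
      fix z assume "z \<in> T ` {u'<..<v'}"
      then obtain w where w: "w \<in> {u'<..<v'}" "z = T w" by blast
      then have "w \<in> orbit_set" "w \<notin> cuts" using K R(2) by blast+
      then show "z \<in> orbit_set" using orbit_step w by simp
    qed
    show ?case
    proof (cases "u' \<in> cuts \<or> v' \<in> cuts")
      case True
      from image_at_cut[OF br K(1) this] obtain w where
        "0 < w \<and> w < 1 \<and> T ` {u'<..<v'} = {0<..<w} \<or> 0 < w \<and> w < 1 \<and> T ` {u'<..<v'} = {w<..<1}
          \<or> T ` {u'<..<v'} = {0<..<1}" by blast
      then have "\<exists>w. (T ` {u'<..<v'} = {0<..<w} \<or> T ` {u'<..<v'} = {w<..<1}) \<and> 0 \<le> w \<and> w \<le> 1"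
        by (elim disjE; intro exI[of _ w] exI[of _ "1::real"]; simp)
      then show ?thesis using orbit_enlarge[OF sub Ty] by blast
    next
      case False
      have "u' = u" "v' = v"
        using False L'(1,2) uv01 R'(1) K(1) by (auto simp: u'_v'_def max_def min_def split: if_splits)
      then have "len (T ` {u'<..<v'}) = s * len R" using branch_oint(5)[OF br] R'(2) by simp
      also have "\<dots> \<ge> 1 * \<eta>" using R(4) beta eta by (intro mult_mono) auto
      finally have "len (T ` {u'<..<v'}) \<ge> \<eta>" by simp
      then show ?thesis using sub Ty branch_oint(2)[OF br] by blast
    qed
  qed
  obtain n I where I: "y \<in> (T ^^ n) ` I" "I \<subseteq> V" "I \<inter> breaks cuts n = {}"
    using assms by (auto simp: orbit_set_def reach_def branch_def)
  then obtain x where "x \<in> V" "x \<notin> breaks cuts n" "y = (T ^^ n) x" by blast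
  then show ?thesis using * by blast
qed

text \<open>Orbit points accumulate at \<open>z2\<close>, so one lies between \<open>z1\<close> and
  \<open>z3\<close>, and its interval of length at least \<open>\<eta>\<close> contains neither of
  these.\<close>

lemma boundary_three:
  assumes "z1 \<notin> orbit_set" "z2 \<in> closure orbit_set - orbit_set" "z3 \<notin> orbit_set" "z1 < z2" "z2 < z3"
  shows "z3 - z1 \<ge> \<eta>"
proof -
  have "{z1<..<z3} \<inter> orbit_set \<noteq> {}"
    using assms open_Int_closure_eq_empty[of "{z1<..<z3}" orbit_set] by auto
  then obtain y where y: "z1 < y" "y < z3" "y \<in> orbit_set" by auto
  obtain R where R: "oint R" "R \<subseteq> orbit_set" "y \<in> R" "len R \<ge> \<eta>" using orbit_interval[OF y(3)] by blast
  obtain u v where uv: "u < v" "R = {u<..<v}" "len R = v - u" using R(1) by (rule ointE)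
  have "z1 \<notin> {u<..<v}" "z3 \<notin> {u<..<v}" using assms(1,3) R(2) uv(2) by auto
  then show ?thesis using R(3,4) uv y by auto
qed

text \<open>Among infinitely many boundary points, three would share a cell of mesh
  \<open>\<eta> / 2\<close>, against \<open>boundary_three\<close>.\<close>

lemma finite_boundary: "finite (closure orbit_set - orbit_set)" (is "finite ?Z")
proof (rule ccontr)
  assume inf: "infinite ?Z"
  define f where "f z = \<lfloor>2 * z / \<eta>\<rfloor>" for z :: real
  have cl: "closure orbit_set \<subseteq> {0..1}"
    using orbit_subset by (intro closure_minimal) auto
  have "f ` ?Z \<subseteq> {0..\<lfloor>2 / \<eta>\<rfloor>}"
  proof
    fix k assume "k \<in> f ` ?Z"
    then obtain z where z: "z \<in> ?Z" "k = f z" by blast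
    then have "0 \<le> z" "z \<le> 1" using cl by auto
    then have "0 \<le> 2 * z / \<eta>" "2 * z / \<eta> \<le> 2 / \<eta>" using eta by (auto simp: field_simps)
    then show "k \<in> {0..\<lfloor>2 / \<eta>\<rfloor>}" using z(2) floor_mono by (auto simp: f_def)
  qed
  then have "finite (f ` ?Z)" by (rule finite_subset) simp
  from pigeonhole_infinite[OF inf this] obtain z0 where z0: "infinite {z \<in> ?Z. f z = f z0}" by blast
  obtain B where B: "finite B" "card B = 3" "B \<subseteq> {z \<in> ?Z. f z = f z0}"
    using infinite_arbitrarily_large[OF z0, of 3] by blast
  obtain x y z where xyz: "B = {x, y, z}" "x \<noteq> y" "y \<noteq> z" "x \<noteq> z"
    using B(2) by (auto simp: card_3_iff)
  have close: "z2 - z1 < \<eta>" if "f z1 = f z2" for z1 z2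
  proof -
    have "2 * z2 / \<eta> - 2 * z1 / \<eta> < 1" using that unfolding f_def by linarith
    then show ?thesis using eta by (simp add: field_simps)
  qed
  have no: False if "z1 \<in> B" "z2 \<in> B" "z3 \<in> B" "z1 < z2" "z2 < z3" for z1 z2 z3
  proof -
    have "z3 - z1 \<ge> \<eta>" using that B(3) by (intro boundary_three[of z1 z2 z3]) auto
    moreover have "f z1 = f z0" "f z3 = f z0" using that(1,3) B(3) by blast+
    then have "z3 - z1 < \<eta>" by (intro close) simp
    ultimately show False by simp
  qed
  have in3: "x \<in> B" "y \<in> B" "z \<in> B" using xyz by auto
  consider "x < y" "y < z" | "x < z" "z < y" | "y < x" "x < z" | "y < z" "z < x" | "z < x" "x < y" | "z < y" "y < x"
    using xyz(2-4) by linarith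
  then show False using no in3 by cases blast+
qed

lemma orbit_germ: "a \<in> orbit_set \<Longrightarrow> germ a"
proof -
  assume "a \<in> orbit_set"
  then obtain n J where J: "reach n V J" "a \<in> J" by (auto simp: orbit_set_def)
  then obtain e where e: "e > 0" "{a - e<..<a + e} \<subseteq> J"
    using open_small_oint[of J a] reach_oint(1) oint_open by blast
  then have "{a<..<a + e} \<subseteq> J" by auto
  from reach_shrink[OF J(1) _ this] have "reach n V {a<..<a + e}" using e(1) ointI by simp
  then show "germ a" unfolding germ_def using e(1) by blast
qed

lemma germ_0: "germ 0"
  unfolding germ_def using branch_reach[OF branch_0[OF V_oint(1,2)]] eta
  by (intro exI[of _ \<eta>]) auto

lemma germ_1: "germ 1"
  unfolding germ_def using reach_right[OF V_oint(1,2)] eta by (intro exI[of _ \<eta>]) auto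

text \<open>As \<open>\<beta> * x\<close> is no integer, \<open>T\<close> is continuous at
  \<open>x\<close>, so the image interval ends at \<open>T x\<close>.\<close>

lemma germ_branch:
  assumes "branch 1 {u<..<v} J" "u < v" "x = u \<or> x = v" "\<beta> * x \<notin> \<int>"
  shows "\<exists>\<rho>>0. J = {T x<..<T x + \<rho>} \<or> J = {T x - \<rho><..<T x}"
proof -
  obtain c where c: "\<And>x. x \<in> {u<..<v} \<Longrightarrow> (T ^^ 1) x = \<beta> ^ 1 * x + c"
    "J = (\<lambda>x. \<beta> ^ 1 * x + c) ` {u<..<v}" using assms(1) by (elim branchE) (rule that)
  obtain y where y: "u < y" "y < v" using dense assms(2) by blast
  have cfl: "c = - of_int \<lfloor>\<beta> * y\<rfloor>" using c(1)[of y] y by (simp add: beta_map_def frac_def)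
  have J: "J = (if \<beta> > 0 then {\<beta> * u + c<..<\<beta> * v + c} else {\<beta> * v + c<..<\<beta> * u + c})"
    using assms(2) beta_nonzero by (simp add: c(2) affine_image_Ioo)
  have lt: "\<beta> > 0 \<Longrightarrow> \<beta> * u < \<beta> * v" "\<beta> < 0 \<Longrightarrow> \<beta> * v < \<beta> * u" using assms(2) by auto
  have J01: "J \<subseteq> {0<..<1}" using branch_oint(4)[OF assms(1)] .
  have "0 \<le> \<beta> * x + c \<and> \<beta> * x + c \<le> 1"
  proof (cases "\<beta> > 0")
    case True
    then have "0 \<le> \<beta> * u + c" "\<beta> * v + c \<le> 1"
      using J01 lt(1) unfolding J by (auto simp: greaterThanLessThan_subseteq_greaterThanLessThan)
    then show ?thesis using assms(3) lt(1)[OF True] by auto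
  next
    case False
    then have "\<beta> < 0" using beta_nonzero by simp
    then have "0 \<le> \<beta> * v + c" "\<beta> * u + c \<le> 1"
      using J01 lt(2) unfolding J by (auto simp: greaterThanLessThan_subseteq_greaterThanLessThan)
    then show ?thesis using assms(3) lt(2)[OF \<open>\<beta> < 0\<close>] by auto
  qed
  moreover have "\<beta> * x + c \<notin> \<int>" using assms(4) cfl by (simp add: minus_in_Ints_iff)
  ultimately have "0 \<le> \<beta> * x + c \<and> \<beta> * x + c < 1" by (metis Ints_1 order_le_less)
  then have "frac (\<beta> * x) = \<beta> * x + c" using cfl by (simp add: frac_unique_iff)
  then have Tx: "T x = \<beta> * x + c" by (simp add: beta_map_def)
  show ?thesis
    using assms(3) lt beta_nonzero unfolding Tx J
    by (intro exI[of _ "\<bar>\<beta> * v - \<beta> * u\<bar>"]) (auto simp: abs_if)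
qed

text \<open>Used in contrapositive form: a preimage of a point without germ has no germ, unless it
  is sent to an integer by \<open>\<beta>\<close>.\<close>

lemma germ_step:
  assumes "germ b" "\<beta> * b \<notin> \<int>" "b \<in> {0..1}"
  shows "germ (T b)"
proof -
  obtain \<rho> p where \<rho>: "\<rho> > 0" "reach p V {b<..<b + \<rho>} \<or> reach p V {b - \<rho><..<b}"
    using assms(1) by (auto simp: germ_def)
  have "b \<in> - cuts" using assms(2) by (auto simp: cuts_def)
  then obtain e where e: "e > 0" "{b - e<..<b + e} \<subseteq> - cuts"
    using open_small_oint[of "- cuts" b] closed_cuts by (auto simp: open_Compl)
  define r where "r = min e \<rho>"
  have r: "r > 0" "r \<le> e" "r \<le> \<rho>" using e \<rho> by (auto simp: r_def)
  have r_cuts: "x \<notin> cuts" if "b - r < x" "x < b + r" for x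
    using subsetD[OF e(2), of x] that r by auto
  have fin: "germ (T b)" if "reach p V {u<..<v}" "u < v" "b = u \<or> b = v" "{u<..<v} \<inter> cuts = {}" for u v
  proof -
    have br: "branch 1 {u<..<v} (T ` {u<..<v})"
      using that reach_oint[OF that(1)] by (intro branch_1) auto
    have "reach (p + 1) V (T ` {u<..<v})" using reach_trans[OF that(1) branch_reach[OF br]] .
    then show ?thesis using germ_branch[OF br that(2,3) assms(2)] unfolding germ_def by metis
  qed
  from \<rho>(2) show ?thesis
  proof
    assume "reach p V {b<..<b + \<rho>}"
    then have "reach p V {b<..<b + r}" by (rule reach_shrink) (use r in \<open>auto intro!: ointI\<close>)
    then show ?thesis using r r_cuts by (intro fin[of b "b + r"]) auto
  next
    assume "reach p V {b - \<rho><..<b}"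
    then have "reach p V {b - r<..<b}" by (rule reach_shrink) (use r in \<open>auto intro!: ointI\<close>)
    then show ?thesis using r r_cuts by (intro fin[of "b - r" b]) auto
  qed
qed

end

lemma oint_nonempty: "oint I \<Longrightarrow> I \<noteq> {}"
  by (elim ointE) simp

section \<open>Lebesgue-almost every orbit enters \<open>V\<close>\<close>

context beta_window
begin

text \<open>With the end \<open>\<eta>\<close> of \<open>V\<close> added, an iterate maps a lap
  either into \<open>V\<close> or off it.\<close>

definition marks :: "real set" where
  "marks = cuts \<union> {\<eta>}"

lemma cutset_marks: "cutset marks"
  using cutset_cuts eta by (auto simp: cutset_def marks_def)

definition survivors :: "nat \<Rightarrow> real set" where
  "survivors n = {x \<in> {0<..<1} - breaks marks n. \<forall>i<n. (T ^^ i) x \<notin> V}"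

definition survivor_laps :: "nat \<Rightarrow> real set set" where
  "survivor_laps n = {L \<in> laps (breaks marks n). L \<subseteq> survivors n}"

text \<open>An iterate of the lap that meets both \<open>V\<close> and its complement would contain
  \<open>\<eta>\<close>, which is a mark.\<close>

lemma lap_survives:
  assumes "L \<in> laps (breaks marks n)" "x \<in> L" "x \<in> survivors n"
  shows "L \<subseteq> survivors n"
proof
  fix y assume y: "y \<in> L"
  have y01: "y \<in> {0<..<1} - breaks marks n"
    using laps_subset[OF breaks_subset assms(1)] laps_avoid[OF assms(1)] y by auto
  have "(T ^^ i) y \<notin> V" if i: "i < n" for i
  proof
    assume yV: "(T ^^ i) y \<in> V"
    have avoid: "L \<inter> breaks marks i = {}"
      using laps_avoid[OF assms(1)] breaks_mono[of i n marks] i by auto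
    then have "L \<inter> breaks cuts i = {}"
      using breaks_mono_set[of cuts marks i] by (auto simp: marks_def)
    then have br: "branch i L ((T ^^ i) ` L)"
      using laps_oint[OF assms(1)] laps_subset[OF breaks_subset assms(1)] by (simp add: branch_def)
    have "(T ^^ i) x \<in> {0<..<1}" using branch_oint(4)[OF br] assms(2) by blast
    moreover have "(T ^^ i) x \<notin> V" using assms(3) i by (auto simp: survivors_def)
    ultimately have "\<eta> \<in> (T ^^ i) ` L"
      using yV oint_mem_between[OF branch_oint(2)[OF br], of "(T ^^ i) y" "(T ^^ i) x" \<eta>] y assms(2)
      by auto
    then obtain w where w: "w \<in> L" "(T ^^ i) w = \<eta>" by auto
    then have "w \<in> breaks marks n"
      using i laps_subset[OF breaks_subset assms(1)] by (auto simp: breaks_def marks_def)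
    then show False using laps_avoid[OF assms(1)] w(1) by blast
  qed
  then show "y \<in> survivors n" using y01 by (simp add: survivors_def)
qed

lemma survivors_eq: "survivors n = \<Union>(survivor_laps n)"
proof
  show "survivors n \<subseteq> \<Union>(survivor_laps n)"
  proof
    fix x assume x: "x \<in> survivors n"
    then obtain L where "L \<in> laps (breaks marks n)" "x \<in> L"
      using laps_cover[OF finite_breaks[OF cutset_marks], of x n] unfolding survivors_def by blast
    then show "x \<in> \<Union>(survivor_laps n)"
      using lap_survives x unfolding survivor_laps_def by blast
  qed
qed (auto simp: survivor_laps_def)

lemma finite_survivor_laps: "finite (survivor_laps n)"
  using finite_laps(1)[OF finite_breaks[OF cutset_marks] breaks_subset] by (simp add: survivor_laps_def)

lemma survivor_laps_oint: "L \<in> survivor_laps n \<Longrightarrow> oint L"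
  using laps_oint by (auto simp: survivor_laps_def)

lemma survivors_fmeasurable: "survivors n \<in> fmeasurable lborel"
  unfolding survivors_eq using oint_fmeasurable survivor_laps_oint finite_survivor_laps
  by (intro fmeasurable.finite_Union) auto

lemma len_survivors: "len (survivors n) = (\<Sum>L\<in>survivor_laps n. len L)"
proof (rule antisym)
  have b: "survivors n \<in> sets borel" "emeasure lborel (survivors n) < \<infinity>"
    using survivors_fmeasurable[of n] fmeasurableD fmeasurableD2[of "survivors n" lborel]
    by (auto simp: less_top)
  show "len (survivors n) \<le> (\<Sum>L\<in>survivor_laps n. len L)"
    using finite_survivor_laps survivor_laps_oint b survivors_eq by (intro len_le_sum[where F = "{}"]) auto
  have "pairwise disjnt (survivor_laps n)"
    using laps_pairwise[OF breaks_subset] by (rule pairwise_subset) (auto simp: survivor_laps_def)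
  then show "(\<Sum>L\<in>survivor_laps n. len L) \<le> len (survivors n)"
    using finite_survivor_laps survivor_laps_oint b survivors_eq by (intro sum_len_le) auto
qed

lemma survivors_antimono: "n \<le> m \<Longrightarrow> survivors m \<subseteq> survivors n"
  using breaks_mono[of n m marks] by (auto simp: survivors_def)

text \<open>Each long lap sends a fixed proportion of its length into \<open>V\<close> within
  \<open>P\<close> further steps, and the short laps have total length at most
  \<open>C * \<delta>\<close>.\<close>

lemma survivors_contract:
  assumes C: "\<And>n. real (card (breaks marks n)) + 1 \<le> C * s ^ n" and "\<delta> > 0"
  shows "\<exists>c>0. \<exists>P. \<forall>n. len (survivors (n + P)) \<le> len (survivors n) - c * (len (survivors n) - C * \<delta>)"
proof -
  obtain P where P: "\<And>J. oint J \<Longrightarrow> J \<subseteq> {0<..<1} \<Longrightarrow> len J \<ge> \<delta> \<Longrightarrow> \<exists>q\<le>P. reach q J V"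
    using reach_V_bounded[OF assms(2)] by blast
  define c where "c = \<eta> / s ^ P"
  have c: "c > 0" using eta beta by (simp add: c_def)
  \<comment> \<open>\<open>survivors\<close> tests only times below its index, so an entrance at
    time \<open>n + P\<close> is first seen at index \<open>n + Suc P\<close>.\<close>
  have "len (survivors (n + Suc P)) \<le> len (survivors n) - c * (len (survivors n) - C * \<delta>)" for n
  proof -
    let ?B = "survivor_laps n" and ?S = "survivors (n + Suc P)"
    define G where "G = {L \<in> ?B. len L \<ge> \<delta> / s ^ n}"
    have sn: "s ^ n > 0" using beta by simp
    have fin: "finite ?B" "finite G" using finite_survivor_laps by (auto simp: G_def)
    have br: "branch n L ((T ^^ n) ` L)" if "L \<in> ?B" for L
      using lap_branch[OF cutset_marks] that by (auto simp: survivor_laps_def)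
    have long: "len (?S \<inter> L) \<le> len L - c * len L" if L: "L \<in> G" for L
    proof -
      have LB: "L \<in> ?B" using L by (simp add: G_def)
      note b = branch_oint[OF br[OF LB]]
      have "len ((T ^^ n) ` L) \<ge> \<delta>" using b(5) L sn by (simp add: G_def field_simps)
      then obtain p where p: "p \<le> P" "reach p ((T ^^ n) ` L) V" using P b by blast
      from reach_trans[OF branch_reach[OF br[OF LB]] p(2)]
      obtain A where A: "A \<subseteq> L" "branch (n + p) A V" unfolding reach_def by blast
      have "len L \<le> 1 / s ^ n"
        using b(5) oint_len_le_1[OF b(2,4)] sn by (simp add: field_simps)
      then have "c * len L \<le> c * (1 / s ^ n)" using c by (intro mult_left_mono) auto
      also have "\<dots> \<le> \<eta> / s ^ (n + p)"
        unfolding c_def power_add using p(1) eta beta sn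
        by (simp add: field_simps power_increasing)
      also have "\<dots> = len A"
        using branch_oint(5)[OF A(2)] V_oint(3) beta by (simp add: field_simps)
      finally have lenA: "c * len L \<le> len A" .
      have "?S \<inter> L \<subseteq> L - A"
      proof
        fix x assume x: "x \<in> ?S \<inter> L"
        have "(T ^^ (n + p)) x \<notin> V" using x p(1) by (auto simp: survivors_def)
        then have "x \<notin> A" using A(2) unfolding branch_def by blast
        then show "x \<in> L - A" using x by blast
      qed
      then have "len (?S \<inter> L) \<le> len (L - A)"
        using survivors_fmeasurable oint_fmeasurable[OF b(1)] oint_fmeasurable[OF branch_oint(1)[OF A(2)]]
        by (intro measure_mono_fmeasurable) (auto intro: fmeasurableD fmeasurable.Diff)
      also have "\<dots> = len L - len A"
        using oint_fmeasurable[OF b(1)] oint_fmeasurable[OF branch_oint(1)[OF A(2)]] A(1)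
        by (intro measure_Diff) (auto dest: fmeasurableD2 fmeasurableD)
      finally show ?thesis using lenA by simp
    qed
    have short: "len (?S \<inter> L) \<le> len L" if "L \<in> ?B" for L
      using survivors_fmeasurable oint_fmeasurable[OF survivor_laps_oint[OF that]]
      by (intro measure_mono_fmeasurable) (auto intro: fmeasurableD)
    have "?S = (\<Union>L\<in>?B. ?S \<inter> L)"
      using survivors_antimono[of n "n + Suc P"] survivors_eq[of n] by auto
    then have "len ?S = len (\<Union>L\<in>?B. ?S \<inter> L)" by simp
    also have "\<dots> \<le> (\<Sum>L\<in>?B. len (?S \<inter> L))"
      using survivors_fmeasurable oint_fmeasurable[OF survivor_laps_oint] fin
      by (intro measure_UNION_le) (auto intro!: sets.Int dest: fmeasurableD)
    also have "\<dots> = (\<Sum>L\<in>?B - G. len (?S \<inter> L)) + (\<Sum>L\<in>G. len (?S \<inter> L))"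
      using fin by (intro sum.subset_diff) (auto simp: G_def)
    also have "\<dots> \<le> (\<Sum>L\<in>?B - G. len L) + (\<Sum>L\<in>G. len L - c * len L)"
      using long short by (intro add_mono sum_mono) auto
    also have "\<dots> = (\<Sum>L\<in>?B - G. len L) + (\<Sum>L\<in>G. len L) - c * (\<Sum>L\<in>G. len L)"
      by (simp add: sum_subtractf sum_distrib_left)
    also have "(\<Sum>L\<in>?B - G. len L) + (\<Sum>L\<in>G. len L) = len (survivors n)"
      unfolding len_survivors using fin by (intro sum.subset_diff[symmetric]) (auto simp: G_def)
    finally have 1: "len ?S \<le> len (survivors n) - c * (\<Sum>L\<in>G. len L)" .
    have "(\<Sum>L\<in>?B - G. len L) \<le> real (card (?B - G)) * (\<delta> / s ^ n)"
      by (intro sum_bounded_above) (auto simp: G_def)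
    also have "\<dots> \<le> (C * s ^ n) * (\<delta> / s ^ n)"
    proof (rule mult_right_mono)
      have "card (?B - G) \<le> card (laps (breaks marks n))"
        using finite_laps(1)[OF finite_breaks[OF cutset_marks] breaks_subset]
        by (intro card_mono) (auto simp: survivor_laps_def)
      also have "\<dots> \<le> card (breaks marks n) + 1"
        by (rule finite_laps(2)[OF finite_breaks[OF cutset_marks] breaks_subset])
      finally show "real (card (?B - G)) \<le> C * s ^ n" using C[of n] by linarith
    qed (use assms(2) sn in auto)
    also have "\<dots> = C * \<delta>" using beta_nonzero by simp
    finally have "(\<Sum>L\<in>?B - G. len L) \<le> C * \<delta>" .
    moreover have "len (survivors n) = (\<Sum>L\<in>?B - G. len L) + (\<Sum>L\<in>G. len L)"
      unfolding len_survivors using fin by (intro sum.subset_diff) (auto simp: G_def)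
    ultimately have "(\<Sum>L\<in>G. len L) \<ge> len (survivors n) - C * \<delta>" by simp
    then have "c * (\<Sum>L\<in>G. len L) \<ge> c * (len (survivors n) - C * \<delta>)" using c by (intro mult_left_mono) auto
    then show ?thesis using 1 by linarith
  qed
  then show ?thesis using c by blast
qed

lemma survivors_tendsto_0: "(\<lambda>n. len (survivors n)) \<longlonglongrightarrow> 0"
proof -
  obtain C where C: "C > 0" "\<And>n. real (card (breaks marks n)) + 1 \<le> C * s ^ n"
    using card_breaks_bound[OF cutset_marks] by blast
  have anti: "decseq (\<lambda>n. len (survivors n))"
    unfolding decseq_def using survivors_antimono survivors_fmeasurable fmeasurableD[OF survivors_fmeasurable]
    by (intro allI impI measure_mono_fmeasurable)
  then obtain b where b: "(\<lambda>n. len (survivors n)) \<longlonglongrightarrow> b" "\<And>n. b \<le> len (survivors n)"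
    using decseq_convergent[OF anti, of 0] by auto
  have "b \<ge> 0" using b(1) by (rule LIMSEQ_le_const) simp
  have "b \<le> C * \<delta>" if "\<delta> > 0" for \<delta>
  proof -
    obtain c P where cP: "c > 0"
      "\<And>n. len (survivors (n + P)) \<le> len (survivors n) - c * (len (survivors n) - C * \<delta>)"
      using survivors_contract[OF C(2) \<open>\<delta> > 0\<close>] by blast
    have "b \<le> b - c * (b - C * \<delta>)"
    proof (rule LIMSEQ_le)
      show "(\<lambda>n. len (survivors (n + P))) \<longlonglongrightarrow> b" using b(1) by (rule LIMSEQ_ignore_initial_segment)
      show "(\<lambda>n. len (survivors n) - c * (len (survivors n) - C * \<delta>)) \<longlonglongrightarrow> b - c * (b - C * \<delta>)"
        by (intro tendsto_intros b(1))
      show "\<exists>N. \<forall>n\<ge>N. len (survivors (n + P)) \<le> len (survivors n) - c * (len (survivors n) - C * \<delta>)"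
        using cP(2) by blast
    qed
    then have "c * (b - C * \<delta>) \<le> 0" by simp
    then show ?thesis using cP(1) by (simp add: mult_le_0_iff)
  qed
  \<comment> \<open>This choice of \<open>\<delta>\<close> turns the estimate into
    \<open>b \<le> b / 2\<close>.\<close>
  from this[of "b / (2 * C)"] have "b \<le> 0" using C(1) \<open>b \<ge> 0\<close> by (cases "b = 0") auto
  then show ?thesis using b(1) \<open>b \<ge> 0\<close> by simp
qed

lemma survivors_null: "(\<Inter>n. survivors n) \<in> null_sets lborel"
proof (rule null_setsI)
  have m: "survivors n \<in> sets lborel" for n using survivors_fmeasurable fmeasurableD by blast
  have "emeasure lborel (\<Inter>n. survivors n) \<le> ennreal \<epsilon>" if \<epsilon>: "\<epsilon> > 0" for \<epsilon>
  proof -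
    obtain n where n: "len (survivors n) < \<epsilon>"
      using order_tendstoD(2)[OF survivors_tendsto_0 \<epsilon>] eventually_sequentially by (meson order_refl)
    have "emeasure lborel (\<Inter>n. survivors n) \<le> emeasure lborel (survivors n)"
      using m by (intro emeasure_mono) auto
    also have "\<dots> = ennreal (len (survivors n))"
      using survivors_fmeasurable by (intro emeasure_eq_measure2)
    also have "\<dots> \<le> ennreal \<epsilon>" using n by (intro ennreal_leI) simp
    finally show ?thesis .
  qed
  then show "emeasure lborel (\<Inter>n. survivors n) = 0"
    using ennreal_le_epsilon[of 0 "emeasure lborel (\<Inter>n. survivors n)"] by simp
  show "(\<Inter>n. survivors n) \<in> sets lborel" using m by auto
qed

lemma countable_all_breaks: "countable (\<Union>n. breaks marks n)"
  using finite_breaks[OF cutset_marks] by (intro countable_UN) (auto intro: countable_finite)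

lemma AE_lborel_enters: "AE x in lborel. x \<in> {0<..<1} \<longrightarrow> (\<exists>n. (T ^^ n) x \<in> V) \<and> (\<forall>n. x \<notin> breaks cuts n)"
proof -
  have "(\<Union>n. breaks marks n) \<in> null_sets lborel"
    using countable_all_breaks by (rule countable_imp_null_set_lborel)
  then have "(\<Inter>n. survivors n) \<union> (\<Union>n. breaks marks n) \<in> null_sets lborel"
    using survivors_null by (intro null_sets.Un)
  then have "AE x in lborel. x \<notin> (\<Inter>n. survivors n) \<union> (\<Union>n. breaks marks n)" by (rule AE_not_in)
  then show ?thesis
  proof eventually_elim
    case (elim x)
    show ?case
    proof (intro impI conjI allI)
      assume x: "x \<in> {0<..<1}"
      show "x \<notin> breaks cuts n" for n
        using elim breaks_mono_set[of cuts marks n] by (auto simp: marks_def)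
      show "\<exists>n. (T ^^ n) x \<in> V" using elim x by (auto simp: survivors_def)
    qed
  qed
qed

end

section \<open>One-sided neighbourhoods at every point of the support\<close>

locale parry_window = beta_window +
  fixes \<mu> :: "real measure"
  assumes parry: "parry_yrrap_measure \<beta> \<mu>"
begin

sublocale prob_space \<mu>
  using parry by (simp add: parry_yrrap_measure_def)

lemma sets_mu: "sets \<mu> = sets borel" "space \<mu> = UNIV"
  using parry sets_eq_imp_space_eq[of \<mu> borel] by (auto simp: parry_yrrap_measure_def)

lemma borel_mu: "A \<in> sets borel \<Longrightarrow> A \<in> sets \<mu>"
  by (simp add: sets_mu)

lemma T_measurable: "T \<in> borel_measurable borel" "T \<in> measurable \<mu> \<mu>"
proof -
  show 1: "T \<in> borel_measurable borel" unfolding beta_map_def frac_def by measurable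
  show "T \<in> measurable \<mu> \<mu>" using 1 sets_mu by (simp cong: measurable_cong_sets)
qed

lemma null_mu: "A \<in> null_sets lborel \<Longrightarrow> A \<in> null_sets \<mu>"
  using parry by (auto simp: parry_yrrap_measure_def absolutely_continuous_def)

lemma AE_mu: "AE x in lborel. P x \<Longrightarrow> AE x in \<mu>. P x"
  using parry absolutely_continuous_AE[of \<mu> lborel P] sets_mu(1) by (simp add: parry_yrrap_measure_def)

lemma measure_T_vimage: "A \<in> sets borel \<Longrightarrow> prob (T -` A) = prob A"
proof -
  assume A: "A \<in> sets borel"
  have "prob A = measure (distr \<mu> \<mu> T) A" using parry by (simp add: parry_yrrap_measure_def)
  also have "\<dots> = prob (T -` A)"
    using A T_measurable sets_mu by (subst measure_distr) auto
  finally show ?thesis ..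
qed

lemma Tn_measurable: "(T ^^ n) \<in> borel_measurable borel"
proof (induction n)
  case (Suc n)
  then show ?case using T_measurable(1) by (auto intro: measurable_comp simp: comp_def)
qed simp

lemma prob_iterate_vimage: "A \<in> sets borel \<Longrightarrow> prob ((T ^^ n) -` A) = prob A"
proof (induction n arbitrary: A)
  case (Suc n)
  have "T -` A \<in> sets borel" using T_measurable(1) Suc.prems measurable_sets_borel by blast
  have "(T ^^ Suc n) -` A = (T ^^ n) -` (T -` A)" by auto
  then show ?case using Suc.IH[OF \<open>T -` A \<in> _\<close>] measure_T_vimage[OF Suc.prems] by (simp only:)
qed simp

lemma AE_unit: "AE x in \<mu>. x \<in> {0<..<1}"
proof -
  have "AE x in \<mu>. x \<in> {0..<1}"
    using parry sets_mu by (intro AE_prob_1) (simp add: parry_yrrap_measure_def measure_def)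
  moreover have "AE x in \<mu>. x \<noteq> 0"
    by (rule AE_mu) (rule AE_lborel_singleton)
  ultimately show ?thesis by eventually_elim auto
qed

text \<open>Up to a null set, the orbit set is contained in its preimage under
  \<open>T ^^ n\<close>. Invariance gives both the same measure, so they agree almost everywhere. As
  almost every orbit enters \<open>V\<close>, almost every point already lies in the orbit
  set.\<close>

lemma AE_orbit: "AE x in \<mu>. x \<in> orbit_set"
proof -
  have OB: "orbit_set \<in> sets borel" using orbit_open by simp
  have good: "AE x in \<mu>. x \<in> {0<..<1} \<and> (\<exists>n. (T ^^ n) x \<in> V) \<and> (\<forall>n. x \<notin> breaks cuts n)"
    using AE_unit AE_mu[OF AE_lborel_enters] by eventually_elim auto
  have stay: "(T ^^ n) x \<in> orbit_set" if x: "x \<in> orbit_set" "\<forall>n. x \<notin> breaks cuts n" for n x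
  proof (induction n)
    case 0
    show ?case using x(1) by simp
  next
    case (Suc n)
    have "x \<in> {0<..<1}" using x(1) orbit_subset by blast
    then have "(T ^^ n) x \<notin> cuts" using spec[OF x(2), of "Suc n"] by (auto simp: breaks_def)
    then show ?case using orbit_step Suc by simp
  qed
  have pull_back: "AE x in \<mu>. (T ^^ n) x \<in> orbit_set \<longrightarrow> x \<in> orbit_set" for n
  proof -
    let ?X = "(T ^^ n) -` orbit_set"
    have X: "?X \<in> sets \<mu>" using Tn_measurable OB measurable_sets_borel borel_mu by blast
    have sub: "AE x in \<mu>. x \<in> orbit_set \<longrightarrow> x \<in> ?X"
      using good
    proof eventually_elim
      case (elim x)
      then show ?case using stay[of x n] by simp
    qed
    have "prob (?X \<inter> orbit_set) = prob orbit_set"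
    proof (rule finite_measure_eq_AE)
      show "AE x in \<mu>. x \<in> ?X \<inter> orbit_set \<longleftrightarrow> x \<in> orbit_set"
        using sub by eventually_elim blast
    qed (use X borel_mu[OF OB] in blast)+
    then have "prob (?X - orbit_set) = 0"
      using prob_iterate_vimage[OF OB, of n] finite_measure_Diff'[OF X borel_mu[OF OB]] by simp
    moreover have "?X - orbit_set \<in> events" using X borel_mu[OF OB] by blast
    ultimately have "AE x in \<mu>. x \<notin> ?X - orbit_set" using prob_eq_0 by blast
    then show ?thesis by eventually_elim blast
  qed
  have "AE x in \<mu>. \<forall>n. (T ^^ n) x \<in> orbit_set \<longrightarrow> x \<in> orbit_set"
    unfolding AE_all_countable using pull_back by blast
  then show ?thesis using good
  proof eventually_elim
    case (elim x)
    then show ?case using orbit_left by blast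
  qed
qed

lemma not_support:
  assumes "b \<notin> measure_support \<mu>"
  shows "\<exists>r>0. prob (ball b r) = 0"
proof -
  obtain U where U: "open U" "b \<in> U" "emeasure \<mu> U = 0"
    using assms by (auto simp: measure_support_def not_gr_zero)
  then obtain r where r: "r > 0" "ball b r \<subseteq> U" by (meson open_contains_ball)
  then have "emeasure \<mu> (ball b r) \<le> emeasure \<mu> U" using U borel_mu by (intro emeasure_mono) auto
  then show ?thesis using U r by (intro exI[of _ r]) (simp add: measure_def)
qed

lemma support_pos:
  assumes "a \<in> measure_support \<mu>" "r > 0"
  shows "prob (ball a r) > 0"
proof -
  have "emeasure \<mu> (ball a r) > 0" using assms by (simp add: measure_support_def)
  then show ?thesis by (simp add: emeasure_eq_measure)
qed

lemma support_closure: "measure_support \<mu> \<subseteq> closure orbit_set"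
proof
  fix a assume a: "a \<in> measure_support \<mu>"
  show "a \<in> closure orbit_set"
  proof (rule ccontr)
    assume "a \<notin> closure orbit_set"
    then have "a \<in> - closure orbit_set" "open (- closure orbit_set)" by auto
    then have "emeasure \<mu> (- closure orbit_set) > 0" using a by (auto simp: measure_support_def)
    moreover have "AE x in \<mu>. x \<notin> - closure orbit_set"
      using AE_orbit by eventually_elim (use closure_subset in auto)
    then have "emeasure \<mu> (- closure orbit_set) = 0"
      using AE_iff_measurable[of "- closure orbit_set" \<mu> "\<lambda>x. x \<notin> - closure orbit_set"] borel_mu sets_mu
      by auto
    ultimately show False by simp
  qed
qed

lemma support_subset: "measure_support \<mu> \<subseteq> {0..1}"
proof -
  have "closure orbit_set \<subseteq> {0..1}" using orbit_subset by (intro closure_minimal) auto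
  then show ?thesis using support_closure by blast
qed

definition bad :: "real set" where
  "bad = {z \<in> {0<..<1}. z \<in> measure_support \<mu> \<and> \<not> germ z}"

lemma finite_bad: "finite bad"
proof (rule finite_subset)
  show "bad \<subseteq> closure orbit_set - orbit_set"
    using support_closure orbit_germ by (auto simp: bad_def)
qed (rule finite_boundary)

text \<open>The preimage of \<open>ball z r\<close> is covered, almost everywhere, by balls of
  radius \<open>r / s\<close>. A centre off the support has a null neighbourhood. A centre in the
  support has no germ, by \<open>germ_step\<close>, so it is neither 0 nor 1 and is bad
  again.\<close>

lemma bad_preimages:
  assumes z: "z \<in> bad"
  shows "\<exists>r0>0. \<forall>r. 0 < r \<longrightarrow> r < r0 \<longrightarrow> prob (ball z r) \<le> (\<Sum>b\<in>{b \<in> bad. T b = z}. prob (ball b (r / s)))"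
proof -
  have z01: "0 < z" "z < 1" and zg: "\<not> germ z" using z by (auto simp: bad_def)
  \<comment> \<open>Bounds \<open>\<lfloor>\<beta> * x\<rfloor>\<close> for \<open>x\<close> in the
    unit interval. Candidate centres outside \<open>{0..1}\<close> do no harm, being off the
    support.\<close>
  define N where "N = \<lceil>s\<rceil> + 1"
  define Pre where "Pre = (\<lambda>k. (z + of_int k) / \<beta>) ` {-N..N}"
  let ?Z = "{b \<in> bad. T b = z}"
  have finPre: "finite Pre" by (simp add: Pre_def)
  have null: "\<forall>b\<in>Pre - ?Z. \<exists>r. r > 0 \<and> prob (ball b r) = 0"
  proof (intro ballI not_support notI)
    fix b assume b: "b \<in> Pre - ?Z"
    assume supp: "b \<in> measure_support \<mu>"
    obtain k where k: "\<beta> * b = z + of_int k" using b beta_nonzero by (auto simp: Pre_def)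
    have Tb: "T b = z" unfolding beta_map_def k using z01 by (auto simp: frac_unique_iff)
    have nint: "\<beta> * b \<notin> \<int>"
    proof
      assume "\<beta> * b \<in> \<int>"
      then have "T b = 0" by (simp add: beta_map_def)
      then show False using Tb z01 by simp
    qed
    have b01: "b \<in> {0..1}" using supp support_subset by blast
    have ng: "\<not> germ b" using germ_step[OF _ nint b01] Tb zg by auto
    have "b \<noteq> 0" "b \<noteq> 1" using ng germ_0 germ_1 by auto
    then have "b \<in> bad" using b01 supp ng by (auto simp: bad_def)
    then show False using b Tb by simp
  qed
  from bchoice[OF this] obtain \<rho> where \<rho>': "\<forall>b\<in>Pre - ?Z. \<rho> b > 0 \<and> prob (ball b (\<rho> b)) = 0" ..
  have \<rho>: "\<rho> b > 0" "prob (ball b (\<rho> b)) = 0" if "b \<in> Pre - ?Z" for b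
    using bspec[OF \<rho>' that] by simp_all
  define r0 where "r0 = Min (insert 1 (\<rho> ` (Pre - ?Z)))"
  have r0: "r0 > 0" "\<And>b. b \<in> Pre - ?Z \<Longrightarrow> r0 \<le> \<rho> b"
    using finPre \<rho>(1) by (auto simp: r0_def)
  have "prob (ball z r) \<le> (\<Sum>b\<in>?Z. prob (ball b (r / s)))" if r: "0 < r" "r < r0" for r
  proof -
    have rs: "r / s \<le> r" using beta r(1) by (simp add: field_simps)
    have "prob (ball z r) = prob (T -` ball z r)" using measure_T_vimage by simp
    also have "\<dots> \<le> prob (\<Union>b\<in>Pre. ball b (r / s))"
    proof (rule finite_measure_mono_AE)
      show "AE x in \<mu>. x \<in> T -` ball z r \<longrightarrow> x \<in> (\<Union>b\<in>Pre. ball b (r / s))"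
        using AE_unit
      proof eventually_elim
        case (elim x)
        show ?case
        proof
          assume "x \<in> T -` ball z r"
          then have d: "\<bar>z - T x\<bar> < r" by (simp add: dist_real_def)
          define k where "k = \<lfloor>\<beta> * x\<rfloor>"
          have "s * \<bar>x\<bar> < s * 1" using elim beta by (intro mult_strict_left_mono) auto
          then have "\<bar>\<beta> * x\<bar> < s" by (simp add: abs_mult)
          then have "k \<in> {-N..N}" unfolding k_def N_def by simp linarith
          moreover have "(z + of_int k) / \<beta> - x = (z - T x) / \<beta>"
            using beta_nonzero by (simp add: beta_map_def frac_def k_def field_simps)
          then have "dist ((z + of_int k) / \<beta>) x < r / s"
            using d beta by (simp add: dist_real_def abs_divide divide_strict_right_mono)
          ultimately show "x \<in> (\<Union>b\<in>Pre. ball b (r / s))" by (auto simp: Pre_def)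
        qed
      qed
    qed (auto intro!: borel_mu borel_open open_UN)
    also have "\<dots> \<le> (\<Sum>b\<in>Pre. prob (ball b (r / s)))"
      using finPre borel_mu by (intro finite_measure_subadditive_finite) auto
    also have "\<dots> \<le> (\<Sum>b\<in>?Z. prob (ball b (r / s)))"
    proof -
      have "(\<Sum>b\<in>Pre. prob (ball b (r / s))) = (\<Sum>b\<in>Pre \<inter> ?Z. prob (ball b (r / s)))"
      proof (rule sum.mono_neutral_right[OF finPre])
        show "\<forall>b\<in>Pre - Pre \<inter> ?Z. prob (ball b (r / s)) = 0"
        proof
          fix b assume "b \<in> Pre - Pre \<inter> ?Z"
          then have b: "b \<in> Pre - ?Z" by blast
          have "prob (ball b (r / s)) \<le> prob (ball b (\<rho> b))"
            using r0(2)[OF b] r rs borel_mu by (intro finite_measure_mono subset_ball) auto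
          then show "prob (ball b (r / s)) = 0" using \<rho>(2)[OF b] measure_nonneg[of \<mu> "ball b (r / s)"] by linarith
        qed
      qed auto
      also have "\<dots> \<le> (\<Sum>b\<in>?Z. prob (ball b (r / s)))"
        using finite_bad by (intro sum_mono2) auto
      finally show ?thesis .
    qed
    finally show ?thesis .
  qed
  then show ?thesis using r0(1) by blast
qed

lemma bad_empty: "bad = {}"
proof (rule ccontr)
  assume ne: "bad \<noteq> {}"
  define \<Phi> where "\<Phi> r = (\<Sum>z\<in>bad. prob (ball z r))" for r
  have "\<forall>z\<in>bad. \<exists>r0. r0 > 0 \<and> (\<forall>r. 0 < r \<longrightarrow> r < r0 \<longrightarrow>
      prob (ball z r) \<le> (\<Sum>b\<in>{b \<in> bad. T b = z}. prob (ball b (r / s))))"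
    using bad_preimages by (intro ballI)
  from bchoice[OF this] obtain R where R': "\<forall>z\<in>bad. R z > 0 \<and> (\<forall>r. 0 < r \<longrightarrow> r < R z \<longrightarrow>
      prob (ball z r) \<le> (\<Sum>b\<in>{b \<in> bad. T b = z}. prob (ball b (r / s))))" ..
  have R: "R z > 0" "0 < r \<Longrightarrow> r < R z \<Longrightarrow>
      prob (ball z r) \<le> (\<Sum>b\<in>{b \<in> bad. T b = z}. prob (ball b (r / s)))" if "z \<in> bad" for z r
    using bspec[OF R' that] by simp_all
  define r0 where "r0 = Min (R ` bad)"
  have r0: "r0 > 0" "\<And>z. z \<in> bad \<Longrightarrow> r0 \<le> R z"
    using finite_bad ne R(1) by (auto simp: r0_def)
  have step: "\<Phi> r \<le> \<Phi> (r / s)" if r: "0 < r" "r < r0" for r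
  proof -
    have "\<Phi> r \<le> (\<Sum>z\<in>bad. \<Sum>b\<in>{b \<in> {b \<in> bad. T b \<in> bad}. T b = z}. prob (ball b (r / s)))"
      unfolding \<Phi>_def
    proof (rule sum_mono)
      fix z assume z: "z \<in> bad"
      have "{b \<in> {b \<in> bad. T b \<in> bad}. T b = z} = {b \<in> bad. T b = z}" using z by auto
      then show "prob (ball z r) \<le> (\<Sum>b\<in>{b \<in> {b \<in> bad. T b \<in> bad}. T b = z}. prob (ball b (r / s)))"
        using R(2)[OF z r(1)] r0(2)[OF z] r(2) by simp
    qed
    \<comment> \<open>A point has only one image, so the preimage sets of different bad points are
      disjoint and each ball is counted once.\<close>
    also have "\<dots> = (\<Sum>b\<in>{b \<in> bad. T b \<in> bad}. prob (ball b (r / s)))"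
      using finite_bad by (intro sum.group) auto
    also have "\<dots> \<le> \<Phi> (r / s)" unfolding \<Phi>_def using finite_bad by (intro sum_mono2) auto
    finally show ?thesis .
  qed
  define r where "r = r0 / 2"
  have r: "0 < r" "r < r0" using r0 by (auto simp: r_def)
  have rj: "0 < r / s ^ j" "r / s ^ j \<le> r" for j
    using r beta one_le_power[of s j] by (auto simp: field_simps)
  have \<Phi>j: "\<Phi> r \<le> \<Phi> (r / s ^ j)" for j
  proof (induction j)
    case (Suc j)
    then show ?case using step[of "r / s ^ j"] rj[of j] r(2) by (simp add: mult.commute)
  qed simp
  have lim: "(\<lambda>j. prob (ball z (r / s ^ j))) \<longlonglongrightarrow> 0" for z
  proof -
    have dec: "decseq (\<lambda>j. ball z (r / s ^ j))"
      unfolding decseq_def using r beta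
      by (auto intro!: subset_ball divide_left_mono power_increasing mult_pos_pos)
    have "(\<Inter>j. ball z (r / s ^ j)) = {z}"
    proof
      show "(\<Inter>j. ball z (r / s ^ j)) \<subseteq> {z}"
      proof
        fix x assume x: "x \<in> (\<Inter>j. ball z (r / s ^ j))"
        show "x \<in> {z}"
        proof (rule ccontr)
          assume "x \<notin> {z}"
          then have d: "dist z x > 0" by simp
          obtain j where "r / dist z x < s ^ j" using real_arch_pow[OF beta] by blast
          then have "r / s ^ j < dist z x" using d beta by (simp add: field_simps)
          moreover have "dist z x < r / s ^ j" using x by auto
          ultimately show False by simp
        qed
      qed
    qed (use rj in auto)
    \<comment> \<open>Absolute continuity excludes atoms, which makes \<open>\<Phi>\<close> tend to
      0 along the shrinking radii.\<close>
    moreover have "prob {z} = 0"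
      using null_mu[of "{z}"] by (auto simp: measure_def null_sets_def)
    ultimately show ?thesis
      using finite_Lim_measure_decseq[OF _ dec] borel_mu by (simp add: image_subset_iff)
  qed
  have "(\<lambda>j. \<Phi> (r / s ^ j)) \<longlonglongrightarrow> (\<Sum>z\<in>bad. 0)"
    unfolding \<Phi>_def by (intro tendsto_sum lim)
  then have "\<Phi> r \<le> 0" using \<Phi>j by (intro LIMSEQ_le_const) auto
  moreover obtain z where z: "z \<in> bad" using ne by blast
  have "prob (ball z r) \<le> \<Phi> r" unfolding \<Phi>_def using finite_bad z by (intro member_le_sum) auto
  moreover have "prob (ball z r) > 0" using support_pos z r(1) by (simp add: bad_def)
  ultimately show False by simp
qed

lemma support_germ:
  assumes "a \<in> measure_support \<mu>"
  shows "germ a"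
proof (cases "a = 0 \<or> a = 1")
  case True
  then show ?thesis using germ_0 germ_1 by auto
next
  case False
  have "a \<in> {0..1}" using assms support_subset by blast
  then have "a \<in> {0<..<1}" using False by auto
  then show ?thesis using bad_empty assms unfolding bad_def by blast
qed

end

section \<open>The upper bound\<close>

lemma diam_powr_singleton: "t > 0 \<Longrightarrow> diam_powr t {x} = 0"
  by (simp add: diam_powr_def)

lemma diam_powr_le:
  assumes "t > 0" "bounded U" "diameter U \<le> d"
  shows "diam_powr t U \<le> ennreal (d powr t)"
  using assms diameter_ge_0[OF assms(2)] by (auto simp: diam_powr_def intro!: ennreal_leI powr_mono2)

text \<open>Tails of the covers cost arbitrarily little. For \<open>t > 0\<close> the points of
  \<open>D\<close> are covered for free by singletons, which later takes care of the breaks.\<close>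

lemma hausdorff_measure_zero:
  fixes W D :: "'a::metric_space set" and \<U> :: "nat \<Rightarrow> 'a set set" and N d :: "nat \<Rightarrow> real"
  assumes t: "t > 0"
    and fin: "\<And>n. finite (\<U> n)" and card: "\<And>n. real (card (\<U> n)) \<le> N n"
    and diam: "\<And>n U. U \<in> \<U> n \<Longrightarrow> bounded U \<and> diameter U \<le> d n" and d0: "d \<longlonglongrightarrow> 0"
    and summ: "summable (\<lambda>n. N n * d n powr t)"
    and "countable D" and cover: "\<And>m. W \<subseteq> D \<union> (\<Union>n\<in>{m..}. \<Union>(\<U> n))"
  shows "hausdorff_measure t W = 0"
proof -
  have "hausdorff_premeasure t \<delta> W \<le> ennreal e" if \<delta>: "\<delta> > 0" and e: "e > 0" for \<delta> e
  proof -
    obtain m1 where m1: "\<And>n. n \<ge> m1 \<Longrightarrow> d n < \<delta>"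
      using order_tendstoD(2)[OF d0 \<delta>] by (auto simp: eventually_sequentially)
    obtain m2 where m2: "\<And>n. n \<ge> m2 \<Longrightarrow> norm (\<Sum>i. N (i + n) * d (i + n) powr t) < e"
      using suminf_exist_split[OF e summ] by blast
    define m where "m = max m1 m2"
    have "\<forall>n. \<exists>h. bij_betw h {0..<card (\<U> n)} (\<U> n)"
      using fin ex_bij_betw_nat_finite by blast
    then obtain h where h: "\<And>n. bij_betw (h n) {0..<card (\<U> n)} (\<U> n)" by metis
    \<comment> \<open>Row \<open>j\<close> holds the \<open>j\<close>-th point of \<open>D\<close>,
      the members of \<open>\<U> (j + m)\<close>, and then empty sets, which cost 0. For empty
      \<open>D\<close> the singleton is arbitrary and still costs 0.\<close>
    define f where "f = (\<lambda>(j, k). case k of 0 \<Rightarrow> {from_nat_into D j}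
      | Suc k \<Rightarrow> if k < card (\<U> (j + m)) then h (j + m) k else {})"
    have f_simps: "f (j, 0) = {from_nat_into D j}"
      "f (j, Suc k) = (if k < card (\<U> (j + m)) then h (j + m) k else {})" for j k
      by (auto simp: f_def)
    have hU: "h n k \<in> \<U> n" if "k < card (\<U> n)" for n k
      using bij_betwE[OF h[of n]] that by simp
    define U where "U i = f (prod_decode i)" for i
    have f_ok: "bounded (f p) \<and> diameter (f p) \<le> \<delta>" for p
    proof (cases p)
      case (Pair j k)
      show ?thesis
      proof (cases k)
        case 0
        then show ?thesis using \<delta> by (simp add: Pair f_simps)
      next
        case (Suc k')
        have "d (j + m) < \<delta>" using m1[of "j + m"] by (simp add: m_def)
        then show ?thesis using diam[OF hU[of k' "j + m"]] \<delta> by (auto simp: Pair Suc f_simps)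
      qed
    qed
    have "W \<subseteq> (\<Union>i. U i)"
    proof
      fix x assume "x \<in> W"
      then have "x \<in> D \<or> (\<exists>n\<ge>m. \<exists>S\<in>\<U> n. x \<in> S)" using cover[of m] by auto
      then have "\<exists>p. x \<in> f p"
      proof
        assume x: "x \<in> D"
        then obtain j where "from_nat_into D j = x" using from_nat_into_surj[OF assms(7)] by blast
        then have "x \<in> f (j, 0)" by (simp add: f_simps)
        then show ?thesis by blast
      next
        assume "\<exists>n\<ge>m. \<exists>S\<in>\<U> n. x \<in> S"
        then obtain n S where S: "n \<ge> m" "S \<in> \<U> n" "x \<in> S" by blast
        obtain k where k: "k < card (\<U> n)" "h n k = S"
          using S(2) bij_betw_imp_surj_on[OF h[of n]] by (metis atLeastLessThan_iff imageE)
        have "x \<in> f (n - m, Suc k)" using S k by (simp add: f_simps)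
        then show ?thesis by blast
      qed
      then obtain p where "x \<in> f p" by blast
      then have "x \<in> U (prod_encode p)" by (simp add: U_def)
      then show "x \<in> (\<Union>i. U i)" by blast
    qed
    moreover have "\<forall>i. bounded (U i) \<and> diameter (U i) \<le> \<delta>" using f_ok by (simp add: U_def)
    ultimately have "hausdorff_premeasure t \<delta> W \<le> (\<Sum>i. diam_powr t (U i))"
      unfolding hausdorff_premeasure_def by (intro INF_lower) auto
    also have "\<dots> = (\<Sum>j. \<Sum>k. diam_powr t (f (j, k)))"
      unfolding U_def by (rule suminf_ennreal_2dimen) simp
    also have "\<dots> \<le> (\<Sum>j. ennreal (N (j + m) * d (j + m) powr t))"
    proof (rule suminf_le)
      fix j
      have "(\<Sum>k. diam_powr t (f (j, k))) = (\<Sum>k\<in>{..<Suc (card (\<U> (j + m)))}. diam_powr t (f (j, k)))"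
      proof (rule suminf_finite)
        fix k assume "k \<notin> {..<Suc (card (\<U> (j + m)))}"
        then show "diam_powr t (f (j, k)) = 0" by (cases k) (auto simp: f_simps diam_powr_def)
      qed simp
      also have "\<dots> = (\<Sum>k<card (\<U> (j + m)). diam_powr t (f (j, Suc k)))"
        by (subst sum.lessThan_Suc_shift) (simp add: f_simps diam_powr_singleton t)
      also have "\<dots> \<le> (\<Sum>k<card (\<U> (j + m)). ennreal (d (j + m) powr t))"
        using diam hU t by (intro sum_mono) (auto simp: f_simps intro!: diam_powr_le)
      also have "\<dots> = ennreal (real (card (\<U> (j + m))) * d (j + m) powr t)"
        by (simp add: ennreal_mult' ennreal_of_nat_eq_real_of_nat)
      also have "\<dots> \<le> ennreal (N (j + m) * d (j + m) powr t)"
        using card by (intro ennreal_leI mult_right_mono) auto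
      finally show "(\<Sum>k. diam_powr t (f (j, k))) \<le> ennreal (N (j + m) * d (j + m) powr t)" .
    qed auto
    also have "\<dots> = ennreal (\<Sum>j. N (j + m) * d (j + m) powr t)"
    proof (rule suminf_ennreal2)
      show "0 \<le> N (j + m) * d (j + m) powr t" for j
        using order_trans[OF of_nat_0_le_iff card[of "j + m"]] by simp
      show "summable (\<lambda>j. N (j + m) * d (j + m) powr t)"
        using summ by (rule summable_ignore_initial_segment)
    qed
    also have "\<dots> \<le> ennreal e" using m2[of m] by (intro ennreal_leI) (auto simp: m_def)
    finally show ?thesis .
  qed
  then have "hausdorff_premeasure t \<delta> W = 0" if "\<delta> > 0" for \<delta>
    using that ennreal_le_epsilon[of 0 "hausdorff_premeasure t \<delta> W"] by simp
  then show ?thesis unfolding hausdorff_measure_def by (simp cong: SUP_cong_simp)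
qed

lemma int_dist_attained: "\<exists>k. int_dist x = \<bar>x - of_int k\<bar>"
proof -
  obtain z where "z \<in> \<int>" "infdist x \<int> = dist x z"
    using infdist_attains_inf[OF closed_Ints, of x] by (metis Ints_0 empty_iff)
  then show ?thesis by (auto simp: int_dist_def Ints_def dist_real_def)
qed

lemma int_dist_le: "int_dist x \<le> \<bar>x - of_int k\<bar>"
  unfolding int_dist_def using infdist_le[of "of_int k" \<int> x] by (simp add: dist_real_def)

lemma bounded_Ioo: "bounded {u<..<v::real}"
  by (rule bounded_subset[OF bounded_closed_interval[of u v]]) auto

context beta_dynamics
begin

text \<open>For an orbit point in the open unit interval and \<open>a \<in> {0..1}\<close> the
  difference lies strictly between -1 and 1, so only -1, 0 and 1 occur as nearest integers.\<close>

definition hits :: "(real \<Rightarrow> real) \<Rightarrow> real \<Rightarrow> nat \<Rightarrow> real set set" where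
  "hits \<psi> a n = (\<lambda>(L, k). {x \<in> L. \<bar>(T ^^ n) x - a - of_int k\<bar> \<le> \<psi> (real n)}) `
     (laps (breaks cuts n) \<times> {-1..1})"

lemma hits_cover:
  assumes "x \<in> {0<..<1} - breaks cuts n" "int_dist ((T ^^ n) x - a) \<le> \<psi> (real n)" "a \<in> {0..1}"
  shows "x \<in> \<Union>(hits \<psi> a n)"
proof -
  obtain L where L: "L \<in> laps (breaks cuts n)" "x \<in> L"
    using laps_cover[OF finite_breaks[OF cutset_cuts] assms(1)] by blast
  obtain k where k: "int_dist ((T ^^ n) x - a) = \<bar>(T ^^ n) x - a - of_int k\<bar>"
    using int_dist_attained by blast
  have y: "(T ^^ n) x \<in> {0<..<1}" using assms(1) iterate_mem[of x cuts n n] by auto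
  have "\<bar>(T ^^ n) x - a - of_int k\<bar> < 1"
    using int_dist_le[of "(T ^^ n) x - a" "\<lfloor>(T ^^ n) x - a\<rfloor>"] unfolding k by linarith
  then have "\<bar>of_int k\<bar> < (2::real)" using y assms(3) by auto
  then have "k \<in> {-1..1}" by auto
  then show ?thesis unfolding hits_def using L k assms(2) by force
qed

lemma hits_diameter:
  assumes "U \<in> hits \<psi> a n" "\<psi> (real n) \<ge> 0"
  shows "bounded U \<and> diameter U \<le> 2 * \<psi> (real n) / s ^ n"
proof -
  obtain L k where L: "L \<in> laps (breaks cuts n)" "U = {x \<in> L. \<bar>(T ^^ n) x - a - of_int k\<bar> \<le> \<psi> (real n)}"
    using assms(1) by (auto simp: hits_def)
  obtain c where c: "\<And>x. x \<in> L \<Longrightarrow> (T ^^ n) x = \<beta> ^ n * x + c"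
    using lap_branch[OF cutset_cuts L(1)] by (elim branchE) (rule that)
  have sn: "s ^ n > 0" using beta by simp
  have "norm (x - y) \<le> 2 * \<psi> (real n) / s ^ n" if "x \<in> U" "y \<in> U" for x y
  proof -
    have "\<bar>\<beta> ^ n * x - \<beta> ^ n * y\<bar> \<le> 2 * \<psi> (real n)"
      using that c unfolding L(2) by auto
    then have "s ^ n * \<bar>x - y\<bar> \<le> 2 * \<psi> (real n)"
      by (simp add: abs_mult power_abs flip: right_diff_distrib)
    then show ?thesis using sn by (simp add: field_simps)
  qed
  then have "diameter U \<le> 2 * \<psi> (real n) / s ^ n" using assms(2) sn by (intro diameter_le) auto
  moreover have "U \<subseteq> {0<..<1}" using L laps_subset[OF breaks_subset L(1)] by auto
  ultimately show ?thesis using bounded_subset[OF bounded_Ioo] by blast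
qed

lemma hits_card:
  assumes "real (card (breaks cuts n)) + 1 \<le> C * s ^ n"
  shows "finite (hits \<psi> a n)" "real (card (hits \<psi> a n)) \<le> 3 * C * s ^ n"
proof -
  note fin = finite_laps[OF finite_breaks[OF cutset_cuts] breaks_subset, of n]
  show "finite (hits \<psi> a n)" using fin by (simp add: hits_def)
  have "card (hits \<psi> a n) \<le> card (laps (breaks cuts n) \<times> {-1..1::int})"
    unfolding hits_def using fin by (intro card_image_le) auto
  also have "\<dots> \<le> (card (breaks cuts n) + 1) * 3" using fin by (simp add: card_cartesian_product)
  finally have "real (card (hits \<psi> a n)) \<le> real ((card (breaks cuts n) + 1) * 3)"
    by (rule of_nat_mono)
  also have "\<dots> = 3 * (real (card (breaks cuts n)) + 1)" by simp
  also have "\<dots> \<le> 3 * (C * s ^ n)" using assms by (intro mult_left_mono) auto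
  finally show "real (card (hits \<psi> a n)) \<le> 3 * C * s ^ n" by simp
qed

lemma power_eq_exp: "s ^ n = exp (ln s * real n)"
  using beta by (simp add: exp_of_nat2_mult)

text \<open>The points hitting at time \<open>n\<close> are covered by at most
  \<open>3 * C * s ^ n\<close> sets of diameter at most \<open>2 * exp (- (l + ln s) * n)\<close>
  for large \<open>n\<close>. By \<open>t * (l + ln s) > ln s\<close> the \<open>t\<close>-th powers
  are dominated by a geometric series.\<close>

lemma upper_bound:
  assumes pos: "\<And>x. x > 0 \<Longrightarrow> \<psi> x > 0" and anti: "antimono_on {0<..} \<psi>" and a: "a \<in> {0..1}"
    and t: "t > 0" and l: "ereal l < lower_order \<psi>" and tl: "t * (l + ln s) > ln s"
  shows "hausdorff_measure t (target_set T \<psi> a) = 0"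
proof -
  obtain C where C: "C > 0" "\<And>n. real (card (breaks cuts n)) + 1 \<le> C * s ^ n"
    using card_breaks_bound[OF cutset_cuts] by blast
  \<comment> \<open>Times start at 1, as positivity of \<open>\<psi>\<close> is known only for
    positive arguments.\<close>
  let ?d = "\<lambda>n. 2 * \<psi> (real (Suc n)) / s ^ Suc n"
  show ?thesis
  \<comment> \<open>The point 0 joins the breaks because it may lie in the target set but lies in no
    lap.\<close>
  proof (rule hausdorff_measure_zero[where \<U> = "\<lambda>n. hits \<psi> a (Suc n)" and d = ?d
        and N = "\<lambda>n. 3 * C * s ^ Suc n" and D = "insert 0 (\<Union>n. breaks cuts n)"])
    show "finite (hits \<psi> a (Suc n))" "real (card (hits \<psi> a (Suc n))) \<le> 3 * C * s ^ Suc n" for n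
      using hits_card[OF C(2)[of "Suc n"], of \<psi> a] by blast+
    show "bounded U \<and> diameter U \<le> ?d n" if "U \<in> hits \<psi> a (Suc n)" for n U
      using hits_diameter[OF that] pos[of "real (Suc n)"] by simp
    show "countable (insert 0 (\<Union>n. breaks cuts n))"
      using finite_breaks[OF cutset_cuts] by (auto intro!: countable_UN intro: countable_finite)
    show "target_set T \<psi> a \<subseteq> insert 0 (\<Union>n. breaks cuts n) \<union> (\<Union>n\<in>{m..}. \<Union>(hits \<psi> a (Suc n)))" for m
    proof
      fix x assume x: "x \<in> target_set T \<psi> a"
      then obtain n where n: "n > m" "int_dist ((T ^^ n) x - a) \<le> \<psi> (real n)"
        by (auto simp: target_set_def INFM_nat)
      obtain n' where n': "n = Suc n'" "n' \<ge> m" using n(1) by (cases n) auto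
      show "x \<in> insert 0 (\<Union>n. breaks cuts n) \<union> (\<Union>n\<in>{m..}. \<Union>(hits \<psi> a (Suc n)))"
      proof (cases "x \<in> insert 0 (\<Union>n. breaks cuts n)")
        case False
        then have "x \<in> {0<..<1} - breaks cuts n" using x by (auto simp: target_set_def order_le_less)
        then have "x \<in> \<Union>(hits \<psi> a (Suc n'))" using hits_cover n(2) a unfolding n'(1) by blast
        then show ?thesis using n'(2) by blast
      qed blast
    qed
    have inv: "(\<lambda>n. 1 / s ^ Suc n) \<longlonglongrightarrow> 0"
      using LIMSEQ_Suc[OF LIMSEQ_inverse_realpow_zero[OF beta]] by (simp add: divide_inverse)
    have le1: "\<psi> (real (Suc n)) \<le> \<psi> 1" for n
      using monotone_onD[OF anti, of 1 "real (Suc n)"] by simp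
    show "?d \<longlonglongrightarrow> 0"
    proof (rule tendsto_sandwich[OF always_eventually always_eventually])
      show "\<forall>n. 0 \<le> ?d n" using pos[of "real (Suc _)"] by (simp add: less_imp_le)
      show "\<forall>n. ?d n \<le> 2 * \<psi> 1 * (1 / s ^ Suc n)"
      proof
        fix n
        have "2 * \<psi> (real (Suc n)) * (1 / s ^ Suc n) \<le> 2 * \<psi> 1 * (1 / s ^ Suc n)"
          using le1[of n] by (intro mult_right_mono) auto
        then show "?d n \<le> 2 * \<psi> 1 * (1 / s ^ Suc n)" by simp
      qed
      show "(\<lambda>n. 2 * \<psi> 1 * (1 / s ^ Suc n)) \<longlonglongrightarrow> 0" using tendsto_mult_right_zero[OF inv] .
    qed simp
    define q where "q = exp (ln s - t * (l + ln s))"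
    have q: "q > 0" "q < 1" using tl by (auto simp: q_def)
    have "\<forall>\<^sub>F n in sequentially. ereal l < ereal (- ln (\<psi> (real n)) / real n)"
      using less_LiminfD[OF l[unfolded lower_order_def]] .
    then obtain M where M: "\<And>n. n \<ge> M \<Longrightarrow> l < - ln (\<psi> (real n)) / real n"
      by (auto simp: eventually_sequentially)
    show "summable (\<lambda>n. 3 * C * s ^ Suc n * ?d n powr t)"
    proof (rule summable_comparison_test')
      show "summable (\<lambda>n. (3 * C * 2 powr t) * q ^ Suc n)"
        using q by (subst summable_Suc_iff) (intro summable_mult summable_geometric, simp)
      fix n assume n: "n \<ge> M"
      let ?m = "Suc n"
      have psi: "\<psi> (real ?m) > 0" using pos by simp
      have "ln (\<psi> (real ?m)) < - l * real ?m" using M[of ?m] n by (simp add: field_simps)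
      then have "\<psi> (real ?m) < exp (- l * real ?m)" using psi by (metis exp_less_mono exp_ln)
      moreover note sm = power_eq_exp[of ?m]
      ultimately have "?d n \<le> 2 * exp (- l * real ?m) / exp (ln s * real ?m)"
        by (simp only: sm) (simp add: divide_right_mono)
      also have "\<dots> = 2 * exp (- (l + ln s) * real ?m)"
        unfolding times_divide_eq_right[symmetric] exp_diff[symmetric] by (simp add: algebra_simps)
      finally have "?d n powr t \<le> (2 * exp (- (l + ln s) * real ?m)) powr t"
        using psi beta t by (intro powr_mono2) auto
      also have "\<dots> = 2 powr t * exp (- t * (l + ln s) * real ?m)"
        by (simp add: powr_mult exp_powr_real algebra_simps)
      finally have "3 * C * s ^ ?m * ?d n powr t \<le> 3 * C * s ^ ?m * (2 powr t * exp (- t * (l + ln s) * real ?m))"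
        using C(1) by (intro mult_left_mono) auto
      also have "\<dots> = 3 * C * 2 powr t * (exp (ln s * real ?m) * exp (- t * (l + ln s) * real ?m))"
        unfolding sm by (simp add: mult_ac)
      also have "exp (ln s * real ?m) * exp (- t * (l + ln s) * real ?m) = q ^ ?m"
        unfolding q_def exp_of_nat2_mult[symmetric] exp_add[symmetric] by (simp add: algebra_simps)
      finally show "norm (3 * C * s ^ Suc n * ?d n powr t) \<le> 3 * C * 2 powr t * q ^ Suc n"
        using C(1) by simp
    qed
  qed (rule t)
qed

end

section \<open>The lower bound\<close>

text \<open>All intervals meeting \<open>X\<close> lie within distance \<open>d + g\<close> of one
  point of \<open>X\<close>; being disjoint, they have total length at most
  \<open>2 * d + 2 * g\<close>.\<close>

lemma card_meeting_le:
  fixes X :: "real set"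
  assumes "finite \<H>" "pairwise disjnt \<H>" "\<And>H. H \<in> \<H> \<Longrightarrow> oint H \<and> len H = g" "g > 0"
    "\<And>x y. x \<in> X \<Longrightarrow> y \<in> X \<Longrightarrow> \<bar>x - y\<bar> \<le> d" "d \<ge> 0"
  shows "real (card {H \<in> \<H>. H \<inter> X \<noteq> {}}) \<le> 2 * d / g + 2"
proof (cases "X = {}")
  case True
  then show ?thesis using assms(4,6) by simp
next
  case False
  then obtain x0 where x0: "x0 \<in> X" by blast
  let ?M = "{H \<in> \<H>. H \<inter> X \<noteq> {}}"
  have sub: "H \<subseteq> {x0 - d - g<..<x0 + d + g}" if HM: "H \<in> ?M" for H
  proof -
    obtain x where x: "x \<in> H" "x \<in> X" using HM by blast
    obtain u v where uv: "H = {u<..<v}" "len H = v - u"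
      using assms(3)[of H] HM by (metis (mono_tags, lifting) mem_Collect_eq ointE)
    have "\<bar>x - x0\<bar> \<le> d" using assms(5) x x0 by blast
    moreover have "v - u = g" using assms(3)[of H] HM uv(2) by simp
    ultimately show ?thesis using x(1) unfolding uv(1) by auto
  qed
  have "real (card ?M) * g = (\<Sum>H\<in>?M. len H)" using assms(3) by simp
  also have "\<dots> \<le> len {x0 - d - g<..<x0 + d + g}"
    using assms sub by (intro sum_len_le) (auto simp: pairwise_def)
  also have "\<dots> = 2 * d + 2 * g" using assms(4,6) by simp
  finally show ?thesis using assms(4) by (simp add: field_simps)
qed

text \<open>\<open>h\<close> is the length of the children and \<open>g\<close> that of disjoint
  cells holding one child each, so children are as spread out as cells. The factor 8 leaves room for
  discarding half of the children and for small covering sets that meet up to four of them.\<close>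

definition child_family ::
  "(real set \<Rightarrow> bool) \<Rightarrow> real \<Rightarrow> real \<Rightarrow> real set \<Rightarrow> real set set \<Rightarrow> real \<Rightarrow> real \<Rightarrow> bool" where
  "child_family Q c t I \<C> h g \<longleftrightarrow>
     finite \<C> \<and> (\<forall>J\<in>\<C>. Q J \<and> closure J \<subseteq> I \<and> len J = h) \<and>
     0 < h \<and> h \<le> g \<and> h \<le> len I / 2 \<and> c * len I \<le> real (card \<C>) * g \<and>
     8 * len I powr t \<le> real (card \<C>) * h powr t \<and>
     (\<forall>X e. (\<forall>x\<in>X. \<forall>y\<in>X. \<bar>x - y\<bar> \<le> e) \<longrightarrow> 0 \<le> e \<longrightarrow>
        real (card {J \<in> \<C>. J \<inter> X \<noteq> {}}) \<le> 2 * e / g + 2)"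

text \<open>
  A mass distribution argument without a measure: along a sequence of nested intervals \<open>I\<close> one keeps
  the total \<open>t\<close>-dimensional size of the covering sets meeting \<open>I\<close> below \<open>(\<rho> \<cdot> len I) powr t\<close>.
  Covering sets that are large compared with the children of \<open>I\<close> meet fewer than half of these,
  and a child with at most average load by small covering sets is found among the remaining ones.
\<close>

locale avoiding =
  fixes U :: "nat \<Rightarrow> real set" and d :: "nat \<Rightarrow> real" and t c :: real
    and G :: "real set \<Rightarrow> bool" and R :: "nat \<Rightarrow> real set \<Rightarrow> bool"
  assumes t: "0 < t" "t < 1" and c: "0 < c" "c \<le> 1"
    and d_pos: "\<And>i. d i > 0" and d_diam: "\<And>i x y. x \<in> U i \<Longrightarrow> y \<in> U i \<Longrightarrow> \<bar>x - y\<bar> \<le> d i"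
    and d_summable: "summable (\<lambda>i. d i powr t)"
    and G_oint: "\<And>I. G I \<Longrightarrow> oint I"
    and children: "\<And>I k. G I \<Longrightarrow> \<exists>\<C> h g. child_family (\<lambda>J. G J \<and> R k J) c t I \<C> h g"
begin

definition load :: "real set \<Rightarrow> nat \<Rightarrow> real" where
  "load I i = (if U i \<inter> I \<noteq> {} then d i powr t else 0)"

text \<open>With 16, the diameters of the large covering sets account for at most an eighth of the
  children in \<open>light_step\<close>.\<close>

definition \<rho> :: real where "\<rho> = c / 16"

definition light :: "real set \<Rightarrow> bool" where
  "light I \<longleftrightarrow> G I \<and> (\<Sum>i. load I i) < (\<rho> * len I) powr t"

lemma load_nonneg: "0 \<le> load I i"
  by (simp add: load_def)

lemma load_summable: "summable (load I)"
  by (rule summable_comparison_test'[OF d_summable, of 0]) (simp add: load_def)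

lemma load_le_sum: "load I i \<le> (\<Sum>i. load I i)"
  using sum_le_suminf[OF load_summable, of "{i}" I] load_nonneg by simp

lemma rho: "0 < \<rho>" "\<rho> \<le> 1"
  using c by (auto simp: \<rho>_def)

text \<open>The load of one set is at most the total load. Hence no set can meet all members of a
  sequence of light intervals whose lengths tend to 0.\<close>

lemma light_small:
  assumes "light I" "U i \<inter> I \<noteq> {}"
  shows "d i < \<rho> * len I"
proof -
  have "d i powr t < (\<rho> * len I) powr t"
    using load_le_sum[of I i] assms by (simp add: load_def light_def)
  moreover have "0 \<le> \<rho> * len I" using rho by simp
  ultimately show ?thesis using t powr_mono2[of t "\<rho> * len I" "d i"] by force
qed

lemma light_step:
  assumes "light I"
  shows "\<exists>J. light J \<and> R k J \<and> closure J \<subseteq> I \<and> len J \<le> len I / 2"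
proof -
  have GI: "G I" and SI: "(\<Sum>i. load I i) < (\<rho> * len I) powr t" using assms by (auto simp: light_def)
  have lenI: "len I > 0" using oint_len_pos[OF G_oint[OF GI]] .
  obtain \<C> h g where cf: "child_family (\<lambda>J. G J \<and> R k J) c t I \<C> h g"
    using children[OF GI, of k] by blast
  have fin: "finite \<C>" and h: "0 < h" "h \<le> g" "h \<le> len I / 2"
    and Mg: "c * len I \<le> real (card \<C>) * g" and Mh: "8 * len I powr t \<le> real (card \<C>) * h powr t"
    using cf by (simp_all add: child_family_def)
  have ch: "G J \<and> R k J \<and> closure J \<subseteq> I \<and> len J = h" if "J \<in> \<C>" for J
    using cf that by (simp add: child_family_def)
  have meet: "real (card {J \<in> \<C>. J \<inter> X \<noteq> {}}) \<le> 2 * e / g + 2"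
    if "\<And>x y. x \<in> X \<Longrightarrow> y \<in> X \<Longrightarrow> \<bar>x - y\<bar> \<le> e" "0 \<le> e" for X e
    using cf that by (simp add: child_family_def)
  have g: "g > 0" using h by simp
  define M where "M = real (card \<C>)"
  have Mpos: "M > 0"
  proof -
    have "M * g > 0" using Mg c lenI unfolding M_def by (meson mult_pos_pos order_less_le_trans)
    then show ?thesis using g by (simp add: zero_less_mult_iff)
  qed
  define B where "B = {i. U i \<inter> I \<noteq> {} \<and> d i \<ge> \<rho> * h}"
  have \<rho>h: "\<rho> * h > 0" using rho h by simp
  have B_load: "load I i = d i powr t" "load I i \<ge> (\<rho> * h) powr t" if "i \<in> B" for i
    using that \<rho>h t powr_mono2[of t "\<rho> * h" "d i"] by (auto simp: B_def load_def)
  have finB: "finite B"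
  proof -
    have "\<forall>\<^sub>F i in sequentially. load I i < (\<rho> * h) powr t"
      using order_tendstoD(2)[OF summable_LIMSEQ_zero[OF load_summable], of "(\<rho> * h) powr t" I] rho h by simp
    then obtain n where "\<And>i. i \<ge> n \<Longrightarrow> load I i < (\<rho> * h) powr t" by (auto simp: eventually_sequentially)
    then have "B \<subseteq> {..<n}" using B_load(2) by (force simp: not_le[symmetric])
    then show ?thesis by (rule finite_subset) simp
  qed
  have sumB: "(\<Sum>i\<in>B. load I i) \<le> (\<Sum>i. load I i)"
    using finB load_nonneg by (intro sum_le_suminf load_summable) auto
  \<comment> \<open>Each member of \<open>B\<close> loads \<open>I\<close> with at least
    \<open>(\<rho> * h) powr t\<close>, and
    \<open>8 * len I powr t \<le> M * h powr t\<close>.\<close>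
  have cardB: "real (card B) \<le> M / 8"
  proof -
    have "real (card B) * (\<rho> * h) powr t \<le> (\<Sum>i\<in>B. load I i)"
      using sum_mono[of B "\<lambda>_. (\<rho> * h) powr t" "load I"] B_load(2) by simp
    also have "\<dots> \<le> (\<rho> * len I) powr t" using sumB SI by simp
    finally have "real (card B) * h powr t \<le> len I powr t"
      using rho h lenI by (simp add: powr_mult)
    then have "8 * (real (card B) * h powr t) \<le> M * h powr t" using Mh unfolding M_def by linarith
    then show ?thesis using h by simp
  qed
  \<comment> \<open>Splits \<open>d i\<close> as \<open>d i powr t * d i powr (1 - t)\<close> and
    bounds the second factor by \<open>light_small\<close>; this is where \<open>t < 1\<close>
    enters.\<close>
  have sum_d: "(\<Sum>i\<in>B. d i) \<le> \<rho> * len I"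
  proof -
    have "(\<Sum>i\<in>B. d i) \<le> (\<Sum>i\<in>B. load I i * (\<rho> * len I) powr (1 - t))"
    proof (rule sum_mono)
      fix i assume i: "i \<in> B"
      then have "d i < \<rho> * len I" using light_small[OF assms] by (simp add: B_def)
      then have "d i powr (1 - t) \<le> (\<rho> * len I) powr (1 - t)"
        using t d_pos[of i] by (intro powr_mono2) auto
      then have "d i powr t * d i powr (1 - t) \<le> load I i * (\<rho> * len I) powr (1 - t)"
        using B_load(1)[OF i] by (simp add: mult_left_mono)
      then show "d i \<le> load I i * (\<rho> * len I) powr (1 - t)"
        using d_pos[of i] by (simp flip: powr_add)
    qed
    also have "\<dots> = (\<Sum>i\<in>B. load I i) * (\<rho> * len I) powr (1 - t)" by (simp add: sum_distrib_right)
    also have "\<dots> \<le> (\<rho> * len I) powr t * (\<rho> * len I) powr (1 - t)"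
      using sumB SI by (intro mult_right_mono) auto
    also have "\<dots> = \<rho> * len I" using rho lenI by (simp flip: powr_add)
    finally show ?thesis .
  qed
  define K where "K = (\<Union>i\<in>B. {J \<in> \<C>. J \<inter> U i \<noteq> {}})"
  \<comment> \<open>\<open>M / 8\<close> comes from the diameters and \<open>2 * (M / 8)\<close>
    from the additive constant 2.\<close>
  have "real (card K) \<le> M / 2"
  proof -
    have "card K \<le> (\<Sum>i\<in>B. card {J \<in> \<C>. J \<inter> U i \<noteq> {}})"
      unfolding K_def by (rule card_UN_le[OF finB])
    then have "real (card K) \<le> (\<Sum>i\<in>B. real (card {J \<in> \<C>. J \<inter> U i \<noteq> {}}))"
      by (simp flip: of_nat_sum)
    also have "\<dots> \<le> (\<Sum>i\<in>B. 2 * d i / g + 2)"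
      using d_diam d_pos by (intro sum_mono meet) (auto intro: less_imp_le)
    also have "\<dots> = 2 / g * (\<Sum>i\<in>B. d i) + 2 * real (card B)"
      by (simp add: sum.distrib sum_distrib_left)
    also have "2 / g * (\<Sum>i\<in>B. d i) \<le> 2 / g * (M * g / 16)"
      using sum_d Mg g unfolding \<rho>_def M_def by (intro mult_left_mono) auto
    also have "2 / g * (M * g / 16) + 2 * real (card B) \<le> M / 2"
      using cardB g Mpos by simp
    finally show ?thesis by simp
  qed
  moreover define S where "S = \<C> - K"
  have "K \<subseteq> \<C>" by (auto simp: K_def)
  ultimately have cardS: "real (card S) \<ge> M / 2"
    using fin finite_subset[OF \<open>K \<subseteq> \<C>\<close> fin] card_mono[OF fin \<open>K \<subseteq> \<C>\<close>]
    unfolding S_def M_def by (simp add: card_Diff_subset)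
  have finS: "finite S" using fin by (simp add: S_def)
  \<comment> \<open>A covering set that meets \<open>I\<close> and is not in \<open>B\<close> is
    shorter than \<open>g\<close>, so it meets at most \<open>2 + 2\<close> children.\<close>
  have total: "(\<Sum>J\<in>S. \<Sum>i. load J i) \<le> 4 * (\<Sum>i. load I i)"
  proof -
    have "(\<Sum>J\<in>S. \<Sum>i. load J i) = (\<Sum>i. \<Sum>J\<in>S. load J i)"
      using load_summable by (intro suminf_sum[symmetric]) auto
    also have "\<dots> \<le> (\<Sum>i. 4 * load I i)"
    proof (rule suminf_le)
      fix i
      show "(\<Sum>J\<in>S. load J i) \<le> 4 * load I i"
      proof (cases "(\<exists>J\<in>S. U i \<inter> J \<noteq> {})")
        case False
        then have "(\<Sum>J\<in>S. load J i) = 0" by (intro sum.neutral) (auto simp: load_def)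
        then show ?thesis using load_nonneg[of I i] by simp
      next
        case True
        then obtain J where J: "J \<in> S" "U i \<inter> J \<noteq> {}" by blast
        then have JC: "J \<in> \<C>" "J \<notin> K" by (auto simp: S_def)
        then have "J \<subseteq> I" using ch[OF JC(1)] closure_subset by blast
        then have UI: "U i \<inter> I \<noteq> {}" using J(2) by blast
        have "i \<notin> B" using JC J(2) by (auto simp: K_def)
        then have "d i < \<rho> * h" using UI by (auto simp: B_def)
        also have "\<dots> \<le> 1 * g" using rho h by (intro mult_mono) auto
        finally have dg: "d i / g \<le> 1" using g by simp
        have "(\<Sum>J\<in>S. load J i) = (\<Sum>J\<in>{J \<in> S. J \<inter> U i \<noteq> {}}. d i powr t)"
          using finS by (intro sum.mono_neutral_cong_right) (auto simp: load_def)
        also have "\<dots> = real (card {J \<in> S. J \<inter> U i \<noteq> {}}) * d i powr t" by simp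
        also have "\<dots> \<le> 4 * d i powr t"
        proof (rule mult_right_mono)
          have "real (card {J \<in> S. J \<inter> U i \<noteq> {}}) \<le> real (card {J \<in> \<C>. J \<inter> U i \<noteq> {}})"
            using fin by (intro of_nat_mono card_mono) (auto simp: S_def)
          also have "\<dots> \<le> 2 * d i / g + 2"
            using d_diam d_pos by (intro meet) (auto intro: less_imp_le)
          also have "\<dots> \<le> 4" using dg by simp
          finally show "real (card {J \<in> S. J \<inter> U i \<noteq> {}}) \<le> 4" .
        qed simp
        finally show ?thesis using UI by (simp add: load_def)
      qed
    qed (use load_summable in \<open>auto intro: summable_sum summable_mult\<close>)
    also have "\<dots> = 4 * (\<Sum>i. load I i)" by (rule suminf_mult[OF load_summable])
    finally show ?thesis .
  qed
  \<comment> \<open>Otherwise the children in \<open>S\<close>, at least \<open>M / 2\<close> of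
    them, would carry a load of at least \<open>4 * (\<rho> * len I) powr t\<close>.\<close>
  have "\<exists>J\<in>S. (\<Sum>i. load J i) < (\<rho> * h) powr t"
  proof (rule ccontr)
    assume "\<not> ?thesis"
    then have "real (card S) * (\<rho> * h) powr t \<le> (\<Sum>J\<in>S. \<Sum>i. load J i)"
      using sum_mono[of S "\<lambda>_. (\<rho> * h) powr t" "\<lambda>J. \<Sum>i. load J i"] by (simp add: not_less)
    also have "\<dots> < 4 * (\<rho> * len I) powr t" using total SI by linarith
    finally have "real (card S) * h powr t < 4 * len I powr t"
      using rho h lenI by (simp add: powr_mult)
    moreover have "M / 2 * h powr t \<le> real (card S) * h powr t" using cardS by (intro mult_right_mono) auto
    ultimately show False using Mh unfolding M_def by linarith
  qed
  then obtain J where J: "J \<in> S" "(\<Sum>i. load J i) < (\<rho> * h) powr t" by blast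
  then have "J \<in> \<C>" by (simp add: S_def)
  from ch[OF this] show ?thesis using J(2) h(3) by (intro exI[of _ J]) (auto simp: light_def)
qed

text \<open>Iterating \<open>light_step\<close> gives nested closures with a common point. A
  covering set containing it would meet every interval of the sequence, so its positive size would
  be bounded by lengths tending to 0.\<close>

lemma avoiding_point:
  assumes "light I"
  shows "\<exists>x\<in>I. (\<forall>i. x \<notin> U i) \<and> (\<forall>k. \<exists>J. x \<in> J \<and> R k J)"
proof -
  have "\<exists>f. \<forall>n. (light (f n) \<and> (n = 0 \<longrightarrow> f n = I)) \<and>
      (R n (f (Suc n)) \<and> closure (f (Suc n)) \<subseteq> f n \<and> len (f (Suc n)) \<le> len (f n) / 2)"
  proof (rule dependent_nat_choice)
    show "\<exists>J. light J \<and> (0 = (0::nat) \<longrightarrow> J = I)" using assms by blast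
    show "\<exists>J'. (light J' \<and> (Suc n = 0 \<longrightarrow> J' = I)) \<and> R n J' \<and> closure J' \<subseteq> J \<and> len J' \<le> len J / 2"
      if "light J \<and> (n = 0 \<longrightarrow> J = I)" for J n
      using light_step[of J n] that by blast
  qed
  then obtain f where f: "\<And>n. light (f n)" "f 0 = I" "\<And>n. R n (f (Suc n))"
    "\<And>n. closure (f (Suc n)) \<subseteq> f n" "\<And>n. len (f (Suc n)) \<le> len (f n) / 2" by blast
  have oi: "oint (f n)" for n using f(1) G_oint by (auto simp: light_def)
  have "\<Inter>(range (\<lambda>n. closure (f n))) \<noteq> {}"
  proof (rule compact_nest)
    show "compact (closure (f n))" for n
      using oi[of n] by (elim ointE) simp
    show "closure (f n) \<noteq> {}" for n using oint_nonempty[OF oi[of n]] by simp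
    have "closure (f (Suc n)) \<subseteq> closure (f n)" for n using f(4)[of n] closure_subset by blast
    then show "m \<le> n \<Longrightarrow> closure (f n) \<subseteq> closure (f m)" for m n
      by (rule lift_Suc_antimono_le)
  qed
  then obtain x where "\<And>n. x \<in> closure (f n)" by auto
  then have x: "x \<in> f n" for n using f(4)[of n] by blast
  have len_f: "len (f n) \<le> len I * (1/2) ^ n" for n
  proof (induction n)
    case (Suc n)
    then show ?case using f(5)[of n] by simp
  qed (simp add: f(2))
  have "x \<notin> U i" for i
  proof
    assume "x \<in> U i"
    then have "d i < \<rho> * len (f n)" for n using light_small[OF f(1)] x by blast
    then have "d i \<le> \<rho> * (len I * (1/2) ^ n)" for n
      using mult_left_mono[OF len_f[of n], of \<rho>] rho by (smt (verit))
    moreover have "(\<lambda>n. \<rho> * (len I * (1/2) ^ n)) \<longlonglongrightarrow> \<rho> * (len I * 0)"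
      by (intro tendsto_intros LIMSEQ_realpow_zero) auto
    ultimately have "d i \<le> \<rho> * (len I * 0)" by (intro LIMSEQ_le_const) auto
    then show False using d_pos[of i] by simp
  qed
  then show ?thesis using x f(2,3) by (metis)
qed

end

lemma frequently_below_lower_order:
  assumes "lower_order \<psi> < ereal l" "\<And>x. x > 0 \<Longrightarrow> \<psi> x > 0"
  shows "\<exists>n\<ge>N. \<psi> (real n) > exp (- l * real n)"
proof (rule ccontr)
  assume no: "\<not> ?thesis"
  have "ereal l \<le> ereal (- ln (\<psi> (real n)) / real n)" if n: "n \<ge> max 1 N" for n
  proof -
    have psi: "\<psi> (real n) > 0" using assms(2) n by simp
    have "\<psi> (real n) \<le> exp (- l * real n)" using no n by (auto simp: not_less)
    then have "ln (\<psi> (real n)) \<le> - l * real n" using psi by (metis ln_exp ln_le_cancel_iff exp_gt_zero)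
    then show ?thesis using n by (simp add: field_simps)
  qed
  then have "\<forall>\<^sub>F n in sequentially. ereal l \<le> ereal (- ln (\<psi> (real n)) / real n)"
    unfolding eventually_sequentially by blast
  then have "ereal l \<le> lower_order \<psi>" unfolding lower_order_def by (rule Liminf_bounded)
  then show False using assms(1) by simp
qed

section \<open>Children of an interval, built from the dynamics\<close>

context beta_window
begin

text \<open>The affine formula makes sense on the whole line, so the closure is sent into the closed
  middle half, still inside \<open>V\<close>; injectivity brings it back into
  \<open>I\<close>.\<close>

lemma closure_middle:
  assumes "branch q I V"
  shows "closure {x \<in> I. (T ^^ q) x \<in> {\<eta>/4<..<3*\<eta>/4}} \<subseteq> I"
proof -
  obtain c where c: "\<And>x. x \<in> I \<Longrightarrow> (T ^^ q) x = \<beta> ^ q * x + c" "V = (\<lambda>x. \<beta> ^ q * x + c) ` I"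
    using assms by (elim branchE) (rule that)
  let ?F = "(\<lambda>x. \<beta> ^ q * x + c) -` {\<eta>/4..3*\<eta>/4}"
  have "closed ?F" by (intro closed_vimage continuous_intros)
  moreover have "{x \<in> I. (T ^^ q) x \<in> {\<eta>/4<..<3*\<eta>/4}} \<subseteq> ?F" using c(1) by auto
  ultimately have "closure {x \<in> I. (T ^^ q) x \<in> {\<eta>/4<..<3*\<eta>/4}} \<subseteq> ?F" by (intro closure_minimal)
  also have "?F \<subseteq> I"
  proof
    fix x assume "x \<in> ?F"
    then have "\<beta> ^ q * x + c \<in> V" using eta by auto
    then obtain y where "y \<in> I" "\<beta> ^ q * x + c = \<beta> ^ q * y + c" unfolding c(2) by blast
    then show "x \<in> I" using beta_nonzero by simp
  qed
  finally show ?thesis .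
qed

text \<open>Packs the left and the right case into one family \<open>w r\<close> of one-sided
  neighbourhoods of \<open>a\<close>.\<close>

lemma germ_sides:
  assumes "germ a"
  shows "\<exists>\<rho>0 w p. 0 < \<rho>0 \<and> \<rho>0 \<le> 1 \<and> reach p V (w \<rho>0) \<and>
    (\<forall>r. 0 < r \<longrightarrow> r \<le> \<rho>0 \<longrightarrow> oint (w r) \<and> len (w r) = r \<and> w r \<subseteq> w \<rho>0 \<and> (\<forall>y\<in>w r. \<bar>y - a\<bar> \<le> r))"
proof -
  obtain \<rho>0 p where \<rho>: "\<rho>0 > 0" "reach p V {a<..<a + \<rho>0} \<or> reach p V {a - \<rho>0<..<a}"
    using assms by (auto simp: germ_def)
  from \<rho>(2) show ?thesis
  proof
    assume r: "reach p V {a<..<a + \<rho>0}"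
    then have "\<rho>0 \<le> 1" using oint_len_le_1[OF reach_oint(1)[OF r] reach_oint(2)[OF r]] \<rho>(1) by simp
    then show ?thesis using r \<rho>(1)
      by (intro exI[of _ \<rho>0] exI[of _ "\<lambda>r. {a<..<a + r}"] exI[of _ p]) (auto intro: ointI)
  next
    assume r: "reach p V {a - \<rho>0<..<a}"
    then have "\<rho>0 \<le> 1" using oint_len_le_1[OF reach_oint(1)[OF r] reach_oint(2)[OF r]] \<rho>(1) by simp
    then show ?thesis using r \<rho>(1)
      by (intro exI[of _ \<rho>0] exI[of _ "\<lambda>r. {a - r<..<a}"] exI[of _ p]) (auto intro: ointI)
  qed
qed

text \<open>Three stages are composed: \<open>I\<close> to \<open>V\<close>, a member of
  \<open>\<A>\<close> to \<open>V\<close>, and \<open>B\<close> to \<open>V\<close>. The cells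
  \<open>H A\<close> are the pullbacks through the first two stages, of length
  \<open>\<eta> / s ^ (q + n)\<close>. They are disjoint and contain the children, so counting cells
  bounds the children meeting a set.\<close>

lemma pull_back_family:
  assumes I: "branch q I V" and fam: "\<forall>A\<in>\<A>. branch n A V \<and> A \<subseteq> {\<eta>/4<..<3*\<eta>/4}"
    and disj: "pairwise disjnt \<A>" and fin: "finite \<A>" and B: "B \<subseteq> V" "branch m B V"
  shows "\<exists>\<C>. finite \<C> \<and> card \<C> = card \<A> \<and>
    (\<forall>J\<in>\<C>. branch (q + n + m) J V \<and> closure J \<subseteq> I \<and> (\<forall>x\<in>J. (T ^^ (q + n)) x \<in> B)) \<and>
    (\<forall>X e. (\<forall>x\<in>X. \<forall>y\<in>X. \<bar>x - y\<bar> \<le> e) \<longrightarrow> 0 \<le> e \<longrightarrow>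
       real (card {J \<in> \<C>. J \<inter> X \<noteq> {}}) \<le> 2 * e / (\<eta> / s ^ (q + n)) + 2)"
proof -
  define H where "H A = {x \<in> I. (T ^^ q) x \<in> A}" for A
  define j where "j A = {x \<in> H A. (T ^^ (q + n)) x \<in> B}" for A
  have brH: "branch q (H A) A" if "A \<in> \<A>" for A
  proof -
    have "A \<subseteq> V" using bspec[OF fam that] eta by (auto simp: subset_eq)
    then show ?thesis unfolding H_def using branch_restrict[OF I] branch_oint(1) bspec[OF fam that] by blast
  qed
  have brHV: "branch (q + n) (H A) V" if "A \<in> \<A>" for A
    using branch_compose[OF brH[OF that]] bspec[OF fam that] by blast
  have brJ: "branch (q + n) (j A) B" if "A \<in> \<A>" for A
    unfolding j_def using branch_restrict[OF brHV[OF that] branch_oint(1)[OF B(2)] B(1)] .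
  have brJV: "branch (q + n + m) (j A) V" if "A \<in> \<A>" for A
    using branch_compose[OF brJ[OF that] B(2)] .
  have lenH: "len (H A) = \<eta> / s ^ (q + n)" if "A \<in> \<A>" for A
    using branch_oint(5)[OF brHV[OF that]] V_oint(3) beta by (simp add: field_simps)
  have disjH: "A = A'" if "A \<in> \<A>" "A' \<in> \<A>" "x \<in> H A" "x \<in> H A'" for A A' x
    using disj that unfolding H_def pairwise_def disjnt_def by blast
  have jH: "j A \<subseteq> H A" for A by (auto simp: j_def)
  have nej: "j A \<noteq> {}" if "A \<in> \<A>" for A
    using oint_nonempty[OF branch_oint(1)[OF brJ[OF that]]] .
  have injj: "inj_on j \<A>"
  proof (rule inj_onI)
    fix A A' assume A: "A \<in> \<A>" "A' \<in> \<A>" "j A = j A'"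
    obtain x where "x \<in> j A" using nej[OF A(1)] by blast
    then show "A = A'" using disjH[OF A(1,2)] jH A(3) by blast
  qed
  have injH: "inj_on H \<A>"
  proof (rule inj_onI)
    fix A A' assume A: "A \<in> \<A>" "A' \<in> \<A>" "H A = H A'"
    obtain x where "x \<in> j A" using nej[OF A(1)] by blast
    then show "A = A'" using disjH[OF A(1,2)] jH A(3) by blast
  qed
  have clos: "closure (j A) \<subseteq> I" if "A \<in> \<A>" for A
  proof -
    have "j A \<subseteq> {x \<in> I. (T ^^ q) x \<in> {\<eta>/4<..<3*\<eta>/4}}"
      using bspec[OF fam that] unfolding j_def H_def by blast
    then show ?thesis using closure_mono closure_middle[OF I] by blast
  qed
  have meet: "real (card {J \<in> j ` \<A>. J \<inter> X \<noteq> {}}) \<le> 2 * e / (\<eta> / s ^ (q + n)) + 2"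
    if "\<forall>x\<in>X. \<forall>y\<in>X. \<bar>x - y\<bar> \<le> e" "0 \<le> e" for X e
  proof -
    have "{J \<in> j ` \<A>. J \<inter> X \<noteq> {}} = j ` {A \<in> \<A>. j A \<inter> X \<noteq> {}}" by auto
    then have "card {J \<in> j ` \<A>. J \<inter> X \<noteq> {}} = card {A \<in> \<A>. j A \<inter> X \<noteq> {}}"
      using card_image[OF inj_on_subset[OF injj, of "{A \<in> \<A>. j A \<inter> X \<noteq> {}}"]] by auto
    also have "\<dots> \<le> card {A \<in> \<A>. H A \<inter> X \<noteq> {}}"
      using fin jH by (intro card_mono) auto
    also have "\<dots> = card (H ` {A \<in> \<A>. H A \<inter> X \<noteq> {}})"
      using card_image[OF inj_on_subset[OF injH, of "{A \<in> \<A>. H A \<inter> X \<noteq> {}}"]] by auto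
    also have "H ` {A \<in> \<A>. H A \<inter> X \<noteq> {}} = {K \<in> H ` \<A>. K \<inter> X \<noteq> {}}" by auto
    finally have "real (card {J \<in> j ` \<A>. J \<inter> X \<noteq> {}}) \<le> real (card {K \<in> H ` \<A>. K \<inter> X \<noteq> {}})"
      by (rule of_nat_mono)
    also have "\<dots> \<le> 2 * e / (\<eta> / s ^ (q + n)) + 2"
    proof (rule card_meeting_le)
      show "pairwise disjnt (H ` \<A>)" using disjH unfolding pairwise_def disjnt_def by blast
      show "oint K \<and> len K = \<eta> / s ^ (q + n)" if "K \<in> H ` \<A>" for K
        using that lenH branch_oint(1)[OF brH] by auto
    qed (use that fin eta beta in auto)
    finally show ?thesis .
  qed
  have "\<forall>J\<in>j ` \<A>. branch (q + n + m) J V \<and> closure J \<subseteq> I \<and> (\<forall>x\<in>J. (T ^^ (q + n)) x \<in> B)"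
    using brJV clos by (auto simp: j_def)
  then show ?thesis using fin card_image[OF injj] meet by (intro exI[of _ "j ` \<A>"]) simp
qed

text \<open>A child goes from \<open>I\<close> to \<open>V\<close>, along one of at least
  \<open>c1 * s ^ n\<close> branches back to \<open>V\<close>, into the target, and from there to
  \<open>V\<close>. Up to factors depending on \<open>I\<close> but not on \<open>N\<close>, there
  are at least \<open>s ^ N\<close> children of length at least
  \<open>exp (- (l * (1 + \<kappa>) + ln s) * N)\<close>; a large \<open>N\<close> lets the gap
  between the exponents win.\<close>

lemma dynamical_children:
  assumes "germ a" and pos: "\<forall>x>0. \<psi> x > 0" and anti: "antimono_on {0<..} \<psi>"
    and l: "l > 0" "lower_order \<psi> < ereal l" and t: "0 < t" "t * (l + ln s) < ln s"
  shows "\<exists>c>0. c \<le> 1 \<and> (\<forall>I k. (\<exists>q. branch q I V) \<longrightarrow> (\<exists>\<C> h g. child_family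
      (\<lambda>J. (\<exists>q. branch q J V) \<and> (\<exists>n\<ge>k. \<forall>x\<in>J. int_dist ((T ^^ n) x - a) \<le> \<psi> (real n))) c t I \<C> h g))"
proof -
  have lns: "ln s > 0" using beta by simp
  define gap where "gap = ln s - t * (l + ln s)"
  \<comment> \<open>The loss on the way back from the target may use up half of the gap:
    \<open>t * l * \<kappa> = gap / 2\<close>.\<close>
  define \<kappa> where "\<kappa> = gap / (2 * t * l)"
  have gap: "gap > 0" using t by (simp add: gap_def)
  have \<kappa>: "\<kappa> > 0" using gap t l by (simp add: \<kappa>_def)
  define \<sigma> where "\<sigma> = t * (l * (1 + \<kappa>) + ln s)"
  have "t * l * \<kappa> = gap / 2" using t l by (simp add: \<kappa>_def)
  then have \<sigma>: "\<sigma> < ln s" using gap unfolding \<sigma>_def gap_def by (simp add: algebra_simps)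
  obtain \<rho>0 w p where \<rho>0: "0 < \<rho>0" "\<rho>0 \<le> 1" and W: "reach p V (w \<rho>0)"
    and w: "\<And>r. 0 < r \<Longrightarrow> r \<le> \<rho>0 \<Longrightarrow> oint (w r) \<and> len (w r) = r \<and> w r \<subseteq> w \<rho>0 \<and> (\<forall>y\<in>w r. \<bar>y - a\<bar> \<le> r)"
    using germ_sides[OF assms(1)] by blast
  obtain c0 where c0: "c0 > 0" "\<And>I. oint I \<Longrightarrow> I \<subseteq> {0<..<1} \<Longrightarrow>
      \<exists>q. reach q I V \<and> \<eta> / s ^ q \<ge> c0 * len I powr (1 + \<kappa>)"
    using reach_V_quantitative[OF \<kappa>] by blast
  obtain c1 P where c1: "c1 > 0" "\<And>n. n \<ge> 1 \<Longrightarrow> \<exists>n'\<in>{n..n + P}. \<exists>\<A>. finite \<A> \<and> pairwise disjnt \<A> \<and>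
     (\<forall>A\<in>\<A>. branch n' A V \<and> A \<subseteq> {\<eta>/4<..<3*\<eta>/4}) \<and> c1 * s ^ n \<le> real (card \<A>)"
    using many_branches by blast
  \<comment> \<open>A delay of up to \<open>P\<close> steps in \<open>many_branches\<close> shortens
    the cells by at most the factor \<open>s ^ P\<close>.\<close>
  define c where "c = min 1 (c1 / s ^ P)"
  have c: "c > 0" "c \<le> 1" using c1 beta by (auto simp: c_def)
  have main: "\<exists>\<C> h g. child_family
      (\<lambda>J. (\<exists>q. branch q J V) \<and> (\<exists>n\<ge>k. \<forall>x\<in>J. int_dist ((T ^^ n) x - a) \<le> \<psi> (real n))) c t I \<C> h g"
    if I: "branch q I V" for I q k
  proof -
    have sp: "s ^ i > 0" for i using beta by simp
    define c2 where "c2 = c0 * \<rho>0 powr (1 + \<kappa>)"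
    have c2: "c2 > 0" using c0 \<rho>0 by (simp add: c2_def)
    \<comment> \<open>Collects the factors that depend on \<open>I\<close> through \<open>q\<close>;
      \<open>N\<close> is chosen only afterwards.\<close>
    define K where "K = c1 / s ^ (q + p + P) * c2 powr t"
    have K: "K > 0" using c1 c2 beta by (simp add: K_def)
    obtain N0 where N0: "8 / K < exp (ln s - \<sigma>) ^ N0"
      using real_arch_pow[of "exp (ln s - \<sigma>)"] \<sigma> by auto
    obtain n2 where n2: "2 < s ^ n2" using real_arch_pow[OF beta] by blast
    \<comment> \<open>\<open>N0\<close> beats the constant \<open>8 / K\<close>, \<open>k\<close>
      makes the hit late, \<open>n2\<close> provides the halving of lengths, and the rest ensures
      \<open>n \<ge> 2\<close>.\<close>
    obtain N where N: "N \<ge> N0 + k + q + p + P + n2 + 2" "\<psi> (real N) > exp (- l * real N)"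
      using frequently_below_lower_order[OF l(2)] pos by blast
    \<comment> \<open>The delay \<open>n' - n\<close> is at most \<open>P\<close>, so the actual hit
      at time \<open>q + n' + p\<close> comes no later than \<open>N\<close>.\<close>
    define n where "n = N - (q + p + P)"
    have n: "n \<ge> 2" "n + q + p + P = N" using N(1) by (auto simp: n_def)
    obtain n' \<A> where n': "n \<le> n'" "n' \<le> n + P" and \<A>: "finite \<A>" "pairwise disjnt \<A>"
      "\<forall>A\<in>\<A>. branch n' A V \<and> A \<subseteq> {\<eta>/4<..<3*\<eta>/4}" "c1 * s ^ n \<le> real (card \<A>)"
      using c1(2)[of n] n(1) by auto
    define r where "r = min (\<psi> (real N)) \<rho>0"
    have r: "0 < r" "r \<le> \<rho>0" "r \<le> \<psi> (real N)" using spec[OF pos, of "real N"] \<rho>0 n by (auto simp: r_def)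
    note wr = w[OF r(1,2)]
    have "w r \<subseteq> {0<..<1}" using wr reach_oint(2)[OF W] by blast
    then obtain u where u: "reach u (w r) V" "\<eta> / s ^ u \<ge> c0 * r powr (1 + \<kappa>)"
      using c0(2)[of "w r"] wr by auto
    obtain Q where Q: "Q \<subseteq> w r" "branch u Q V" using u(1) unfolding reach_def by blast
    have "reach p V Q" using reach_shrink[OF W] branch_oint(1)[OF Q(2)] Q(1) wr by blast
    then obtain B where B: "B \<subseteq> V" "branch p B Q" unfolding reach_def by blast
    obtain \<C> where \<C>: "finite \<C>" "card \<C> = card \<A>"
      "\<forall>J\<in>\<C>. branch (q + n' + (p + u)) J V \<and> closure J \<subseteq> I \<and> (\<forall>x\<in>J. (T ^^ (q + n')) x \<in> B)"
      "\<forall>X e. (\<forall>x\<in>X. \<forall>y\<in>X. \<bar>x - y\<bar> \<le> e) \<longrightarrow> 0 \<le> e \<longrightarrow>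
         real (card {J \<in> \<C>. J \<inter> X \<noteq> {}}) \<le> 2 * e / (\<eta> / s ^ (q + n')) + 2"
      using pull_back_family[OF I \<A>(3,2,1) B(1) branch_compose[OF B(2) Q(2)]] by (elim exE conjE) (rule that)
    define N' where "N' = q + n' + p"
    have N': "N' \<le> N" "N' \<ge> k" "N' \<ge> 1" using n n' N(1) by (auto simp: N'_def)
    define h where "h = \<eta> / s ^ (N' + u)"
    define g where "g = \<eta> / s ^ (q + n')"
    have hit: "int_dist ((T ^^ N') x - a) \<le> \<psi> (real N')" if "J \<in> \<C>" "x \<in> J" for J x
    proof -
      have "(T ^^ (q + n')) x \<in> B" using \<C>(3) that by blast
      then have "(T ^^ p) ((T ^^ (q + n')) x) \<in> Q" using B(2) by (auto simp: branch_def)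
      then have "(T ^^ N') x \<in> w r"
        using Q(1) funpow_add[of p "q + n'" T] by (auto simp: N'_def add.commute)
      then have "\<bar>(T ^^ N') x - a\<bar> \<le> r" using wr by blast
      also have "r \<le> \<psi> (real N)" by (rule r(3))
      also have "\<psi> (real N) \<le> \<psi> (real N')" using monotone_onD[OF anti, of "real N'" "real N"] N' by simp
      finally show ?thesis using int_dist_le[of "(T ^^ N') x - a" 0] by simp
    qed
    have lenJ: "len J = h" if "J \<in> \<C>" for J
    proof -
      have "branch (N' + u) J V" using bspec[OF \<C>(3) that] by (simp add: N'_def add.assoc)
      then show ?thesis using branch_oint(5) V_oint(3) sp by (fastforce simp: h_def field_simps)
    qed
    have lenI: "len I = \<eta> / s ^ q" using branch_oint(5)[OF I] V_oint(3) sp[of q] by (simp add: field_simps)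
    have hpos: "h > 0" using eta sp by (simp add: h_def)
    have hg: "h \<le> g" unfolding h_def g_def N'_def using eta beta
      by (intro divide_left_mono power_increasing mult_pos_pos) auto
    have card_pos: "real (card \<A>) > 0" using \<A>(4) c1(1) sp[of n] by (meson mult_pos_pos order_less_le_trans)
    have hhalf: "h \<le> len I / 2"
    proof -
      have "n2 \<le> n'" using n n' N(1) by simp
      then have "s ^ n2 \<le> s ^ n'" using beta by (intro power_increasing) auto
      then have "2 \<le> s ^ n'" using n2 by (simp only: order_less_imp_le order_less_le_trans)
      then have "len I / s ^ n' \<le> len I / 2"
        using lenI eta sp by (intro divide_left_mono) auto
      moreover have "g = len I / s ^ n'" by (simp add: g_def lenI power_add)
      ultimately show ?thesis using hg by linarith
    qed
    have cg: "c * len I \<le> real (card \<C>) * g"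
    proof -
      have "c * len I \<le> c1 / s ^ P * (\<eta> / s ^ q)"
        unfolding lenI using eta sp by (intro mult_right_mono) (auto simp: c_def)
      also have "\<dots> = c1 * s ^ n * (\<eta> / s ^ (q + n + P))" using beta_nonzero by (simp add: power_add)
      also have "\<dots> \<le> c1 * s ^ n * g" unfolding g_def using eta c1 beta n'
        by (intro mult_left_mono divide_left_mono power_increasing mult_pos_pos) auto
      also have "\<dots> \<le> real (card \<C>) * g" using \<A>(4) \<C>(2) hpos hg by (intro mult_right_mono) auto
      finally show ?thesis .
    qed
    have big: "8 * len I powr t \<le> real (card \<C>) * h powr t"
    proof -
      have "\<rho>0 * exp (- l * real N) \<le> \<rho>0 * 1" using l(1) \<rho>0 by (intro mult_left_mono) auto
      moreover have "\<rho>0 * exp (- l * real N) \<le> 1 * exp (- l * real N)" using \<rho>0 by (intro mult_right_mono) auto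
      ultimately have "\<rho>0 * exp (- l * real N) \<le> r" using N(2) unfolding r_def by linarith
      then have "(\<rho>0 * exp (- l * real N)) powr (1 + \<kappa>) \<le> r powr (1 + \<kappa>)"
        using \<rho>0 \<kappa> by (intro powr_mono2) auto
      then have "c2 * exp (- l * (1 + \<kappa>) * real N) \<le> c0 * r powr (1 + \<kappa>)"
        using c0(1) \<rho>0 by (simp add: c2_def powr_mult exp_powr_real mult_ac)
      then have "c2 * exp (- l * (1 + \<kappa>) * real N) \<le> \<eta> / s ^ u" using u(2) by linarith
      then have "c2 * exp (- l * (1 + \<kappa>) * real N) / s ^ N \<le> \<eta> / s ^ u / s ^ N'"
        using c2 N' beta sp eta by (intro frac_le power_increasing) auto
      also have "\<eta> / s ^ u / s ^ N' = h" by (simp add: h_def power_add mult.commute)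
      finally have "c2 * exp (- (l * (1 + \<kappa>) + ln s) * real N) \<le> h"
        unfolding power_eq_exp times_divide_eq_right[symmetric] exp_diff[symmetric]
        by (simp add: algebra_simps)
      then have "(c2 * exp (- (l * (1 + \<kappa>) + ln s) * real N)) powr t \<le> h powr t"
        using c2 t by (intro powr_mono2) auto
      then have "c2 powr t * exp (- \<sigma> * real N) \<le> h powr t"
        using c2 by (simp add: powr_mult exp_powr_real \<sigma>_def algebra_simps)
      moreover have "c1 / s ^ (q + p + P) * exp (ln s * real N) \<le> real (card \<C>)"
      proof -
        have "s ^ N = s ^ n * s ^ (q + p + P)" unfolding n(2)[symmetric] by (simp add: power_add)
        then have "c1 / s ^ (q + p + P) * s ^ N = c1 * s ^ n" using beta_nonzero by simp
        then show ?thesis using \<A>(4) \<C>(2) unfolding power_eq_exp by simp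
      qed
      ultimately have "(c1 / s ^ (q + p + P) * exp (ln s * real N)) * (c2 powr t * exp (- \<sigma> * real N))
          \<le> real (card \<C>) * h powr t"
        using c1(1) sp by (intro mult_mono) auto
      also have "(c1 / s ^ (q + p + P) * exp (ln s * real N)) * (c2 powr t * exp (- \<sigma> * real N)) =
          K * (exp (ln s * real N) * exp (- \<sigma> * real N))" by (simp add: K_def)
      also have "exp (ln s * real N) * exp (- \<sigma> * real N) = exp (ln s - \<sigma>) ^ N"
        unfolding exp_of_nat2_mult[symmetric] exp_add[symmetric] by (simp add: algebra_simps)
      finally have 1: "K * exp (ln s - \<sigma>) ^ N \<le> real (card \<C>) * h powr t" .
      have "exp (ln s - \<sigma>) ^ N0 \<le> exp (ln s - \<sigma>) ^ N" using \<sigma> N(1) by (intro power_increasing) auto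
      then have "8 / K \<le> exp (ln s - \<sigma>) ^ N" using N0 by linarith
      then have "8 \<le> K * exp (ln s - \<sigma>) ^ N" using K by (simp add: field_simps)
      moreover have "len I powr t \<le> 1"
        using oint_len_le_1[OF branch_oint(1)[OF I] branch_oint(3)[OF I]] oint_len_pos[OF branch_oint(1)[OF I]] t
        by (simp add: powr_le1)
      ultimately show ?thesis using 1 by linarith
    qed
    have "\<forall>J\<in>\<C>. ((\<exists>q. branch q J V) \<and> (\<exists>n\<ge>k. \<forall>x\<in>J. int_dist ((T ^^ n) x - a) \<le> \<psi> (real n))) \<and>
         closure J \<subseteq> I \<and> len J = h"
    proof (intro ballI conjI)
      fix J assume J: "J \<in> \<C>"
      show "\<exists>q. branch q J V" "closure J \<subseteq> I" using bspec[OF \<C>(3) J] by blast+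
      show "\<exists>n\<ge>k. \<forall>x\<in>J. int_dist ((T ^^ n) x - a) \<le> \<psi> (real n)"
        using hit[OF J] N'(2) by (intro exI[of _ N']) simp
      show "len J = h" by (rule lenJ[OF J])
    qed
    then have "child_family (\<lambda>J. (\<exists>q. branch q J V) \<and>
        (\<exists>n\<ge>k. \<forall>x\<in>J. int_dist ((T ^^ n) x - a) \<le> \<psi> (real n))) c t I \<C> h g"
      unfolding child_family_def using \<C>(1,4) hpos hg hhalf cg big by (simp add: g_def)
    then show ?thesis by blast
  qed
  then show ?thesis using c by blast
qed

text \<open>A cover witnessing measure 0 is fed into \<open>avoiding\<close>; the point of
  \<open>V\<close> obtained there hits the targets infinitely often and lies in no covering
  set.\<close>

lemma lower_bound:
  assumes "germ a" and pos: "\<forall>x>0. \<psi> x > 0" and anti: "antimono_on {0<..} \<psi>"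
    and l: "l > 0" "lower_order \<psi> < ereal l" and t0: "0 \<le> t0" "t0 * (l + ln s) < ln s"
  shows "hausdorff_measure t0 (target_set T \<psi> a) \<noteq> 0"
proof
  assume zero: "hausdorff_measure t0 (target_set T \<psi> a) = 0"
  have lns: "ln s > 0" using beta by simp
  have "t0 < ln s / (l + ln s)" using t0 l lns by (simp add: field_simps)
  \<comment> \<open>A slightly larger exponent is positive even for \<open>t0 = 0\<close>, as
    \<open>avoiding\<close> demands.\<close>
  then obtain t where t: "t0 < t" "t < ln s / (l + ln s)" using dense by blast
  have t1: "0 < t" "t * (l + ln s) < ln s" using t t0 l lns by (auto simp: field_simps)
  have "ln s / (l + ln s) < 1" using l lns by simp
  then have t2: "t < 1" using t by simp
  let ?R = "\<lambda>k J. \<exists>n\<ge>k. \<forall>x\<in>J. int_dist ((T ^^ n) x - a) \<le> \<psi> (real n)"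
  obtain c where c: "c > 0" "c \<le> 1" and ch: "\<forall>I k. (\<exists>q. branch q I V) \<longrightarrow>
      (\<exists>\<C> h g. child_family (\<lambda>J. (\<exists>q. branch q J V) \<and> ?R k J) c t I \<C> h g)"
    using dynamical_children[OF assms(1) pos anti l t1] by (elim exE conjE) (rule that)
  \<comment> \<open>This is \<open>(\<rho> * len V) powr t\<close>, the load below which
    \<open>V\<close> itself is light.\<close>
  define \<tau> where "\<tau> = (c / 16 * \<eta>) powr t"
  have \<tau>: "\<tau> > 0" using c eta by (simp add: \<tau>_def)
  \<comment> \<open>At scale 1 all diameters are at most 1, so passing from \<open>t0\<close> to the
    larger \<open>t\<close> does not increase the sum.\<close>
  have "hausdorff_premeasure t0 1 (target_set T \<psi> a) \<le> 0"
    unfolding zero[symmetric] hausdorff_measure_def by (intro SUP_upper) auto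
  then have "hausdorff_premeasure t0 1 (target_set T \<psi> a) < ennreal (\<tau> / 2)" using \<tau> by simp
  then obtain U where U: "target_set T \<psi> a \<subseteq> (\<Union>i. U i)" "\<And>i. bounded (U i)" "\<And>i. diameter (U i) \<le> 1"
    "(\<Sum>i. diam_powr t0 (U i)) < ennreal (\<tau> / 2)"
    unfolding hausdorff_premeasure_def by (auto simp: INF_less_iff)
  have dle: "ennreal (diameter (U i) powr t) \<le> diam_powr t0 (U i)" for i
  proof -
    have d0: "0 \<le> diameter (U i)" using U(2) by (rule diameter_ge_0)
    show ?thesis
    proof (cases "U i = {}")
      case False
      show ?thesis
      proof (cases "t0 = 0")
        case True
        have "diameter (U i) powr t \<le> 1" using d0 U(3)[of i] t1 by (intro powr_le1) auto
        then have "ennreal (diameter (U i) powr t) \<le> ennreal 1" by (rule ennreal_leI)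
        then show ?thesis using True False by (simp add: diam_powr_def)
      next
        case t0_pos: False
        have "diameter (U i) powr t \<le> diameter (U i) powr t0"
          using d0 U(3)[of i] t t0 by (intro powr_mono') auto
        then show ?thesis using t0_pos False by (simp add: diam_powr_def ennreal_leI)
      qed
    qed (simp add: diam_powr_def)
  qed
  have less: "(\<Sum>i. ennreal (diameter (U i) powr t)) < ennreal (\<tau> / 2)"
    using suminf_le[OF dle summableI summableI] U(4) by (rule order_le_less_trans)
  have summ: "summable (\<lambda>i. diameter (U i) powr t)"
  proof (rule summable_suminf_not_top)
    show "(\<Sum>i. ennreal (diameter (U i) powr t)) \<noteq> top"
      using less by (metis ennreal_less_top order_less_trans less_irrefl)
  qed simp
  have "(\<Sum>i. ennreal (diameter (U i) powr t)) = ennreal (\<Sum>i. diameter (U i) powr t)"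
    using summ by (intro suminf_ennreal2) simp
  then have sum_lt: "(\<Sum>i. diameter (U i) powr t) < \<tau> / 2"
    using less suminf_nonneg[OF summ] by (simp add: ennreal_less_iff)
  \<comment> \<open>Enlarges the diameters to positive sizes, also for singletons and empty sets;
    the added \<open>t\<close>-th powers sum to \<open>\<tau> / 2\<close>.\<close>
  define d where "d i = (diameter (U i) powr t + \<tau> / 2 * (1/2) ^ Suc i) powr (1 / t)" for i
  have dpos: "diameter (U i) powr t + \<tau> / 2 * (1/2) ^ Suc i > 0" for i
    using \<tau> by (intro add_nonneg_pos) auto
  have dt: "d i powr t = diameter (U i) powr t + \<tau> / 2 * (1/2) ^ Suc i" for i
    using dpos[of i] t1 by (simp add: d_def powr_powr)
  have half: "(\<lambda>i. \<tau> / 2 * (1/2) ^ Suc i) sums (\<tau> / 2 * 1)"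
    by (intro sums_mult power_half_series)
  have dsumm: "summable (\<lambda>i. d i powr t)" unfolding dt
    using summ half by (intro summable_add) (auto simp: sums_iff)
  have dsum: "(\<Sum>i. d i powr t) < \<tau>"
    unfolding dt using suminf_add[OF summ sums_summable[OF half]] sums_unique[OF half] sum_lt by simp
  interpret avoiding U d t c "\<lambda>I. \<exists>q. branch q I V" ?R
  proof
    show "d i > 0" for i using dpos[of i] by (simp add: d_def)
    show "\<bar>x - y\<bar> \<le> d i" if "x \<in> U i" "y \<in> U i" for i x y
    proof -
      have "\<bar>x - y\<bar> \<le> diameter (U i)"
        using diameter_bounded_bound[OF U(2) that] by (simp add: dist_real_def)
      also have "\<dots> = (diameter (U i) powr t) powr (1 / t)"
        using diameter_ge_0[OF U(2)] t1 by (simp add: powr_powr)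
      also have "\<dots> \<le> d i" unfolding d_def using t1 \<tau> by (intro powr_mono2) auto
      finally show ?thesis .
    qed
    show "oint I" if "\<exists>q. branch q I V" for I using that branch_oint(1) by blast
  qed (use t1 t2 c dsumm ch in blast)+
  have "light V"
  proof -
    have "(\<Sum>i. load V i) \<le> (\<Sum>i. d i powr t)"
      by (rule suminf_le[OF _ load_summable dsumm]) (simp add: load_def)
    also have "\<dots> < (\<rho> * len V) powr t" using dsum V_oint(3) by (simp add: \<tau>_def \<rho>_def)
    finally show ?thesis using branch_0[OF V_oint(1,2)] unfolding light_def by blast
  qed
  from avoiding_point[OF this] obtain x where x: "x \<in> V" "\<forall>i. x \<notin> U i"
    "\<forall>k. \<exists>J. x \<in> J \<and> ?R k J" by (elim bexE conjE) (rule that)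
  have "\<exists>\<^sub>\<infinity>n. int_dist ((T ^^ n) x - a) \<le> \<psi> (real n)"
    unfolding INFM_nat_le
  proof
    fix k
    obtain J where "x \<in> J" "?R k J" using spec[OF x(3), of k] by (elim exE) (erule conjE, rule that)
    then show "\<exists>n\<ge>k. int_dist ((T ^^ n) x - a) \<le> \<psi> (real n)" by auto
  qed
  then have "x \<in> target_set T \<psi> a" using x(1) V_oint(2) by (auto simp: target_set_def)
  then show False using U(1) x(2) by blast
qed

end

text \<open>By \<open>\<psi> (real n) \<le> \<psi> 1\<close> the quotients are bounded below by a
  sequence tending to 0.\<close>

lemma lower_order_nonneg:
  assumes "\<And>x. x > 0 \<Longrightarrow> \<psi> x > 0" "antimono_on {0<..} \<psi>"
  shows "0 \<le> lower_order \<psi>"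
proof -
  have "(\<lambda>n. ereal (- ln (\<psi> 1) / real n)) \<longlonglongrightarrow> ereal 0"
    unfolding lim_ereal by (rule lim_const_over_n)
  from lim_imp_Liminf[OF sequentially_bot this]
  have "0 = liminf (\<lambda>n. ereal (- ln (\<psi> 1) / real n))" unfolding zero_ereal_def by (rule sym)
  also have "\<dots> \<le> lower_order \<psi>"
    unfolding lower_order_def
  proof (rule Liminf_mono)
    show "\<forall>\<^sub>F n in sequentially. ereal (- ln (\<psi> 1) / real n) \<le> ereal (- ln (\<psi> (real n)) / real n)"
      unfolding eventually_sequentially
    proof (intro exI[of _ 1] allI impI)
      fix n :: nat assume n: "n \<ge> 1"
      have "\<psi> (real n) \<le> \<psi> 1" using monotone_onD[OF assms(2), of 1 "real n"] n by simp
      then have "ln (\<psi> (real n)) \<le> ln (\<psi> 1)" using assms(1)[of "real n"] n by simp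
      then show "ereal (- ln (\<psi> 1) / real n) \<le> ereal (- ln (\<psi> (real n)) / real n)"
        by (simp add: divide_right_mono)
    qed
  qed
  finally show ?thesis .
qed

theorem theorem7:
  fixes \<beta> a :: real and \<psi> :: "real \<Rightarrow> real" and \<mu> :: "real measure"
  assumes "\<bar>\<beta>\<bar> > 1"
    and "parry_yrrap_measure \<beta> \<mu>"
    and "\<And>x. x > 0 \<Longrightarrow> \<psi> x > 0"
    and "antimono_on {0<..} \<psi>"
    and "a \<in> measure_support \<mu>"
  shows "hausdorff_dim (target_set (beta_map \<beta>) \<psi> a)
           = ereal (ln \<bar>\<beta>\<bar>) / (lower_order \<psi> + ereal (ln \<bar>\<beta>\<bar>))"
proof -
  interpret beta_dynamics \<beta> using assms(1) by unfold_locales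
  obtain \<eta> where \<eta>: "\<eta> > 0" "\<eta> \<le> 1 / 2" "\<forall>J. oint J \<longrightarrow> J \<subseteq> {0<..<1} \<longrightarrow>
     (\<exists>n. reach n J {0<..<\<eta>}) \<and> (\<exists>n. reach n J {1 - \<eta><..<1})"
    using ex_window by blast
  interpret parry_window \<beta> \<eta> \<mu>
    by unfold_locales (use \<eta> assms(2) in auto)
  let ?W = "target_set T \<psi> a"
  have lns: "ln s > 0" using beta by simp
  have a: "a \<in> {0..1}" using support_subset assms(5) by blast
  have germ: "germ a" using support_germ[OF assms(5)] .
  have pos: "\<forall>x>0. \<psi> x > 0" using assms(3) by blast
  have upper: "hausdorff_dim ?W \<le> ereal t"
    if "t > 0" "ereal l < lower_order \<psi>" "t * (l + ln s) > ln s" for t l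
    unfolding hausdorff_dim_def
    using upper_bound[OF assms(3,4) a that] that(1) by (intro INF_lower) simp
  show ?thesis
  proof (cases "lower_order \<psi> = \<infinity>")
    case True
    have "hausdorff_dim ?W \<le> ereal t" if "t > 0" for t
    proof (rule upper[OF that])
      \<comment> \<open>Every real \<open>l\<close> is admissible here; this one gives
        \<open>t * (l + ln s) = ln s + t * ln s\<close>.\<close>
      show "ereal (ln s / t) < lower_order \<psi>" using True by simp
      show "t * (ln s / t + ln s) > ln s" using that lns by (simp add: distrib_left)
    qed
    then have "hausdorff_dim ?W \<le> 0" using ereal_le_epsilon2[of "hausdorff_dim ?W" 0] by simp
    moreover have "0 \<le> hausdorff_dim ?W"
      unfolding hausdorff_dim_def by (intro INF_greatest) auto
    ultimately show ?thesis using True by simp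
  next
    case False
    then obtain l where l: "lower_order \<psi> = ereal l" "l \<ge> 0"
      using lower_order_nonneg[OF assms(3,4)] by (cases "lower_order \<psi>") auto
    define t0 where "t0 = ln s / (l + ln s)"
    have t0: "t0 > 0" "t0 * (l + ln s) = ln s" using l lns by (auto simp: t0_def)
    have "hausdorff_dim ?W \<le> ereal t0"
    proof (rule dense_ge)
      fix y assume "ereal t0 < y"
      then obtain t where t: "ereal t0 < ereal t" "ereal t < y" using ereal_dense2 by blast
      have "t * (l + ln s) > ln s" using t t0 l lns mult_strict_right_mono[of t0 t "l + ln s"] by simp
      \<comment> \<open>\<open>t * e\<close> is half of the excess over \<open>ln s\<close>, so
        \<open>l - e\<close> keeps the inequality strict and lies strictly below the lower
        order.\<close>
      define e where "e = (t * (l + ln s) - ln s) / (2 * t)"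
      have e: "e > 0" using \<open>t * (l + ln s) > ln s\<close> t t0 by (simp add: e_def)
      have "t * e = (t * (l + ln s) - ln s) / 2" using t t0 by (simp add: e_def)
      then have "t * (l - e + ln s) > ln s" using \<open>t * (l + ln s) > ln s\<close> by (simp add: algebra_simps)
      then have "hausdorff_dim ?W \<le> ereal t" using t t0 e l by (intro upper[of t "l - e"]) auto
      then show "hausdorff_dim ?W \<le> y" using t(2) by simp
    qed
    moreover have "ereal t0 \<le> hausdorff_dim ?W"
      unfolding hausdorff_dim_def
    proof (rule INF_greatest)
      fix t assume t: "t \<in> {t. 0 \<le> t \<and> hausdorff_measure t ?W = 0}"
      show "ereal t0 \<le> ereal t"
      proof (rule ccontr)
        assume "\<not> ereal t0 \<le> ereal t"
        then have "t * (l + ln s) < ln s" using t0 l lns mult_strict_right_mono[of t t0 "l + ln s"] by simp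
        \<comment> \<open>The denominator contains \<open>t + 1\<close> because \<open>t\<close> may
          be 0; \<open>l + e\<close> is positive even if the lower order is 0.\<close>
        define e where "e = (ln s - t * (l + ln s)) / (2 * (t + 1))"
        have e: "e > 0" using \<open>t * (l + ln s) < ln s\<close> t by (simp add: e_def)
        have "x * (y / (2 * x)) = y / 2" if "x \<noteq> 0" for x y :: real using that by simp
        from this[of "t + 1"] have "(t + 1) * e = (ln s - t * (l + ln s)) / 2" using t by (simp only: e_def) simp
        then have "t * (l + e + ln s) < ln s" using \<open>t * (l + ln s) < ln s\<close> e by (simp add: algebra_simps)
        then show False using lower_bound[OF germ pos assms(4), of "l + e" t] t e l by simp
      qed
    qed
    ultimately have "hausdorff_dim ?W = ereal t0" by (rule antisym)
    also have "ereal t0 = ereal (ln s) / (lower_order \<psi> + ereal (ln s))"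
      using l lns by (simp add: t0_def)
    finally show ?thesis .
  qed
qed

end
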